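(* Let $p\ge 1$ and $q$ be coprime integers, and let $M$ be a closed connected $3$-manifold for which there is a simple-homotopy equivalence $f\colon M\to L(p,q)$ to the $3$-dimensional lens space $L(p,q)$. Then the action of $\pi_1(M)=\mathbb{Z}/p\mathbb{Z}$ by deck transformations on the universal cover $\widetilde M$ of $M$ embeds in a free orthogonal action on $S^7$; that is, there are a free action of $\mathbb{Z}/p\mathbb{Z}$ on the unit sphere $S^7\subset\mathbb{R}^8$ by orthogonal transformations and a $\mathbb{Z}/p\mathbb{Z}$-equivariant topological embedding $\widetilde M\to S^7$.
   Context: The lens space $L(p,q)$ is the quotient of the unit sphere $S^3\subset\mathbb{C}^2$ by the cyclic group of order $p$ generated by $(z_1,z_2)\mapsto(e^{2\pi i/p}z_1,e^{2\pi i q/p}z_2)$. *)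

theory Defs
  imports
    "HOL-Analysis.Analysis"
    "HOL-Algebra.Elementary_Groups"
    "HOL-Algebra.Group_Action"
begin

section \<open>Closed manifolds and lens spaces\<close>

text \<open>Second countability is not listed: it is automatic for compact locally Euclidean spaces.\<close>

definition closed_manifold :: "nat \<Rightarrow> 'a topology \<Rightarrow> bool" where
  "closed_manifold n M \<longleftrightarrow>
     compact_space M \<and> Hausdorff_space M \<and>
     (\<forall>x \<in> topspace M. \<exists>U V. x \<in> U \<and> openin M U \<and> openin (Euclidean_space n) V \<and>
        subtopology M U homeomorphic_space subtopology (Euclidean_space n) V)"

definition quotient_topology :: "'a topology \<Rightarrow> ('a \<Rightarrow> 'b) \<Rightarrow> 'b topology" where
  "quotient_topology X f =
     topology (\<lambda>U. U \<subseteq> f ` topspace X \<and> openin X {x \<in> topspace X. f x \<in> U})"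

lemma openin_quotient_topology:
  "openin (quotient_topology X f) U \<longleftrightarrow>
     U \<subseteq> f ` topspace X \<and> openin X {x \<in> topspace X. f x \<in> U}"
proof -
  have "istopology (\<lambda>U. U \<subseteq> f ` topspace X \<and> openin X {x \<in> topspace X. f x \<in> U})"
    unfolding istopology_def
  proof (intro conjI allI impI)
    fix S T
    assume S: "S \<subseteq> f ` topspace X \<and> openin X {x \<in> topspace X. f x \<in> S}"
      and T: "T \<subseteq> f ` topspace X \<and> openin X {x \<in> topspace X. f x \<in> T}"
    show "S \<inter> T \<subseteq> f ` topspace X" using S by blast
    have "{x \<in> topspace X. f x \<in> S \<inter> T} =
        {x \<in> topspace X. f x \<in> S} \<inter> {x \<in> topspace X. f x \<in> T}" by blast
    then show "openin X {x \<in> topspace X. f x \<in> S \<inter> T}" using S T by auto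
  next
    fix \<K>
    assume K: "\<forall>S\<in>\<K>. S \<subseteq> f ` topspace X \<and> openin X {x \<in> topspace X. f x \<in> S}"
    show "\<Union>\<K> \<subseteq> f ` topspace X" using K by blast
    have "{x \<in> topspace X. f x \<in> \<Union>\<K>} = \<Union>((\<lambda>S. {x \<in> topspace X. f x \<in> S}) ` \<K>)" by blast
    then show "openin X {x \<in> topspace X. f x \<in> \<Union>\<K>}" using K by auto
  qed
  then show ?thesis by (simp add: quotient_topology_def topology_inverse')
qed

lemma quotient_map_quotient_topology: "quotient_map X (quotient_topology X f) f"
proof -
  have "topspace (quotient_topology X f) = f ` topspace X"
  proof
    show "topspace (quotient_topology X f) \<subseteq> f ` topspace X"
      using openin_quotient_topology[THEN iffD1, OF openin_topspace] by (rule conjunct1)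
    have "{x \<in> topspace X. f x \<in> f ` topspace X} = topspace X" by blast
    then show "f ` topspace X \<subseteq> topspace (quotient_topology X f)"
      by (intro openin_subset) (simp add: openin_quotient_topology)
  qed
  then show ?thesis by (simp add: quotient_map_def openin_quotient_topology)
qed

definition lens_rotation :: "nat \<Rightarrow> int \<Rightarrow> complex \<times> complex \<Rightarrow> complex \<times> complex" where
  "lens_rotation p q z =
     (cis (2 * pi / real p) * fst z, cis (2 * pi * real_of_int q / real p) * snd z)"

text \<open>For \<open>p \<ge> 1\<close> the rotation has finite order, so its nonnegative powers form the cyclic
  group that it generates.\<close>

definition lens_orbit :: "nat \<Rightarrow> int \<Rightarrow> complex \<times> complex \<Rightarrow> (complex \<times> complex) set" where
  "lens_orbit p q z = range (\<lambda>k::nat. (lens_rotation p q ^^ k) z)"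

definition lens_space :: "nat \<Rightarrow> int \<Rightarrow> (complex \<times> complex) set topology" where
  "lens_space p q = quotient_topology (top_of_set (sphere 0 1)) (lens_orbit p q)"


section \<open>Simple-homotopy equivalences\<close>

text \<open>The definitions follow M. M. Cohen, \<^emph>\<open>A Course in Simple-Homotopy Theory\<close>.
  The balls parametrising cells are cubes in \<open>Euclidean_space n\<close>.  As all of these spaces live in
  the type \<open>nat \<Rightarrow> real\<close>, the face of \<open>cube (Suc m)\<close> on which the last coordinate vanishes
  is literally \<open>cube m\<close>.\<close>

definition cube :: "nat \<Rightarrow> (nat \<Rightarrow> real) set" where
  "cube n = {x. (\<forall>i<n. 0 \<le> x i \<and> x i \<le> 1) \<and> (\<forall>i\<ge>n. x i = 0)}"

definition open_cube :: "nat \<Rightarrow> (nat \<Rightarrow> real) set" where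
  "open_cube n = {x. (\<forall>i<n. 0 < x i \<and> x i < 1) \<and> (\<forall>i\<ge>n. x i = 0)}"

text \<open>A cell is a pair \<open>(n, e)\<close> of its dimension and the open cell itself, a subset of the space.\<close>

definition cells_union :: "(nat \<times> 'a set) set \<Rightarrow> 'a set" where
  "cells_union C = \<Union>(snd ` C)"

definition characteristic_map ::
  "'a topology \<Rightarrow> (nat \<times> 'a set) set \<Rightarrow> nat \<times> 'a set \<Rightarrow> ((nat \<Rightarrow> real) \<Rightarrow> 'a) \<Rightarrow> bool" where
  "characteristic_map X C c \<phi> \<longleftrightarrow>
     (case c of (n, e) \<Rightarrow>
        continuous_map (subtopology (Euclidean_space n) (cube n)) X \<phi> \<and>
        homeomorphic_map (subtopology (Euclidean_space n) (open_cube n)) (subtopology X e) \<phi> \<and>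
        \<phi> ` (cube n - open_cube n) \<subseteq> cells_union {c' \<in> C. fst c' < n})"

definition finite_cw_complex :: "'a topology \<Rightarrow> (nat \<times> 'a set) set \<Rightarrow> bool" where
  "finite_cw_complex X C \<longleftrightarrow>
     Hausdorff_space X \<and> finite C \<and> cells_union C = topspace X \<and>
     (\<forall>c \<in> C. \<forall>c' \<in> C. c \<noteq> c' \<longrightarrow> snd c \<inter> snd c' = {}) \<and>
     (\<forall>c \<in> C. \<exists>\<phi>. characteristic_map X C c \<phi>)"

text \<open>\<open>X\<close> collapses to the subcomplex \<open>Y\<close> by removing a cell together with a free face.
  The set \<open>(cube (Suc m) - open_cube (Suc m)) - open_cube m\<close> is the closure of the complement of
  the face \<open>cube m\<close> in the boundary of \<open>cube (Suc m)\<close>.\<close>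

definition elementary_collapse ::
  "'a topology \<Rightarrow> (nat \<times> 'a set) set \<Rightarrow> 'a topology \<Rightarrow> (nat \<times> 'a set) set \<Rightarrow> bool" where
  "elementary_collapse X C Y D \<longleftrightarrow>
     finite_cw_complex X C \<and> finite_cw_complex Y D \<and> Y = subtopology X (cells_union D) \<and>
     (\<exists>m e e' \<phi>. (m, e) \<notin> D \<and> (Suc m, e') \<notin> D \<and> C = D \<union> {(m, e), (Suc m, e')} \<and>
        characteristic_map X C (Suc m, e') \<phi> \<and> characteristic_map X C (m, e) \<phi> \<and>
        \<phi> ` ((cube (Suc m) - open_cube (Suc m)) - open_cube m)
          \<subseteq> cells_union {c \<in> D. fst c \<le> m})"

definition strong_deformation_retraction ::
  "'a topology \<Rightarrow> 'a topology \<Rightarrow> ('a \<Rightarrow> 'a) \<Rightarrow> bool" where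
  "strong_deformation_retraction X Y r \<longleftrightarrow>
     continuous_map X Y r \<and> homotopic_with (\<lambda>h. \<forall>y \<in> topspace Y. h y = y) X X id r"

inductive deformation ::
  "'a topology \<Rightarrow> (nat \<times> 'a set) set \<Rightarrow> 'a topology \<Rightarrow> (nat \<times> 'a set) set \<Rightarrow> ('a \<Rightarrow> 'a) \<Rightarrow> bool"
  for X C where
  refl: "finite_cw_complex X C \<Longrightarrow> deformation X C X C id"
| expand: "\<lbrakk>deformation X C Y D d; elementary_collapse Z E Y D\<rbrakk> \<Longrightarrow> deformation X C Z E d"
| collapse: "\<lbrakk>deformation X C Y D d; elementary_collapse Y D Z E;
    strong_deformation_retraction Y Z r\<rbrakk> \<Longrightarrow> deformation X C Z E (r \<circ> d)"

definition cw_simple_homotopy_equivalence ::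
  "'a topology \<Rightarrow> (nat \<times> 'a set) set \<Rightarrow> 'a topology \<Rightarrow> (nat \<times> 'a set) set \<Rightarrow> ('a \<Rightarrow> 'a) \<Rightarrow> bool" where
  "cw_simple_homotopy_equivalence X C Y D s \<longleftrightarrow>
     (\<exists>d. deformation X C Y D d \<and> homotopic_with (\<lambda>h. True) X Y s d)"

text \<open>For spaces that carry no preferred CW structure, such as closed 3-manifolds, the notion is
  transported along homeomorphisms with finite CW complexes; by Chapman's theorem (homeomorphisms
  of finite CW complexes are simple) the choice of the structures does not matter.  Every finite CW
  complex embeds in some \<open>Euclidean_space N\<close>, and so does every formal deformation of such
  complexes, so nothing is lost by taking all complexes in the type \<open>nat \<Rightarrow> real\<close>.\<close>

definition simple_homotopy_equivalence ::
  "'a topology \<Rightarrow> 'b topology \<Rightarrow> ('a \<Rightarrow> 'b) \<Rightarrow> bool" where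
  "simple_homotopy_equivalence M N f \<longleftrightarrow>
     continuous_map M N f \<and>
     (\<exists>(X :: (nat \<Rightarrow> real) topology) C Y D h k s.
        homeomorphic_map X M h \<and> homeomorphic_map Y N k \<and>
        cw_simple_homotopy_equivalence X C Y D s \<and>
        (\<forall>x \<in> topspace X. f (h x) = k (s x)))"


section \<open>Fundamental group, universal cover and deck transformations\<close>

definition loop_at :: "'a topology \<Rightarrow> 'a \<Rightarrow> (real \<Rightarrow> 'a) \<Rightarrow> bool" where
  "loop_at X x g \<longleftrightarrow> pathin X g \<and> g 0 = x \<and> g 1 = x"

definition loop_class :: "'a topology \<Rightarrow> 'a \<Rightarrow> (real \<Rightarrow> 'a) \<Rightarrow> (real \<Rightarrow> 'a) set" where
  "loop_class X x g =
     {g'. homotopic_with (\<lambda>h. h 0 = x \<and> h 1 = x) (top_of_set {0..1}) X g g'}"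

text \<open>The library's \<^const>\<open>joinpaths\<close> is restricted to the type class of topological spaces.\<close>

definition join_loops :: "(real \<Rightarrow> 'a) \<Rightarrow> (real \<Rightarrow> 'a) \<Rightarrow> real \<Rightarrow> 'a" where
  "join_loops g h = (\<lambda>t. if t \<le> 1/2 then g (2 * t) else h (2 * t - 1))"

definition fundamental_group :: "'a topology \<Rightarrow> 'a \<Rightarrow> (real \<Rightarrow> 'a) set monoid" where
  "fundamental_group X x =
     \<lparr>carrier = loop_class X x ` {g. loop_at X x g},
      monoid.mult = (\<lambda>\<alpha> \<beta>. \<Union>g\<in>\<alpha>. \<Union>h\<in>\<beta>. loop_class X x (join_loops g h)),
      one = loop_class X x (\<lambda>t. x)\<rparr>"

definition simply_connected_space :: "'a topology \<Rightarrow> bool" where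
  "simply_connected_space X \<longleftrightarrow>
     path_connected_space X \<and>
     (\<forall>x g. loop_at X x g \<longrightarrow>
        homotopic_with (\<lambda>h. h 0 = x \<and> h 1 = x) (top_of_set {0..1}) X g (\<lambda>t. x))"

text \<open>The analogue of \<^const>\<open>covering_space\<close> for the type of abstract topologies.\<close>

definition covering_map :: "'b topology \<Rightarrow> 'a topology \<Rightarrow> ('b \<Rightarrow> 'a) \<Rightarrow> bool" where
  "covering_map E M c \<longleftrightarrow>
     continuous_map E M c \<and> c ` topspace E = topspace M \<and>
     (\<forall>x \<in> topspace M. \<exists>U. x \<in> U \<and> openin M U \<and>
        (\<exists>\<V>. \<Union>\<V> = {y \<in> topspace E. c y \<in> U} \<and> (\<forall>V \<in> \<V>. openin E V) \<and>
             pairwise disjnt \<V> \<and>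
             (\<forall>V \<in> \<V>. homeomorphic_map (subtopology E V) (subtopology M U) c)))"

definition universal_cover :: "'b topology \<Rightarrow> 'a topology \<Rightarrow> ('b \<Rightarrow> 'a) \<Rightarrow> bool" where
  "universal_cover E M c \<longleftrightarrow> covering_map E M c \<and> simply_connected_space E"

definition deck_transformation :: "'b topology \<Rightarrow> ('b \<Rightarrow> 'a) \<Rightarrow> ('b \<Rightarrow> 'b) \<Rightarrow> bool" where
  "deck_transformation E c h \<longleftrightarrow>
     h \<in> extensional (topspace E) \<and> homeomorphic_map E E h \<and> (\<forall>y \<in> topspace E. c (h y) = c y)"

text \<open>The standard action of \<open>\<pi>\<^sub>1(M, c y)\<close> on the universal cover \<open>c\<close>: the class of a loop
  \<open>g\<close> acts by the unique deck transformation that takes the base point \<open>y\<close> to the end point of the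
  lift of \<open>g\<close> starting at \<open>y\<close>.\<close>

definition deck_action ::
  "'b topology \<Rightarrow> ('b \<Rightarrow> 'a) \<Rightarrow> 'b \<Rightarrow> (real \<Rightarrow> 'a) set \<Rightarrow> 'b \<Rightarrow> 'b" where
  "deck_action E c y \<alpha> =
     (THE h. deck_transformation E c h \<and>
        (\<exists>g \<in> \<alpha>. \<exists>l. pathin E l \<and> l 0 = y \<and> (\<forall>t \<in> {0..1}. c (l t) = g t) \<and> h y = l 1))"


section \<open>Free orthogonal actions on spheres\<close>

text \<open>In \<^const>\<open>group_action\<close> the acting maps are extensional on the sphere, hence the detour
  through an orthogonal transformation \<open>T\<close> of the whole space.\<close>

definition free_orthogonal_sphere_action ::
  "('g, 'm) monoid_scheme \<Rightarrow> ('g \<Rightarrow> 'v::euclidean_space \<Rightarrow> 'v) \<Rightarrow> bool" where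
  "free_orthogonal_sphere_action G \<rho> \<longleftrightarrow>
     group_action G (sphere 0 1) \<rho> \<and>
     (\<forall>g \<in> carrier G. \<exists>T. orthogonal_transformation T \<and> (\<forall>v \<in> sphere 0 1. \<rho> g v = T v)) \<and>
     (\<forall>g \<in> carrier G. \<forall>v \<in> sphere 0 1. \<rho> g v = v \<longrightarrow> g = \<one>\<^bsub>G\<^esub>)"

end

theory Submission
  imports Defs
begin

text \<open>Lifting a homotopy equivalence to the universal covers identifies the deck groups of \<open>M\<close> and of
  the lens space, which gives \<open>\<pi>\<^sub>1(M) \<cong> \<int>/p\<close>.

  The embedding exists by general position, since \<open>2 \<cdot> 3 + 1 = 7\<close>.  Let \<open>\<int>/p\<close> act on
  \<open>V = \<real>\<^sup>8 = \<complex>\<^sup>4\<close> by multiplication with roots of unity.  Averaging turns continuous maps from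
  the universal cover to \<open>V\<close> into equivariant ones, and by Baire's theorem it is enough that for two
  small compact sets \<open>K, K'\<close> with disjoint orbits the maps whose averages have no common
  directions on \<open>K\<close> and \<open>K'\<close> are open and dense.  Density holds because the map may be made
  polynomial in charts around \<open>K\<close> and \<open>K'\<close>; then \<open>(x, y, t) \<mapsto> t f(y) - f(x)\<close> is a smooth map from a
  7-dimensional space to \<open>V\<close>, and a small translation of \<open>f\<close> near \<open>K\<close> by a vector outside its image
  separates the directions.  Points of one orbit are separated by freeness.\<close>

section \<open>Covering maps and lifting\<close>

text \<open>No smooth structure on \<open>M\<close> is given, so general position cannot be carried
  out on the cover as a whole. A condition on two small closed sets sees only one chart around each,
  and second countability of the cover leaves countably many such conditions. The obstacle is that
  these conditions concern the averaged map, while only the map itself can be changed freely. A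
  correction supported in a set disjoint from its nontrivial translates passes through the average
  unchanged on that set, so the averaged map can be prescribed there. Nonvanishing of the averaged
  map, needed for projecting to the sphere, is not imposed separately: in cross-multiplied form a
  zero vector shares the direction of every vector, so separating the directions at points of two
  orbits excludes zeros as well. The deck group has to be computed before the embedding is
  constructed, not only for the statement about the fundamental group: its finiteness makes the
  cover compact, and compactness underlies the uniform metric, the openness of the conditions and
  the step from an injective map to an embedding.\<close>

lemma continuous_map_paste_closed:
  assumes "closedin X A" "closedin X B" "topspace X \<subseteq> A \<union> B"
    and "continuous_map (subtopology X A) Y f" "continuous_map (subtopology X B) Y g"
    and "\<And>x. x \<in> A \<Longrightarrow> x \<in> B \<Longrightarrow> f x = g x"
  shows "continuous_map X Y (\<lambda>x. if x \<in> A then f x else g x)"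
proof (rule pasting_lemma_closed[of "{True, False}" X "\<lambda>b. if b then A else B" Y "\<lambda>b. if b then f else g"])
  show "finite {True, False}" by simp
  show "closedin X (if i then A else B)" for i using assms(1,2) by simp
  show "continuous_map (subtopology X (if i then A else B)) Y (if i then f else g)" for i
    using assms(4,5) by simp
  show "(if i then f else g) x = (if j then f else g) x"
    if "x \<in> topspace X \<inter> (if i then A else B) \<inter> (if j then A else B)" for i j x
    using that assms(6)[of x] by (cases i; cases j) simp_all
  show "\<exists>j. j \<in> {True, False} \<and> x \<in> (if j then A else B) \<and>
      (if x \<in> A then f x else g x) = (if j then f else g) x" if "x \<in> topspace X" for x
    using assms(3) that by (cases "x \<in> A") auto
qed

section \<open>Evenly covered neighbourhoods and uniqueness of lifts\<close>

text \<open>The family of sheets is dissolved into two pointwise statements. The second holds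
  because a sheet meets a fibre only once, so distinct points of a fibre lie in distinct sheets; it
  serves uniqueness of lifts as well as the Hausdorff property of covers.\<close>

lemma covering_map_sheets:
  assumes "covering_map E M c" "x \<in> topspace M"
  obtains U where "x \<in> U" "openin M U"
    and "\<And>y. y \<in> topspace E \<Longrightarrow> c y \<in> U \<Longrightarrow>
           \<exists>V. y \<in> V \<and> openin E V \<and> homeomorphic_map (subtopology E V) (subtopology M U) c"
    and "\<And>y y'. y \<in> topspace E \<Longrightarrow> y' \<in> topspace E \<Longrightarrow> c y \<in> U \<Longrightarrow> c y' = c y \<Longrightarrow> y \<noteq> y' \<Longrightarrow>
           \<exists>V V'. y \<in> V \<and> y' \<in> V' \<and> openin E V \<and> openin E V' \<and> disjnt V V'"
proof -
  from bspec[OF conjunct2[OF conjunct2[OF assms(1)[unfolded covering_map_def]]] assms(2)]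
  obtain U \<V> where "x \<in> U \<and> openin M U \<and> \<Union>\<V> = {y \<in> topspace E. c y \<in> U} \<and>
      (\<forall>V \<in> \<V>. openin E V) \<and> pairwise disjnt \<V> \<and>
      (\<forall>V \<in> \<V>. homeomorphic_map (subtopology E V) (subtopology M U) c)"
    by (elim exE conjE) fast
  then have U: "x \<in> U" "openin M U" and un: "\<Union>\<V> = {y \<in> topspace E. c y \<in> U}"
    and op: "\<And>V. V \<in> \<V> \<Longrightarrow> openin E V" and dis: "pairwise disjnt \<V>"
    and hom: "\<And>V. V \<in> \<V> \<Longrightarrow> homeomorphic_map (subtopology E V) (subtopology M U) c"
    by auto
  have inj: "inj_on c V" if "V \<in> \<V>" for V
    using hom[OF that] openin_subset[OF op[OF that]]
    by (simp add: homeomorphic_map_def Int_absorb1)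
  show ?thesis
  proof (rule that[OF U])
    show "\<exists>V. y \<in> V \<and> openin E V \<and> homeomorphic_map (subtopology E V) (subtopology M U) c"
      if "y \<in> topspace E" "c y \<in> U" for y
    proof -
      have "y \<in> \<Union>\<V>" using un that by blast
      then show ?thesis using op hom by blast
    qed
    show "\<exists>V V'. y \<in> V \<and> y' \<in> V' \<and> openin E V \<and> openin E V' \<and> disjnt V V'"
      if y: "y \<in> topspace E" "y' \<in> topspace E" "c y \<in> U" "c y' = c y" "y \<noteq> y'" for y y'
    proof -
      have "y \<in> \<Union>\<V>" "y' \<in> \<Union>\<V>" using un y by auto
      then obtain V V' where V: "V \<in> \<V>" "V' \<in> \<V>" "y \<in> V" "y' \<in> V'" by blast
      then have "V \<noteq> V'" using inj_onD[OF inj[OF V(1)] y(4)] y(5) by blast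
      then have "disjnt V V'" using V dis by (simp add: pairwise_def)
      then show ?thesis using V op by blast
    qed
  qed
qed

lemma covering_map_sheet:
  assumes "covering_map E M c" "y \<in> topspace E"
  obtains U V where "openin M U" "y \<in> V" "openin E V" "homeomorphic_map (subtopology E V) (subtopology M U) c"
proof -
  have "c y \<in> topspace M" using assms by (auto simp: covering_map_def)
  then show ?thesis using covering_map_sheets[OF assms(1)] assms(2) that by metis
qed

lemma covering_map_continuous: "covering_map E M c \<Longrightarrow> continuous_map E M c"
  by (simp add: covering_map_def)

lemma covering_map_in_topspace: "covering_map E M c \<Longrightarrow> y \<in> topspace E \<Longrightarrow> c y \<in> topspace M"
  by (auto simp: covering_map_def)

lemma sheet_section:
  assumes "homeomorphic_map (subtopology E V) (subtopology M U) c" "openin E V" "openin M U"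
  obtains s where "continuous_map (subtopology M U) E s"
    "\<And>u. u \<in> U \<Longrightarrow> s u \<in> V \<and> c (s u) = u" "\<And>v. v \<in> V \<Longrightarrow> c v \<in> U \<and> s (c v) = v"
proof -
  have VU: "V \<subseteq> topspace E" "U \<subseteq> topspace M" using assms openin_subset by auto
  obtain s where s: "homeomorphic_maps (subtopology E V) (subtopology M U) c s"
    using assms(1) homeomorphic_map_maps by blast
  then have "continuous_map (subtopology M U) E s" "s \<in> U \<rightarrow> V" "c \<in> V \<rightarrow> U"
    using VU by (auto simp: homeomorphic_maps_def Int_absorb1 Pi_iff continuous_map_in_subtopology
        dest: continuous_map_funspace)
  then show ?thesis using s VU by (intro that[of s]) (auto simp: homeomorphic_maps_def)
qed

text \<open>The set where the two lifts agree is clopen: open since \<open>c\<close> is injective on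
  a sheet around the common value, closed since different points over the same point have disjoint
  neighbourhoods.\<close>

lemma covering_lift_unique:
  assumes cov: "covering_map E M c" and T: "connected_space T"
    and g: "continuous_map T E g" and g': "continuous_map T E g'"
    and eq: "\<And>x. x \<in> topspace T \<Longrightarrow> c (g x) = c (g' x)"
    and a: "a \<in> topspace T" "g a = g' a" and x: "x \<in> topspace T"
  shows "g x = g' x"
proof -
  let ?S = "{x \<in> topspace T. g x = g' x}"
  have gE: "g z \<in> topspace E" "g' z \<in> topspace E" if "z \<in> topspace T" for z
    using g g' that by (auto simp: continuous_map_def)
  have "openin T ?S"
    unfolding openin_subopen[of T ?S]
  proof
    fix z assume "z \<in> ?S"
    then have z: "z \<in> topspace T" "g z = g' z" by auto
    obtain U V where U: "openin M U" "g z \<in> V" "openin E V"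
        "homeomorphic_map (subtopology E V) (subtopology M U) c"
      using covering_map_sheet[OF cov gE(1)[OF z(1)]] by metis
    obtain s where s: "\<And>v. v \<in> V \<Longrightarrow> s (c v) = v" using sheet_section[OF U(4,3,1)] by metis
    let ?W = "{w \<in> topspace T. g w \<in> V} \<inter> {w \<in> topspace T. g' w \<in> V}"
    have "openin T ?W" using g g' U(3) openin_continuous_map_preimage by blast
    moreover have "?W \<subseteq> ?S" using s eq by clarsimp metis
    ultimately show "\<exists>W. openin T W \<and> z \<in> W \<and> W \<subseteq> ?S" using z U(2) by (intro exI[of _ ?W]) auto
  qed
  moreover have "openin T (topspace T - ?S)"
    unfolding openin_subopen[of T "topspace T - ?S"]
  proof
    fix z assume "z \<in> topspace T - ?S"
    then have z: "z \<in> topspace T" "z \<notin> ?S" by auto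
    have "c (g z) \<in> topspace M" using cov gE z covering_map_in_topspace by metis
    moreover have "g z \<noteq> g' z" using z by auto
    ultimately obtain V V' where V: "g z \<in> V" "g' z \<in> V'" "openin E V" "openin E V'" "disjnt V V'"
      using covering_map_sheets[OF cov] gE z(1) eq[OF z(1)] by metis
    let ?W = "{w \<in> topspace T. g w \<in> V} \<inter> {w \<in> topspace T. g' w \<in> V'}"
    have "openin T ?W" using g g' V openin_continuous_map_preimage by blast
    moreover have "?W \<subseteq> topspace T - ?S" using V(5) by (auto simp: disjnt_iff)
    ultimately show "\<exists>W. openin T W \<and> z \<in> W \<and> W \<subseteq> topspace T - ?S"
      using z V by (intro exI[of _ ?W]) auto
  qed
  ultimately have "?S = {} \<or> ?S = topspace T"
    using T by (metis (no_types, lifting) closedin_def connected_space_clopen_in openin_subset)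
  then show ?thesis using a x by blast
qed

section \<open>Lifting maps of the unit square\<close>

text \<open>Every point of the domain may serve as starting point, so that after lifting over one
  piece the lift can be continued over an adjacent piece from any common point.\<close>

definition liftable :: "'b topology \<Rightarrow> ('b \<Rightarrow> 'a) \<Rightarrow> 'c topology \<Rightarrow> ('c \<Rightarrow> 'a) \<Rightarrow> bool" where
  "liftable E c T f \<longleftrightarrow> (\<forall>t \<in> topspace T. \<forall>e \<in> topspace E. c e = f t \<longrightarrow>
     (\<exists>g. continuous_map T E g \<and> g t = e \<and> (\<forall>x \<in> topspace T. c (g x) = f x)))"

text \<open>The two partial lifts are made to agree at one point of \<open>A \<inter> B\<close>;
  connectedness of the intersection and uniqueness of lifts force agreement on all of it, and
  closedness lets them be pasted.\<close>

lemma liftable_glue: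
  assumes cov: "covering_map E M c" and AB: "closedin T A" "closedin T B" "topspace T \<subseteq> A \<union> B"
    and con: "connectedin T (A \<inter> B)" and ne: "A \<inter> B \<noteq> {}"
    and lA: "liftable E c (subtopology T A) f" and lB: "liftable E c (subtopology T B) f"
  shows "liftable E c T f"
proof -
  \<comment> \<open>The starting point may lie in either piece, so the claim is stated for arbitrary
    \<open>A\<close> and \<open>B\<close> with the point in \<open>A\<close> and applied in both
    orders.\<close>
  have *: "\<exists>g. continuous_map T E g \<and> g t = e \<and> (\<forall>x \<in> topspace T. c (g x) = f x)"
    if t: "t \<in> A" "e \<in> topspace E" "c e = f t"
      and AB: "closedin T A" "closedin T B" "topspace T \<subseteq> A \<union> B"
      and con: "connectedin T (A \<inter> B)" and ne: "A \<inter> B \<noteq> {}"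
      and lA: "liftable E c (subtopology T A) f" and lB: "liftable E c (subtopology T B) f"
    for t e A B
  proof -
    have sub: "A \<subseteq> topspace T" "B \<subseteq> topspace T" using AB closedin_subset by auto
    obtain g where g: "continuous_map (subtopology T A) E g" "g t = e" "\<And>x. x \<in> A \<Longrightarrow> c (g x) = f x"
      using lA t sub unfolding liftable_def topspace_subtopology by (metis Int_absorb1)
    obtain h where h: "continuous_map (subtopology T B) E h" "\<And>x. x \<in> B \<Longrightarrow> c (h x) = f x"
      and gh: "\<And>x. x \<in> A \<Longrightarrow> x \<in> B \<Longrightarrow> g x = h x"
    proof -
      obtain m where m: "m \<in> A" "m \<in> B" using ne by auto
      have "g m \<in> topspace E" using g(1) m sub by (auto simp: continuous_map_def Int_absorb1)
      then obtain h where h: "continuous_map (subtopology T B) E h" "h m = g m" "\<And>x. x \<in> B \<Longrightarrow> c (h x) = f x"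
        using lB m sub g(3)[OF m(1)] unfolding liftable_def topspace_subtopology by (metis Int_absorb1)
      have "g x = h x" if "x \<in> A" "x \<in> B" for x
      proof (rule covering_lift_unique[OF cov, of "subtopology T (A \<inter> B)" g h m x])
        show "connected_space (subtopology T (A \<inter> B))" using con by (simp add: connectedin_def)
        show "continuous_map (subtopology T (A \<inter> B)) E g" "continuous_map (subtopology T (A \<inter> B)) E h"
          using g(1) h(1) by (auto intro: continuous_map_from_subtopology_mono)
      qed (use m that g h sub in auto)
      then show ?thesis using that h by blast
    qed
    have "continuous_map T E (\<lambda>x. if x \<in> A then g x else h x)"
      using continuous_map_paste_closed[OF AB g(1) h(1) gh] by blast
    then show ?thesis using g h t AB(3) by (intro exI[of _ "\<lambda>x. if x \<in> A then g x else h x"]) auto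
  qed
  have con': "connectedin T (B \<inter> A)" using con by (simp add: Int_commute)
  have AB3: "topspace T \<subseteq> B \<union> A" using AB by blast
  have ne': "B \<inter> A \<noteq> {}" using ne by blast
  show ?thesis
    unfolding liftable_def
    using *[OF _ _ _ AB con ne lA lB] *[OF _ _ _ AB(2,1) AB3 con' ne' lB lA] AB(3)
    by (metis UnE subsetD)
qed

lemma liftable_if_small:
  assumes cov: "covering_map E M c" and x: "x \<in> topspace M"
  obtains U where "x \<in> U" "openin M U"
    "\<And>(T :: 'c topology) f. continuous_map T M f \<Longrightarrow> f ` topspace T \<subseteq> U \<Longrightarrow> liftable E c T f"
proof -
  obtain U where U: "x \<in> U" "openin M U"
    and sh: "\<And>y. y \<in> topspace E \<Longrightarrow> c y \<in> U \<Longrightarrow>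
           \<exists>V. y \<in> V \<and> openin E V \<and> homeomorphic_map (subtopology E V) (subtopology M U) c"
    using covering_map_sheets[OF cov x] by metis
  show ?thesis
  proof (rule that[OF U])
    fix T :: "'c topology" and f assume f: "continuous_map T M f" "f ` topspace T \<subseteq> U"
    show "liftable E c T f"
      unfolding liftable_def
    proof (intro ballI impI)
      fix t e assume t: "t \<in> topspace T" "e \<in> topspace E" "c e = f t"
      then have "c e \<in> U" using f by auto
      then obtain V where V: "e \<in> V" "openin E V" "homeomorphic_map (subtopology E V) (subtopology M U) c"
        using sh t by metis
      obtain s where s: "continuous_map (subtopology M U) E s"
        "\<And>u. u \<in> U \<Longrightarrow> s u \<in> V \<and> c (s u) = u" "\<And>v. v \<in> V \<Longrightarrow> c v \<in> U \<and> s (c v) = v"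
        using sheet_section[OF V(3,2) U(2)] by metis
      have "continuous_map T (subtopology M U) f"
        using f by (simp add: continuous_map_in_subtopology image_subset_iff_funcset)
      then have "continuous_map T E (s \<circ> f)" using s(1) continuous_map_compose by blast
      moreover have "(s \<circ> f) t = e" using s(3)[OF V(1)] t by simp
      ultimately show "\<exists>g. continuous_map T E g \<and> g t = e \<and> (\<forall>x\<in>topspace T. c (g x) = f x)"
        using s(2) f(2) by (intro exI[of _ "s \<circ> f"]) auto
    qed
  qed
qed

text \<open>Compactness enters through Bolzano's bisection principle instead of a Lebesgue number: a
  property of intervals that holds for all short intervals around each point and passes to unions of
  adjacent intervals holds for \<open>{0..1}\<close>. It is applied first to the height of a thin
  strip and then to the width of the square.\<close>

lemma liftable_square:
  fixes F :: "real \<times> real \<Rightarrow> 'a"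
  assumes cov: "covering_map E M c" and F: "continuous_map (top_of_set ({0..1} \<times> {0..1})) M F"
  shows "liftable E c (top_of_set ({0..1} \<times> {0..1})) F"
proof -
  let ?Q = "{0..1} \<times> {0..1} :: (real \<times> real) set"
  define L where "L A = liftable E c (top_of_set A) F" for A
  have glue: "L (A \<union> B)"
    if "L A" "L B" "closed A" "closed B" "convex (A \<inter> B)" "A \<inter> B \<noteq> {}" for A B
    unfolding L_def
  proof (rule liftable_glue[OF cov])
    show "liftable E c (subtopology (top_of_set (A \<union> B)) A) F" "liftable E c (subtopology (top_of_set (A \<union> B)) B) F"
      using that(1,2) by (simp_all add: L_def subtopology_subtopology Int_absorb1)
    show "connectedin (top_of_set (A \<union> B)) (A \<inter> B)"
      using convex_connected[OF that(5)] by (auto simp: connectedin_subtopology)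
  qed (use that in \<open>auto intro: closed_subset\<close>)
  have loc: "\<exists>e>0. \<forall>A. A \<subseteq> ?Q \<longrightarrow> A \<subseteq> ball z e \<longrightarrow> L A" if z: "z \<in> ?Q" for z
  proof -
    have "F z \<in> topspace M" using F z by (auto simp: continuous_map_def)
    then obtain U where U: "F z \<in> U" "openin M U"
      "\<And>(T :: (real \<times> real) topology) f. continuous_map T M f \<Longrightarrow> f ` topspace T \<subseteq> U \<Longrightarrow> liftable E c T f"
      using liftable_if_small[OF cov] by metis
    have "openin (top_of_set ?Q) {z \<in> ?Q. F z \<in> U}"
      using openin_continuous_map_preimage[OF F U(2)] by simp
    then obtain e where e: "e > 0" "ball z e \<inter> ?Q \<subseteq> {z \<in> ?Q. F z \<in> U}"
      using z U(1) unfolding openin_contains_ball by (metis (no_types, lifting) mem_Collect_eq)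
    have "L A" if "A \<subseteq> ?Q" "A \<subseteq> ball z e" for A
      unfolding L_def
    proof (rule U(3))
      show "continuous_map (top_of_set A) M F" using F that(1) continuous_map_from_subtopology_mono by blast
      show "F ` topspace (top_of_set A) \<subseteq> U" using e(2) that by auto
    qed
    then show ?thesis using e(1) by blast
  qed
  have strip: "\<exists>e>0. \<forall>a b. a \<le> x \<and> x \<le> b \<and> b - a < e \<longrightarrow> 0 \<le> a \<longrightarrow> b \<le> 1 \<longrightarrow> L ({a..b} \<times> {0..1})"
    if x: "0 \<le> x" "x \<le> 1" for x
  proof -
    \<comment> \<open>The width \<open>e\<close> is quantified inside the property because joining
      two boxes vertically leaves only the smaller of their widths. The bounds on \<open>a'\<close>
      and \<open>b'\<close> are premises since the principle also speaks about intervals that leave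
      the unit interval.\<close>
    define P where "P a' b' \<longleftrightarrow> (0 \<le> a' \<longrightarrow> b' \<le> 1 \<longrightarrow>
        (\<exists>e>0. \<forall>a b. a \<le> x \<and> x \<le> b \<and> b - a < e \<longrightarrow> 0 \<le> a \<longrightarrow> b \<le> 1 \<longrightarrow> L ({a..b} \<times> {a'..b'})))" for a' b'
    have "P 0 1"
    proof (rule Bolzano[of 0 1 P])
      fix a' b' d' assume P: "P a' b'" "P b' d'" and ab: "a' \<le> b'" "b' \<le> d'"
      show "P a' d'"
        unfolding P_def
      proof (intro impI)
        assume "0 \<le> a'" "d' \<le> 1"
        then have "0 \<le> b'" "b' \<le> 1" using ab by linarith+
        then obtain e1 e2 where e: "e1 > 0" "e2 > 0"
          "\<And>a b. a \<le> x \<and> x \<le> b \<and> b - a < e1 \<Longrightarrow> 0 \<le> a \<Longrightarrow> b \<le> 1 \<Longrightarrow> L ({a..b} \<times> {a'..b'})"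
          "\<And>a b. a \<le> x \<and> x \<le> b \<and> b - a < e2 \<Longrightarrow> 0 \<le> a \<Longrightarrow> b \<le> 1 \<Longrightarrow> L ({a..b} \<times> {b'..d'})"
          using P \<open>0 \<le> a'\<close> \<open>d' \<le> 1\<close> unfolding P_def by blast
        have "L ({a..b} \<times> {a'..d'})" if "a \<le> x \<and> x \<le> b \<and> b - a < min e1 e2" "0 \<le> a" "b \<le> 1" for a b
        proof -
          have "{a..b} \<times> {a'..d'} = {a..b} \<times> {a'..b'} \<union> {a..b} \<times> {b'..d'}" using ab by auto
          moreover have "{a..b} \<times> {a'..b'} \<inter> {a..b} \<times> {b'..d'} = {a..b} \<times> {b'..b'}" using ab by auto
          ultimately show ?thesis
            using glue[of "{a..b} \<times> {a'..b'}" "{a..b} \<times> {b'..d'}"] e that by (simp add: convex_Times closed_Times)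
        qed
        then show "\<exists>e>0. \<forall>a b. a \<le> x \<and> x \<le> b \<and> b - a < e \<longrightarrow> 0 \<le> a \<longrightarrow> b \<le> 1 \<longrightarrow> L ({a..b} \<times> {a'..d'})"
          using e(1,2) by (intro exI[of _ "min e1 e2"]) auto
      qed
    next
      fix y :: real assume y: "0 \<le> y" "y \<le> 1"
      then obtain e where e: "e > 0" "\<And>A. A \<subseteq> ?Q \<Longrightarrow> A \<subseteq> ball (x, y) e \<Longrightarrow> L A"
        using loc[of "(x, y)"] x by auto
      have "L ({a..b} \<times> {a'..b'})"
        if "a \<le> x" "x \<le> b" "b - a < e/2" "0 \<le> a" "b \<le> 1" "a' \<le> y" "y \<le> b'" "b' - a' < e/2" "0 \<le> a'" "b' \<le> 1" for a b a' b'
      proof (rule e(2))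
        show "{a..b} \<times> {a'..b'} \<subseteq> ball (x, y) e"
        proof
          fix z assume z: "z \<in> {a..b} \<times> {a'..b'}"
          have "dist (x, y) z \<le> dist x (fst z) + dist y (snd z)"
            by (simp add: dist_prod_def sqrt_sum_squares_le_sum)
          also have "\<dots> < e/2 + e/2"
            using z that by (intro add_strict_mono) (auto simp: dist_real_def abs_if)
          finally show "z \<in> ball (x, y) e" by simp
        qed
      qed (use that in auto)
      then show "\<exists>d>0. \<forall>a' b'. a' \<le> y \<and> y \<le> b' \<and> b' - a' < d \<longrightarrow> P a' b'"
        unfolding P_def using e(1) by (meson half_gt_zero)
    qed simp
    then show ?thesis by (simp add: P_def)
  qed
  define P where "P a b \<longleftrightarrow> (0 \<le> a \<longrightarrow> b \<le> 1 \<longrightarrow> L ({a..b} \<times> {0..1}))" for a b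
  have "P 0 1"
  proof (rule Bolzano[of 0 1 P])
    fix a b d assume P: "P a b" "P b d" and ab: "a \<le> b" "b \<le> d"
    have "{a..d} \<times> {0..1::real} = {a..b} \<times> {0..1} \<union> {b..d} \<times> {0..1}" using ab by auto
    moreover have "{a..b} \<times> {0..1::real} \<inter> {b..d} \<times> {0..1} = {b..b} \<times> {0..1}" using ab by auto
    ultimately show "P a d"
      using glue[of "{a..b} \<times> {0..1}" "{b..d} \<times> {0..1}"] P ab by (simp add: P_def convex_Times closed_Times)
  next
    show "\<exists>d>0. \<forall>a b. a \<le> x \<and> x \<le> b \<and> b - a < d \<longrightarrow> P a b" if "0 \<le> x" "x \<le> 1" for x
      using strip[OF that] by (simp add: P_def)
  qed simp
  then show ?thesis by (simp add: P_def L_def)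
qed

lemma prod_topology_top_of_set:
  "prod_topology (top_of_set A) (top_of_set B) = top_of_set (A \<times> B)"
  by (simp add: prod_topology_subtopology(1) prod_topology_subtopology(2) subtopology_subtopology
      Times_Int_Times flip: euclidean_product_topology)

abbreviation unit_square :: "(real \<times> real) topology" where
  "unit_square \<equiv> prod_topology (top_of_set {0..1}) (top_of_set {0..1})"

lemma covering_square_lift:
  fixes F :: "real \<times> real \<Rightarrow> 'a"
  assumes cov: "covering_map E M c"
    and F: "continuous_map unit_square M F"
    and e: "e \<in> topspace E" "c e = F (0, 0)"
  obtains G where "continuous_map unit_square E G"
    "G (0, 0) = e" "\<And>s t. s \<in> {0..1} \<Longrightarrow> t \<in> {0..1} \<Longrightarrow> c (G (s, t)) = F (s, t)"
proof -
  have "liftable E c (top_of_set ({0..1} \<times> {0..1})) F"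
    using liftable_square[OF cov] F by (simp add: prod_topology_top_of_set)
  then obtain G where "continuous_map (top_of_set ({0..1} \<times> {0..1})) E G" "G (0, 0) = e"
      "\<forall>x \<in> {0..1} \<times> {0..1}. c (G x) = F x"
    using e unfolding liftable_def by (metis SigmaI atLeastAtMost_iff order_refl topspace_euclidean_subtopology zero_le_one)
  then show ?thesis by (intro that[of G]) (auto simp: prod_topology_top_of_set)
qed

lemma pathin_square:
  assumes "continuous_map unit_square X G"
    and "continuous_on {0..1} a" "continuous_on {0..1} b" "a ` {0..1} \<subseteq> {0..1}" "b ` {0..1} \<subseteq> {0..1}"
  shows "pathin X (\<lambda>t. G (a t, b t))"
proof -
  have "continuous_map (top_of_set {0..1}) (unit_square) (\<lambda>t. (a t, b t))"
    using assms(2-5) by (intro continuous_map_pairedI) (auto simp: continuous_map_in_subtopology)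
  then show ?thesis
    using continuous_map_compose[OF _ assms(1), of "top_of_set {0..1}" "\<lambda>t. (a t, b t)"]
    by (simp add: pathin_def o_def)
qed

section \<open>Lifts of paths and of path homotopies\<close>

lemma covering_path_lift:
  assumes cov: "covering_map E M c" and g: "pathin M g" and e: "e \<in> topspace E" "c e = g 0"
  obtains l where "pathin E l" "l 0 = e" "\<And>t. t \<in> {0..1} \<Longrightarrow> c (l t) = g t"
proof -
  \<comment> \<open>A path is lifted as the square that is constant in its first coordinate; the
    lift is read off on an edge.\<close>
  let ?F = "\<lambda>z::real \<times> real. g (snd z)"
  have F: "continuous_map unit_square M ?F"
    using continuous_map_compose[OF continuous_map_snd g[unfolded pathin_def], of "top_of_set {0..1::real}"]
    by (simp add: o_def)
  have "c e = ?F (0, 0)" using e(2) by simp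
  from covering_square_lift[OF cov F e(1) this] obtain G where G: "continuous_map unit_square E G"
    "G (0, 0) = e" "\<And>s t. s \<in> {0..1} \<Longrightarrow> t \<in> {0..1} \<Longrightarrow> c (G (s, t)) = ?F (s, t)"
    by blast
  have "pathin E (\<lambda>t. G (0, t))" by (rule pathin_square[OF G(1)]) auto
  then show ?thesis using G(2) G(3)[of 0] by (intro that[of "\<lambda>t. G (0, t)"]) auto
qed

lemma covering_path_lift_unique:
  assumes "covering_map E M c" "pathin E l" "pathin E l'"
    and "\<And>t. t \<in> {0..1} \<Longrightarrow> c (l t) = c (l' t)" "l 0 = l' 0" "t \<in> {0..1}"
  shows "l t = l' t"
  using assms by (intro covering_lift_unique[of E M c "top_of_set {0..1}" l l' 0 t])
    (auto simp: pathin_def connectedin_def connected_space_subtopology)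

lemma pathin_in_topspace: "pathin X g \<Longrightarrow> t \<in> {0..1} \<Longrightarrow> g t \<in> topspace X"
  unfolding pathin_def using continuous_map_funspace by fastforce

lemma pathin_compose': "pathin X g \<Longrightarrow> continuous_map X Y f \<Longrightarrow> pathin Y (\<lambda>t. f (g t))"
  using pathin_compose[of X g Y f] by (simp add: o_def)

lemma pathin_reparam:
  assumes "pathin X g" "continuous_on {a..b} r" "r ` {a..b} \<subseteq> {0..1}"
  shows "continuous_map (top_of_set {a..b}) X (\<lambda>t. g (r t))"
proof -
  have "continuous_map (top_of_set {a..b}) (top_of_set {0..1}) r"
    using assms(2,3) by (auto simp: continuous_map_in_subtopology)
  from continuous_map_compose[OF this assms(1)[unfolded pathin_def]] show ?thesis
    by (simp add: o_def)
qed

lemma pathin_join: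
  assumes g: "pathin X g" and h: "pathin X h" and eq: "g 1 = h 0"
  shows "pathin X (join_loops g h)"
  unfolding pathin_def join_loops_def
proof (rule continuous_map_cases_le)
  have 1: "continuous_map (top_of_set {0..1/2}) X (\<lambda>t. g (2 * t))"
    by (rule pathin_reparam[OF g]) (auto intro!: continuous_intros)
  have "{0..1} \<inter> {x \<in> topspace (top_of_set {0..1}). x \<le> 1/2} = {0..1/2::real}" by auto
  then show "continuous_map (subtopology (top_of_set {0..1}) {x \<in> topspace (top_of_set {0..1}). x \<le> 1/2}) X (\<lambda>t. g (2 * t))"
    using 1 by (simp add: subtopology_subtopology)
  have 2: "continuous_map (top_of_set {1/2..1}) X (\<lambda>t. h (2 * t - 1))"
    by (rule pathin_reparam[OF h]) (auto intro!: continuous_intros)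
  have "{0..1} \<inter> {x \<in> topspace (top_of_set {0..1}). 1/2 \<le> x} = {1/2..1::real}" by auto
  then show "continuous_map (subtopology (top_of_set {0..1}) {x \<in> topspace (top_of_set {0..1}). 1/2 \<le> x}) X (\<lambda>t. h (2 * t - 1))"
    using 2 by (simp add: subtopology_subtopology)
  show "g (2 * t) = h (2 * t - 1)" if "t = 1/2" for t
    unfolding that using eq by simp
qed (auto intro: continuous_intros)

lemma pathin_reverse: "pathin X g \<Longrightarrow> pathin X (\<lambda>t. g (1 - t))"
  using pathin_reparam[of X g 0 1 "\<lambda>t. 1 - t"] by (simp add: pathin_def continuous_on_diff)

abbreviation path_homotopic :: "'a topology \<Rightarrow> 'a \<Rightarrow> 'a \<Rightarrow> (real \<Rightarrow> 'a) \<Rightarrow> (real \<Rightarrow> 'a) \<Rightarrow> bool" where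
  "path_homotopic X a b \<equiv> homotopic_with (\<lambda>h. h 0 = a \<and> h 1 = b) (top_of_set {0..1}) X"

lemma homotopic_with_endpointsD:
  fixes g :: "real \<Rightarrow> 'a"
  assumes "path_homotopic X a b g g'"
  obtains H :: "real \<times> real \<Rightarrow> 'a" where
    "continuous_map unit_square X H"
    "\<And>t. H (0, t) = g t" "\<And>t. H (1, t) = g' t"
    "\<And>s. s \<in> {0..1} \<Longrightarrow> H (s, 0) = a" "\<And>s. s \<in> {0..1} \<Longrightarrow> H (s, 1) = b"
  using assms unfolding homotopic_with_def by blast

lemma homotopic_with_endpointsI:
  fixes H :: "real \<times> real \<Rightarrow> 'a" and g g' :: "real \<Rightarrow> 'a"
  assumes "continuous_map unit_square X H"
    "\<And>t. t \<in> {0..1} \<Longrightarrow> H (0, t) = g t" "\<And>t. t \<in> {0..1} \<Longrightarrow> H (1, t) = g' t"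
    "\<And>s. s \<in> {0..1} \<Longrightarrow> H (s, 0) = a" "\<And>s. s \<in> {0..1} \<Longrightarrow> H (s, 1) = b"
  shows "path_homotopic X a b g g'"
proof (subst homotopic_with)
  show "\<And>h k. (\<And>x. x \<in> topspace (top_of_set {0..1}) \<Longrightarrow> h x = k x) \<Longrightarrow>
     (h (0::real) = a \<and> h 1 = b) = (k 0 = a \<and> k 1 = b)" by auto
  show "\<exists>h. continuous_map unit_square X h \<and>
      (\<forall>x \<in> topspace (top_of_set {0..1}). h (0, x) = g x) \<and>
      (\<forall>x \<in> topspace (top_of_set {0..1}). h (1, x) = g' x) \<and>
      (\<forall>t \<in> {0..1}. h (t, 0) = a \<and> h (t, 1) = b)"
    using assms by (intro exI[of _ H] conjI ballI) simp_all
qed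

text \<open>The four edges are lifted separately, each compared with the corresponding edge of a
  lift of the whole square. With constant \<open>b\<close> and \<open>u\<close> this is homotopy
  invariance of the end of a lift; with moving end points it yields the commutation of a lifted
  homotopy with deck transformations.\<close>

lemma covering_square_edges:
  assumes cov: "covering_map E M c" and F: "continuous_map unit_square M F"
    and l: "pathin E l" "\<And>t. t \<in> {0..1} \<Longrightarrow> c (l t) = F (0, t)"
    and b: "pathin E b" "\<And>s. s \<in> {0..1} \<Longrightarrow> c (b s) = F (s, 0)" "b 0 = l 0"
    and u: "pathin E u" "\<And>s. s \<in> {0..1} \<Longrightarrow> c (u s) = F (s, 1)" "u 0 = l 1"
    and r: "pathin E r" "\<And>t. t \<in> {0..1} \<Longrightarrow> c (r t) = F (1, t)" "r 0 = b 1"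
  shows "u 1 = r 1"
proof -
  obtain G where G: "continuous_map unit_square E G"
    "G (0, 0) = l 0" "\<And>s t. s \<in> {0..1} \<Longrightarrow> t \<in> {0..1} \<Longrightarrow> c (G (s, t)) = F (s, t)"
    using covering_square_lift[OF cov F, of "l 0"] l pathin_in_topspace[OF l(1), of 0] by auto
  have left: "G (0, t) = l t" if "t \<in> {0..1}" for t
    by (rule covering_path_lift_unique[OF cov pathin_square[OF G(1)] l(1) _ _ that]) (use G l in auto)
  have bottom: "G (s, 0) = b s" if "s \<in> {0..1}" for s
    by (rule covering_path_lift_unique[OF cov pathin_square[OF G(1)] b(1) _ _ that]) (use G b in auto)
  have top: "G (s, 1) = u s" if "s \<in> {0..1}" for s
    by (rule covering_path_lift_unique[OF cov pathin_square[OF G(1)] u(1) _ _ that])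
      (use G u left[of 1] in auto)
  have right: "G (1, t) = r t" if "t \<in> {0..1}" for t
    by (rule covering_path_lift_unique[OF cov pathin_square[OF G(1)] r(1) _ _ that])
      (use G r bottom[of 1] in auto)
  show ?thesis using top[of 1] right[of 1] by simp
qed

lemma homotopic_paths_lift_end:
  assumes cov: "covering_map E M c" and hom: "path_homotopic M a b g g'"
    and l: "pathin E l" "\<And>t. t \<in> {0..1} \<Longrightarrow> c (l t) = g t"
    and l': "pathin E l'" "\<And>t. t \<in> {0..1} \<Longrightarrow> c (l' t) = g' t"
    and eq: "l 0 = l' 0"
  shows "l 1 = l' 1"
proof -
  obtain H :: "real \<times> real \<Rightarrow> _" where H: "continuous_map unit_square M H"
    "\<And>t. H (0, t) = g t" "\<And>t. H (1, t) = g' t"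
    "\<And>s. s \<in> {0..1} \<Longrightarrow> H (s, 0) = a" "\<And>s. s \<in> {0..1} \<Longrightarrow> H (s, 1) = b"
    using homotopic_with_endpointsD[OF hom] by blast
  have const: "pathin E (\<lambda>s. l t)" "c (l t) = H (0, t)" if "t \<in> {0..1}" for t
    using pathin_in_topspace[OF l(1) that] l(2)[OF that] H(2) by (auto simp: pathin_def)
  show ?thesis
    by (rule covering_square_edges[OF cov H(1) l(1) _ const(1)[of 0] _ _ const(1)[of 1] _ _ l'(1)])
      (use l(2) l'(2) H(2,3) H(4)[of 0] H(5)[of 0] H(4,5) const(2)[of 0] const(2)[of 1] eq in auto)
qed

text \<open>The square is mapped into itself so that the edge \<open>s = 0\<close> traverses the first half of the left
  edge, \<open>s = 1\<close> traverses the second half backwards, and \<open>t = 0\<close> runs through the other three edges,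
  on which a nullhomotopy of \<open>l\<close> followed by the reverse of \<open>l'\<close> is constant.\<close>

lemma simply_connected_paths_homotopic:
  assumes sc: "simply_connected_space X" and l: "pathin X l" "pathin X l'"
    and ends: "l 0 = a" "l' 0 = a" "l 1 = b" "l' 1 = b"
  shows "path_homotopic X a b l l'"
proof -
  let ?g = "join_loops l (\<lambda>t. l' (1 - t))"
  have "loop_at X a ?g"
    unfolding loop_at_def using pathin_join[OF l(1) pathin_reverse[OF l(2)]] ends
    by (simp add: join_loops_def)
  then have "path_homotopic X a a ?g (\<lambda>t. a)"
    using sc by (simp add: simply_connected_space_def)
  from homotopic_with_endpointsD[OF this]
  obtain F :: "real \<times> real \<Rightarrow> _" where F: "continuous_map unit_square X F"
    "\<And>t. F (0, t) = ?g t" "\<And>t. F (1, t) = a"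
    "\<And>s. s \<in> {0..1} \<Longrightarrow> F (s, 0) = a" "\<And>s. s \<in> {0..1} \<Longrightarrow> F (s, 1) = a"
    by blast
  \<comment> \<open>\<open>(B1, B2)\<close> spends a third of its time on each of the edges with
    second coordinate 0, first coordinate 1 and second coordinate 1. For fixed \<open>s\<close>,
    \<open>\<phi>\<close> is the segment from this point to \<open>(0, 1/2)\<close>, where the
    joined path passes from \<open>l\<close> to the reverse of \<open>l'\<close>.\<close>
  define B1 where "B1 s = min 1 (min (3 * s) (3 - 3 * s))" for s :: real
  define B2 where "B2 s = max 0 (min 1 (3 * s - 1))" for s :: real
  define \<phi> where "\<phi> z = ((1 - snd z) * B1 (fst z), snd z / 2 + (1 - snd z) * B2 (fst z))" for z :: "real \<times> real"
  have B: "0 \<le> B1 s" "B1 s \<le> 1" "0 \<le> B2 s" "B2 s \<le> 1" if "s \<in> {0..1}" for s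
    using that by (auto simp: B1_def B2_def)
  have FB: "F (B1 s, B2 s) = a" if s: "s \<in> {0..1}" for s
  proof -
    consider "s \<le> 1/3" | "1/3 \<le> s" "s \<le> 2/3" | "2/3 \<le> s" by linarith
    then show ?thesis
    proof cases
      case 1
      then have "B2 s = 0" by (simp add: B2_def)
      then show ?thesis using F(4) B[OF s] by simp
    next
      case 2
      then have "B1 s = 1" by (simp add: B1_def)
      then show ?thesis using F(3) by simp
    next
      case 3
      then have "B2 s = 1" by (simp add: B2_def)
      then show ?thesis using F(5) B[OF s] by simp
    qed
  qed
  have \<phi>1: "(1 - t) * B1 s \<in> {0..1}" if "s \<in> {0..1}" "t \<in> {0..1}" for s t
    using B[OF that(1)] that(2) by (auto simp: mult_le_one)
  have \<phi>2: "t / 2 + (1 - t) * B2 s \<in> {0..1}" if "s \<in> {0..1}" "t \<in> {0..1}" for s t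
  proof -
    have "(1 - t) * B2 s \<le> (1 - t) * 1" using B[OF that(1)] that(2) by (intro mult_left_mono) auto
    then show ?thesis using B[OF that(1)] that(2) by auto
  qed
  have "continuous_on ({0..1} \<times> {0..1}) \<phi>"
    unfolding \<phi>_def B1_def B2_def by (intro continuous_intros) auto
  moreover have "\<phi> ` ({0..1} \<times> {0..1}) \<subseteq> {0..1} \<times> {0..1}"
    using \<phi>1 \<phi>2 by (auto simp: \<phi>_def)
  ultimately have "continuous_map (top_of_set ({0..1} \<times> {0..1})) (top_of_set ({0..1} \<times> {0..1})) \<phi>"
    by (auto simp: continuous_map_in_subtopology)
  then have cont: "continuous_map unit_square X (F \<circ> \<phi>)"
    using continuous_map_compose F(1) by (metis prod_topology_top_of_set)
  show ?thesis
  proof (rule homotopic_with_endpointsI[OF cont])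
    fix t :: real assume t: "t \<in> {0..1}"
    have "\<phi> (0, t) = (0, t / 2)" by (simp add: \<phi>_def B1_def B2_def)
    then show "(F \<circ> \<phi>) (0, t) = l t" using F(2) t by (simp add: join_loops_def)
    have "\<phi> (1, t) = (0, 1 - t / 2)" by (simp add: \<phi>_def B1_def B2_def field_simps)
    then show "(F \<circ> \<phi>) (1, t) = l' t" using F(2) t ends by (auto simp: join_loops_def)
    have "\<phi> (t, 0) = (B1 t, B2 t)" by (simp add: \<phi>_def)
    then show "(F \<circ> \<phi>) (t, 0) = a" using FB t by simp
    have "\<phi> (t, 1) = (0, 1 / 2)" by (simp add: \<phi>_def)
    then show "(F \<circ> \<phi>) (t, 1) = b" using F(2) ends by (simp add: join_loops_def)
  qed
qed

section \<open>The lifting criterion for simply connected spaces\<close>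

lemma continuous_map_locally:
  assumes "\<And>x. x \<in> topspace X \<Longrightarrow> \<exists>W. openin X W \<and> x \<in> W \<and> continuous_map (subtopology X W) Y g"
  shows "continuous_map X Y g"
proof (rule pasting_lemma[of "{W. openin X W \<and> continuous_map (subtopology X W) Y g}" X id Y "\<lambda>_. g"])
  show "\<exists>W. W \<in> {W. openin X W \<and> continuous_map (subtopology X W) Y g} \<and> x \<in> id W \<and> g x = g x"
    if "x \<in> topspace X" for x
    using assms[OF that] by auto
qed auto

text \<open>The value at \<open>x\<close> is the end of the lift of \<open>f\<close> along any path
  from \<open>t0\<close> to \<open>x\<close>. Any two such paths are homotopic in \<open>T\<close>,
  so their lifts end together. Near \<open>x\<close> the resulting map is a section of
  \<open>c\<close> over a sheet composed with \<open>f\<close>, because paths inside a small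
  path-connected neighbourhood \<open>W\<close> can be appended; this is where local
  path-connectedness enters.\<close>

lemma covering_lift_exists:
  assumes cov: "covering_map E M c" and sc: "simply_connected_space T"
    and lpc: "locally_path_connected_space T" and f: "continuous_map T M f"
    and t0: "t0 \<in> topspace T" and e0: "e0 \<in> topspace E" "c e0 = f t0"
  obtains g where "continuous_map T E g" "g t0 = e0" "\<And>x. x \<in> topspace T \<Longrightarrow> c (g x) = f x"
proof -
  define Lft where "Lft x e \<longleftrightarrow> (\<exists>\<gamma> l. pathin T \<gamma> \<and> \<gamma> 0 = t0 \<and> \<gamma> 1 = x \<and> pathin E l \<and> l 0 = e0 \<and>
      (\<forall>t \<in> {0..1}. c (l t) = f (\<gamma> t)) \<and> l 1 = e)" for x e
  have ex: "\<exists>e. Lft x e" if x: "x \<in> topspace T" for x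
  proof -
    obtain \<gamma> where \<gamma>: "pathin T \<gamma>" "\<gamma> 0 = t0" "\<gamma> 1 = x"
      using sc x t0 unfolding simply_connected_space_def path_connected_space_def by blast
    obtain l where "pathin E l" "l 0 = e0" "\<And>t. t \<in> {0..1} \<Longrightarrow> c (l t) = f (\<gamma> t)"
      using covering_path_lift[OF cov pathin_compose'[OF \<gamma>(1) f] e0(1)] e0(2) \<gamma>(2) by metis
    then show ?thesis using \<gamma> unfolding Lft_def by blast
  qed
  have unique: "e = e'" if Lft1: "Lft x e" and Lft2: "Lft x e'" for x e e'
  proof -
    obtain \<gamma> l where 1: "pathin T \<gamma>" "\<gamma> 0 = t0" "\<gamma> 1 = x" "pathin E l" "l 0 = e0"
      "\<And>t. t \<in> {0..1} \<Longrightarrow> c (l t) = f (\<gamma> t)" "l 1 = e"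
      using Lft1 unfolding Lft_def by blast
    obtain \<gamma>' l' where 2: "pathin T \<gamma>'" "\<gamma>' 0 = t0" "\<gamma>' 1 = x" "pathin E l'" "l' 0 = e0"
      "\<And>t. t \<in> {0..1} \<Longrightarrow> c (l' t) = f (\<gamma>' t)" "l' 1 = e'"
      using Lft2 unfolding Lft_def by blast
    have "path_homotopic T t0 x \<gamma> \<gamma>'"
      by (rule simply_connected_paths_homotopic[OF sc 1(1) 2(1) 1(2) 2(2) 1(3) 2(3)])
    then have "path_homotopic M (f t0) (f x) (f \<circ> \<gamma>) (f \<circ> \<gamma>')"
      by (rule homotopic_with_compose_continuous_map_left[OF _ f]) auto
    then show ?thesis using homotopic_paths_lift_end[OF cov _ 1(4) _ 2(4)] 1 2 by auto
  qed
  define g where "g x = (THE e. Lft x e)" for x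
  have gI: "g x = e" if "Lft x e" for x e
    unfolding g_def using that unique by blast
  have gL: "Lft x (g x)" if "x \<in> topspace T" for x
    using ex[OF that] gI by metis
  have cg: "c (g x) = f x \<and> g x \<in> topspace E" if "x \<in> topspace T" for x
  proof -
    note gLx = gL[OF that]
    obtain \<gamma> l where \<gamma>l: "\<gamma> 1 = x" "pathin E l" "\<forall>t \<in> {0..1}. c (l t) = f (\<gamma> t)" "l 1 = g x"
      using gLx unfolding Lft_def by blast
    have "c (l 1) = f (\<gamma> 1)" using bspec[OF \<gamma>l(3), of 1] by simp
    then show "c (g x) = f x \<and> g x \<in> topspace E"
      using pathin_in_topspace[of E l 1] \<gamma>l by simp
  qed
  have g0: "g t0 = e0"
  proof (rule gI, unfold Lft_def, intro exI conjI)
    show "pathin T (\<lambda>t. t0)" "pathin E (\<lambda>t. e0)" using t0 e0 by (auto simp: pathin_def)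
  qed (use e0 in auto)
  have "continuous_map T E g"
  proof (rule continuous_map_locally)
    fix x assume x: "x \<in> topspace T"
    have gx: "g x \<in> topspace E" "c (g x) = f x" using cg[OF x] by auto
    obtain U V where U: "openin M U"
      and V: "g x \<in> V" "openin E V" "homeomorphic_map (subtopology E V) (subtopology M U) c"
      using covering_map_sheet[OF cov gx(1)] by metis
    obtain s where s: "continuous_map (subtopology M U) E s"
      "\<And>u. u \<in> U \<Longrightarrow> s u \<in> V \<and> c (s u) = u" "\<And>v. v \<in> V \<Longrightarrow> c v \<in> U \<and> s (c v) = v"
      using sheet_section[OF V(3,2) U] by metis
    have fU: "f x \<in> U" using s(3)[OF V(1)] gx(2) by simp
    have "openin T {y \<in> topspace T. f y \<in> U}" using f U openin_continuous_map_preimage by blast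
    then obtain W where W: "openin T W" "path_connectedin T W" "x \<in> W" "W \<subseteq> {y \<in> topspace T. f y \<in> U}"
      using lpc x fU unfolding locally_path_connected_space by (metis (no_types, lifting) mem_Collect_eq)
    have fW: "continuous_map (subtopology T W) (subtopology M U) f"
      using W(4) f by (auto simp: continuous_map_in_subtopology intro: continuous_map_from_subtopology)
    have sf: "continuous_map (subtopology T W) E (s \<circ> f)"
      by (rule continuous_map_compose[OF fW s(1)])
    have "g w = s (f w)" if w: "w \<in> W" for w
    proof (rule gI)
      obtain \<delta> where \<delta>: "pathin (subtopology T W) \<delta>" "\<delta> 0 = x" "\<delta> 1 = w"
        using W(2,3) w unfolding path_connectedin_def path_connected_space_def
        by (metis Int_absorb1 topspace_subtopology)
      obtain \<gamma> l where 1: "pathin T \<gamma>" "\<gamma> 0 = t0" "\<gamma> 1 = x" "pathin E l" "l 0 = e0"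
        "\<And>t. t \<in> {0..1} \<Longrightarrow> c (l t) = f (\<gamma> t)" "l 1 = g x"
        using gL[OF x] unfolding Lft_def by blast
      have \<delta>T: "pathin T \<delta>" "\<And>t. t \<in> {0..1} \<Longrightarrow> \<delta> t \<in> W" using \<delta>(1) by (auto simp: pathin_subtopology)
      have sx: "s (f x) = g x" using s(3)[OF V(1)] cg[OF x] by simp
      show "Lft w (s (f w))"
        unfolding Lft_def
      proof (intro exI conjI ballI)
        show "pathin T (join_loops \<gamma> \<delta>)" using pathin_join 1 \<delta>T \<delta> by metis
        have "pathin E (\<lambda>t. s (f (\<delta> t)))" using pathin_compose'[OF \<delta>(1) sf] by (simp add: o_def)
        then show "pathin E (join_loops l (\<lambda>t. s (f (\<delta> t))))"
          using pathin_join[OF 1(4)] 1(7) \<delta>(2) sx by simp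
        fix t :: real assume t: "t \<in> {0..1}"
        show "c (join_loops l (\<lambda>t. s (f (\<delta> t))) t) = f (join_loops \<gamma> \<delta> t)"
        proof (cases "t \<le> 1/2")
          case True
          then show ?thesis using 1(6)[of "2 * t"] t by (simp add: join_loops_def)
        next
          case False
          then have "f (\<delta> (2 * t - 1)) \<in> U" using \<delta>T(2)[of "2 * t - 1"] t W(4) by auto
          then show ?thesis using False s(2) by (simp add: join_loops_def)
        qed
      qed (use 1 \<delta> in \<open>auto simp: join_loops_def\<close>)
    qed
    then have "continuous_map (subtopology T W) E g"
      by (intro continuous_map_eq[OF sf]) auto
    then show "\<exists>W. openin T W \<and> x \<in> W \<and> continuous_map (subtopology T W) E g" using W by blast
  qed
  then show ?thesis using that g0 cg by blast
qed

section \<open>Deck transformations of a universal cover\<close>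

lemma deck_transformationD:
  assumes "deck_transformation E c h"
  shows "continuous_map E E h" "y \<in> topspace E \<Longrightarrow> h y \<in> topspace E" "y \<in> topspace E \<Longrightarrow> c (h y) = c y"
    "h \<in> extensional (topspace E)"
  using assms homeomorphic_imp_continuous_map[of E E h] continuous_map_funspace[of E E h]
  by (auto simp: deck_transformation_def)

lemma deck_transformation_eqI:
  assumes cov: "covering_map E M c" and con: "connected_space E"
    and h: "deck_transformation E c h" "deck_transformation E c h'"
    and y: "y \<in> topspace E" "h y = h' y"
  shows "h = h'"
proof (rule extensionalityI[of _ "topspace E"])
  fix x assume "x \<in> topspace E"
  then show "h x = h' x"
    using covering_lift_unique[OF cov con deck_transformationD(1)[OF h(1)] deck_transformationD(1)[OF h(2)] _ y]
      deck_transformationD(3) h by metis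
qed (use deck_transformationD(4)[OF h(1)] deck_transformationD(4)[OF h(2)] in auto)

lemma deck_transformation_compose:
  assumes h: "deck_transformation E c h" "deck_transformation E c h'"
  shows "deck_transformation E c (compose (topspace E) h h')"
proof -
  have "homeomorphic_map E E (h \<circ> h')"
    using h by (auto simp: deck_transformation_def intro: homeomorphic_map_compose)
  then have "homeomorphic_map E E (compose (topspace E) h h')"
    by (rule homeomorphic_map_eq) (simp add: compose_def)
  then show ?thesis
    using deck_transformationD[OF h(1)] deck_transformationD[OF h(2)]
    by (auto simp: deck_transformation_def compose_def)
qed

lemma simply_connected_imp_connected_space: "simply_connected_space X \<Longrightarrow> connected_space X"
  by (simp add: simply_connected_space_def path_connected_imp_connected_space)

text \<open>Local path-connectedness is what lifting maps defined on \<open>E\<close> itself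
  requires; for covers of closed 3-manifolds it comes from charts.\<close>

locale universal_covering =
  fixes E :: "'b topology" and M :: "'a topology" and c :: "'b \<Rightarrow> 'a"
  assumes uc: "universal_cover E M c" and lpc: "locally_path_connected_space E"
begin

lemma cov: "covering_map E M c" and sc: "simply_connected_space E"
  using uc by (auto simp: universal_cover_def)

lemma con: "connected_space E"
  using sc by (rule simply_connected_imp_connected_space)

lemma path_ex: "x \<in> topspace E \<Longrightarrow> y \<in> topspace E \<Longrightarrow> \<exists>l. pathin E l \<and> l 0 = x \<and> l 1 = y"
  using sc by (simp add: simply_connected_space_def path_connected_space_def)

text \<open>Lifts of \<open>c\<close> through itself, from \<open>y\<close> to \<open>y'\<close> and
  back, compose to lifts of \<open>c\<close> that fix a point and so are the identity. Restriction
  to \<open>topspace E\<close> makes the result extensional, as \<open>deck_transformation\<close>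
  demands.\<close>

lemma deck_transformation_exists:
  assumes y: "y \<in> topspace E" "y' \<in> topspace E" "c y = c y'"
  obtains h where "deck_transformation E c h" "h y = y'"
proof -
  have cc: "continuous_map E M c" using cov by (rule covering_map_continuous)
  obtain g where g: "continuous_map E E g" "g y = y'" "\<And>x. x \<in> topspace E \<Longrightarrow> c (g x) = c x"
    using covering_lift_exists[OF cov sc lpc cc y(1,2)] y(3) by metis
  obtain g' where g': "continuous_map E E g'" "g' y' = y" "\<And>x. x \<in> topspace E \<Longrightarrow> c (g' x) = c x"
    using covering_lift_exists[OF cov sc lpc cc y(2,1)] y(3) by metis
  have gE: "g x \<in> topspace E" "g' x \<in> topspace E" if "x \<in> topspace E" for x
    using that g(1) g'(1) by (auto simp: continuous_map_def)
  have 1: "(g' \<circ> g) x = id x" if "x \<in> topspace E" for x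
    by (rule covering_lift_unique[OF cov con continuous_map_compose[OF g(1) g'(1)] continuous_map_id _ y(1) _ that])
      (use g g' gE in auto)
  have 2: "(g \<circ> g') x = id x" if "x \<in> topspace E" for x
    by (rule covering_lift_unique[OF cov con continuous_map_compose[OF g'(1) g(1)] continuous_map_id _ y(2) _ that])
      (use g g' gE in auto)
  have "homeomorphic_maps E E g g'"
    using g(1) g'(1) 1 2 by (auto simp: homeomorphic_maps_def)
  then have "homeomorphic_map E E g" using homeomorphic_map_maps by blast
  then have "homeomorphic_map E E (restrict g (topspace E))" by (rule homeomorphic_map_eq) auto
  then have "deck_transformation E c (restrict g (topspace E))"
    using g by (auto simp: deck_transformation_def)
  then show ?thesis using that g(2) y(1) by fastforce
qed

section \<open>The fundamental group as the deck group\<close>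

lemma homotopic_if_lift_ends:
  assumes "pathin E l" "\<And>t. t \<in> {0..1} \<Longrightarrow> c (l t) = g t" "pathin E l'" "\<And>t. t \<in> {0..1} \<Longrightarrow> c (l' t) = g' t"
    and "l 0 = l' 0" "l 1 = l' 1" and x: "x = c (l 0)" "x = c (l 1)"
  shows "path_homotopic M x x g g'"
proof -
  have "path_homotopic E (l 0) (l 1) l l'"
    using simply_connected_paths_homotopic[OF sc assms(1,3)] assms(5,6) by simp
  then have *: "path_homotopic M x x (c \<circ> l) (c \<circ> l')"
    by (rule homotopic_with_compose_continuous_map_left[OF _ covering_map_continuous[OF cov]]) (use x in auto)
  show ?thesis
    by (rule homotopic_with_eq[OF *]) (use assms in auto)
qed

lemma loop_lift:
  assumes "y \<in> topspace E" "loop_at M (c y) g"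
  obtains l where "pathin E l" "l 0 = y" "\<And>t. t \<in> {0..1} \<Longrightarrow> c (l t) = g t"
  using covering_path_lift[OF cov, of g y] assms unfolding loop_at_def by metis

lemma loop_class_self: "loop_at M x g \<Longrightarrow> g \<in> loop_class M x g"
  by (simp add: loop_class_def loop_at_def pathin_def)

lemma loop_class_eqI:
  assumes "path_homotopic M x x g g'"
  shows "loop_class M x g = loop_class M x g'"
  unfolding loop_class_def using assms homotopic_with_trans homotopic_with_symD by blast

lemma loop_classD:
  assumes "g' \<in> loop_class M x g"
  shows "loop_at M x g'" "path_homotopic M x x g g'"
  using assms homotopic_with_imp_continuous_maps[of _ "top_of_set {0..1}" M g g']
    homotopic_with_imp_property[of "\<lambda>h. h 0 = x \<and> h 1 = x" "top_of_set {0..1}" M g g']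
  by (auto simp: loop_class_def loop_at_def pathin_def)

text \<open>Evaluates the definite description in \<open>deck_action\<close> from one representative
  and one lift. Other choices give the same end point because lifts of homotopic loops end together,
  and a deck transformation is determined by one value.\<close>

lemma deck_action_eq:
  assumes y: "y \<in> topspace E" and g: "g \<in> loop_class M (c y) k"
    and l: "pathin E l" "l 0 = y" "\<And>t. t \<in> {0..1} \<Longrightarrow> c (l t) = g t"
    and h: "deck_transformation E c h" "h y = l 1"
  shows "deck_action E c y (loop_class M (c y) k) = h"
  unfolding deck_action_def
proof (rule the_equality)
  show "deck_transformation E c h \<and> (\<exists>g\<in>loop_class M (c y) k. \<exists>l. pathin E l \<and> l 0 = y \<and>
      (\<forall>t\<in>{0..1}. c (l t) = g t) \<and> h y = l 1)"
    using assms by blast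
next
  fix h' assume "deck_transformation E c h' \<and> (\<exists>g\<in>loop_class M (c y) k. \<exists>l. pathin E l \<and> l 0 = y \<and>
      (\<forall>t\<in>{0..1}. c (l t) = g t) \<and> h' y = l 1)"
  then obtain g' l' where h': "deck_transformation E c h'" and g': "g' \<in> loop_class M (c y) k"
    and l': "pathin E l'" "l' 0 = y" "\<And>t. t \<in> {0..1} \<Longrightarrow> c (l' t) = g' t" "h' y = l' 1"
    by blast
  have "path_homotopic M (c y) (c y) g g'"
    using loop_classD(2)[OF g] loop_classD(2)[OF g'] homotopic_with_trans homotopic_with_symD by blast
  then have "l 1 = l' 1"
    using homotopic_paths_lift_end[OF cov _ l(1,3) l'(1,3)] l(2) l'(2) by simp
  then show "h' = h"
    using deck_transformation_eqI[OF cov con h' h(1) y] h(2) l'(4) by simp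
qed

lemma deck_action_loop_class:
  assumes y: "y \<in> topspace E" and g: "g \<in> loop_class M (c y) k"
    and l: "pathin E l" "l 0 = y" "\<And>t. t \<in> {0..1} \<Longrightarrow> c (l t) = g t"
  shows "deck_transformation E c (deck_action E c y (loop_class M (c y) k))"
    "deck_action E c y (loop_class M (c y) k) y = l 1"
proof -
  have "c (l 1) = c y" using loop_classD(1)[OF g] l(3)[of 1] by (simp add: loop_at_def)
  then obtain h where h: "deck_transformation E c h" "h y = l 1"
    using deck_transformation_exists[of y "l 1"] y pathin_in_topspace[OF l(1), of 1] by auto
  then have "deck_action E c y (loop_class M (c y) k) = h" using deck_action_eq[OF y g l h] by simp
  then show "deck_transformation E c (deck_action E c y (loop_class M (c y) k))"
    "deck_action E c y (loop_class M (c y) k) y = l 1" using h by auto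
qed

lemma carrier_fundamental_group:
  "carrier (fundamental_group M x) = loop_class M x ` {g. loop_at M x g}"
  by (simp add: fundamental_group_def)

text \<open>Loops whose lifts from \<open>y\<close> end together are homotopic because
  \<open>E\<close> is simply connected, which gives injectivity. A deck transformation
  \<open>h\<close> comes from the projection of a path from \<open>y\<close> to
  \<open>h y\<close>.\<close>

lemma deck_action_bij:
  assumes y: "y \<in> topspace E"
  shows "bij_betw (deck_action E c y) (carrier (fundamental_group M (c y))) {h. deck_transformation E c h}"
  unfolding bij_betw_def
proof
  show "inj_on (deck_action E c y) (carrier (fundamental_group M (c y)))"
  proof (rule inj_onI, unfold carrier_fundamental_group, clarify)
    fix g g' assume g: "loop_at M (c y) g" "loop_at M (c y) g'"
      and eq: "deck_action E c y (loop_class M (c y) g) = deck_action E c y (loop_class M (c y) g')"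
    obtain l where l: "pathin E l" "l 0 = y" "\<And>t. t \<in> {0..1} \<Longrightarrow> c (l t) = g t"
      using loop_lift[OF y g(1)] by blast
    obtain l' where l': "pathin E l'" "l' 0 = y" "\<And>t. t \<in> {0..1} \<Longrightarrow> c (l' t) = g' t"
      using loop_lift[OF y g(2)] by blast
    have "l 1 = l' 1"
      using deck_action_loop_class(2)[OF y loop_class_self[OF g(1)] l]
        deck_action_loop_class(2)[OF y loop_class_self[OF g(2)] l'] eq by simp
    moreover have "c (l 1) = c y" using l(3)[of 1] g(1) by (simp add: loop_at_def)
    ultimately have "path_homotopic M (c y) (c y) g g'"
      using homotopic_if_lift_ends[OF l(1,3) l'(1,3)] l(2) l'(2) by simp
    then show "loop_class M (c y) g = loop_class M (c y) g'" by (rule loop_class_eqI)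
  qed
  show "deck_action E c y ` carrier (fundamental_group M (c y)) = {h. deck_transformation E c h}"
  proof (intro equalityI subsetI)
    fix h assume "h \<in> deck_action E c y ` carrier (fundamental_group M (c y))"
    then obtain g where g: "loop_at M (c y) g" "h = deck_action E c y (loop_class M (c y) g)"
      by (auto simp: carrier_fundamental_group)
    obtain l where l: "pathin E l" "l 0 = y" "\<And>t. t \<in> {0..1} \<Longrightarrow> c (l t) = g t"
      using loop_lift[OF y g(1)] by blast
    show "h \<in> {h. deck_transformation E c h}"
      using deck_action_loop_class(1)[OF y loop_class_self[OF g(1)] l] g(2) by simp
  next
    fix h assume "h \<in> {h. deck_transformation E c h}"
    then have h: "deck_transformation E c h" by simp
    obtain l where l: "pathin E l" "l 0 = y" "l 1 = h y"
      using path_ex[OF y deck_transformationD(2)[OF h y]] by blast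
    have g: "loop_at M (c y) (\<lambda>t. c (l t))"
      using pathin_compose'[OF l(1) covering_map_continuous[OF cov]] l(2,3) deck_transformationD(3)[OF h y]
      by (simp add: loop_at_def)
    have "deck_action E c y (loop_class M (c y) (\<lambda>t. c (l t))) = h"
      by (rule deck_action_eq[OF y loop_class_self[OF g] l(1,2) _ h]) (use l in auto)
    then show "h \<in> deck_action E c y ` carrier (fundamental_group M (c y))"
      using g by (force simp: carrier_fundamental_group)
  qed
qed

text \<open>If \<open>l\<close> and \<open>l'\<close> lift \<open>g\<close> and \<open>g'\<close>
  from \<open>y\<close>, then \<open>l\<close> followed by \<open>h \<circ> l'\<close> lifts the
  joined loop and ends at \<open>h (k y)\<close>; hence the order of the product is kept. The
  product in \<open>fundamental_group\<close> is a union over all representatives, so it must be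
  seen to be a single class: all joined loops have lifts from \<open>y\<close> with this same end
  and are therefore homotopic.\<close>

lemma deck_action_mult:
  assumes y: "y \<in> topspace E"
    and \<alpha>: "\<alpha> \<in> carrier (fundamental_group M (c y))" and \<beta>: "\<beta> \<in> carrier (fundamental_group M (c y))"
  shows "\<alpha> \<otimes>\<^bsub>fundamental_group M (c y)\<^esub> \<beta> \<in> carrier (fundamental_group M (c y))"
    "deck_action E c y (\<alpha> \<otimes>\<^bsub>fundamental_group M (c y)\<^esub> \<beta>) =
      compose (topspace E) (deck_action E c y \<alpha>) (deck_action E c y \<beta>)"
proof -
  obtain a b where a: "loop_at M (c y) a" "\<alpha> = loop_class M (c y) a"
    and b: "loop_at M (c y) b" "\<beta> = loop_class M (c y) b"
    using \<alpha> \<beta> by (auto simp: carrier_fundamental_group)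
  define h where "h = deck_action E c y \<alpha>"
  define k where "k = deck_action E c y \<beta>"
  have lift: "loop_at M (c y) (join_loops g g') \<and> deck_transformation E c h \<and> deck_transformation E c k \<and>
      (\<exists>l. pathin E l \<and> l 0 = y \<and> l 1 = h (k y) \<and> (\<forall>t \<in> {0..1}. c (l t) = join_loops g g' t))"
    if g: "g \<in> \<alpha>" and g': "g' \<in> \<beta>" for g g'
  proof -
    note ga = g[unfolded a(2)] and gb = g'[unfolded b(2)]
    obtain l where l: "pathin E l" "l 0 = y" "\<And>t. t \<in> {0..1} \<Longrightarrow> c (l t) = g t"
      using loop_lift[OF y loop_classD(1)[OF ga]] by blast
    obtain l' where l': "pathin E l'" "l' 0 = y" "\<And>t. t \<in> {0..1} \<Longrightarrow> c (l' t) = g' t"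
      using loop_lift[OF y loop_classD(1)[OF gb]] by blast
    have h: "deck_transformation E c h" "h y = l 1"
      using deck_action_loop_class[OF y ga l] by (auto simp: h_def a(2))
    have k: "deck_transformation E c k" "k y = l' 1"
      using deck_action_loop_class[OF y gb l'] by (auto simp: k_def b(2))
    have "pathin E (join_loops l (\<lambda>t. h (l' t)))"
      by (rule pathin_join[OF l(1) pathin_compose'[OF l'(1) deck_transformationD(1)[OF h(1)]]])
        (use h l' in simp)
    moreover have "c (join_loops l (\<lambda>t. h (l' t)) t) = join_loops g g' t" if "t \<in> {0..1}" for t
      using that l(3)[of "2 * t"] l'(3)[of "2 * t - 1"] deck_transformationD(3)[OF h(1)]
        pathin_in_topspace[OF l'(1), of "2 * t - 1"]
      by (auto simp: join_loops_def)
    moreover have "loop_at M (c y) (join_loops g g')"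
      using loop_classD(1)[OF ga] loop_classD(1)[OF gb] pathin_join[of M g g']
      by (auto simp: loop_at_def join_loops_def)
    ultimately show ?thesis
      using h k l l' by (intro conjI exI[of _ "join_loops l (\<lambda>t. h (l' t))"] ballI) (auto simp: join_loops_def)
  qed
  have ab: "a \<in> \<alpha>" "b \<in> \<beta>" using a b loop_class_self by auto
  have eq: "loop_class M (c y) (join_loops g g') = loop_class M (c y) (join_loops a b)"
    if g: "g \<in> \<alpha>" and g': "g' \<in> \<beta>" for g g'
  proof (rule loop_class_eqI)
    obtain l where l: "pathin E l" "l 0 = y" "l 1 = h (k y)" "\<And>t. t \<in> {0..1} \<Longrightarrow> c (l t) = join_loops g g' t"
      using lift[OF g g'] by blast
    obtain l' where l': "pathin E l'" "l' 0 = y" "l' 1 = h (k y)" "\<And>t. t \<in> {0..1} \<Longrightarrow> c (l' t) = join_loops a b t"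
      using lift[OF ab] by blast
    have "c (l 1) = c y" using lift[OF g g'] l(4)[of 1] by (simp add: loop_at_def)
    then show "path_homotopic M (c y) (c y) (join_loops g g') (join_loops a b)"
      using homotopic_if_lift_ends[OF l(1,4) l'(1,4)] l(2,3) l'(2,3) by simp
  qed
  have "\<alpha> \<otimes>\<^bsub>fundamental_group M (c y)\<^esub> \<beta> = (\<Union>g\<in>\<alpha>. \<Union>g'\<in>\<beta>. loop_class M (c y) (join_loops g g'))"
    by (simp add: fundamental_group_def)
  also have "\<dots> = (\<Union>g\<in>\<alpha>. \<Union>g'\<in>\<beta>. loop_class M (c y) (join_loops a b))"
    using eq by (intro SUP_cong refl) auto
  also have "\<dots> = loop_class M (c y) (join_loops a b)" using ab by blast
  finally have m: "\<alpha> \<otimes>\<^bsub>fundamental_group M (c y)\<^esub> \<beta> = loop_class M (c y) (join_loops a b)" .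
  obtain l where l: "pathin E l" "l 0 = y" "l 1 = h (k y)" "\<And>t. t \<in> {0..1} \<Longrightarrow> c (l t) = join_loops a b t"
    using lift[OF ab] by blast
  have loop: "loop_at M (c y) (join_loops a b)" using lift[OF ab] by blast
  show "\<alpha> \<otimes>\<^bsub>fundamental_group M (c y)\<^esub> \<beta> \<in> carrier (fundamental_group M (c y))"
    using m loop by (auto simp: carrier_fundamental_group)
  show "deck_action E c y (\<alpha> \<otimes>\<^bsub>fundamental_group M (c y)\<^esub> \<beta>) =
      compose (topspace E) (deck_action E c y \<alpha>) (deck_action E c y \<beta>)"
    unfolding m h_def[symmetric] k_def[symmetric]
    by (rule deck_action_eq[OF y loop_class_self[OF loop] l(1,2,4) deck_transformation_compose])
      (use lift[OF ab] l(3) y in \<open>auto simp: compose_def\<close>)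
qed

end

section \<open>Deck groups and homotopy equivalences\<close>

lemma covering_map_surj: "covering_map E M c \<Longrightarrow> x \<in> topspace M \<Longrightarrow> \<exists>y \<in> topspace E. c y = x"
  using imageE[of x c "topspace E"] by (metis covering_map_def)

text \<open>A self-map homotopic to the identity induces a conjugation on the fundamental group. The
  corresponding deck transformation \<open>e\<close> moves \<open>w y\<close> to the end of the
  lifted track of \<open>y\<close> under the homotopy.\<close>

lemma (in universal_covering) deck_commute_up_to_conjugation:
  assumes w: "continuous_map E E w" "\<And>x. x \<in> topspace E \<Longrightarrow> c (w x) = \<phi> (c x)"
    and hom: "homotopic_with (\<lambda>_. True) M M id \<phi>" and y: "y \<in> topspace E"
  obtains e where "deck_transformation E c e" "\<And>h. deck_transformation E c h \<Longrightarrow> e (w (h y)) = h (e (w y))"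
proof -
  let ?I = "top_of_set {0..1::real}"
  obtain K where K: "continuous_map (prod_topology ?I M) M K" "\<And>x. K (0, x) = x" "\<And>x. K (1, x) = \<phi> x"
    using hom unfolding homotopic_with_def by auto
  have cc: "continuous_map E M c" using cov by (rule covering_map_continuous)
  have cM: "c x \<in> topspace M" if "x \<in> topspace E" for x using cov covering_map_in_topspace that by metis
  have wE: "w x \<in> topspace E" if "x \<in> topspace E" for x
    using w(1) that by (auto simp: continuous_map_def)
  have track: "pathin M (\<lambda>s. K (s, c x))" if "x \<in> topspace E" for x
  proof -
    have "continuous_map ?I (prod_topology ?I M) (\<lambda>s. (s, c x))"
      using cM[OF that] by (intro continuous_map_pairedI) auto
    from continuous_map_compose[OF this K(1)] show ?thesis by (simp add: pathin_def o_def)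
  qed
  obtain l where l: "pathin E l" "l 0 = y" "\<And>t. t \<in> {0..1} \<Longrightarrow> c (l t) = K (t, c y)"
    using covering_path_lift[OF cov track[OF y] y] K(2) by metis
  have l1: "l 1 \<in> topspace E" using pathin_in_topspace[OF l(1)] by simp
  have "c (w y) = c (l 1)" using w(2)[OF y] l(3)[of 1] K(3) by simp
  then obtain e where e: "deck_transformation E c e" "e (w y) = l 1"
    using deck_transformation_exists[OF wE[OF y] l1] by metis
  have "e (w (h y)) = h (e (w y))" if h: "deck_transformation E c h" for h
  proof -
    note hD = deck_transformationD[OF h] and eD = deck_transformationD[OF e(1)]
    obtain \<gamma> where \<gamma>: "pathin E \<gamma>" "\<gamma> 0 = y" "\<gamma> 1 = h y"
      using path_ex[OF y hD(2)[OF y]] by blast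
    have \<gamma>E: "\<gamma> t \<in> topspace E" if "t \<in> {0..1}" for t using pathin_in_topspace[OF \<gamma>(1) that] .
    let ?F = "\<lambda>z::real \<times> real. K (fst z, c (\<gamma> (snd z)))"
    have "continuous_map (prod_topology ?I ?I) M (c \<circ> \<gamma> \<circ> snd)"
      using \<gamma>(1) cc by (intro continuous_map_compose[OF continuous_map_snd] continuous_map_compose[of _ E])
        (auto simp: pathin_def)
    then have "continuous_map (prod_topology ?I ?I) (prod_topology ?I M) (\<lambda>z. (fst z, c (\<gamma> (snd z))))"
      by (intro continuous_map_pairedI continuous_map_fst) (simp add: o_def)
    from continuous_map_compose[OF this K(1)]
    have F: "continuous_map (prod_topology ?I ?I) M ?F" by (simp add: o_def)
    \<comment> \<open>The homotopy is applied along the projection of a path from \<open>y\<close>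
      to \<open>h y\<close>. The lifted edges are \<open>\<gamma>\<close> on the left, the track
      \<open>l\<close> of \<open>y\<close> at the bottom, its translate by \<open>h\<close> at the
      top and the image of \<open>\<gamma>\<close> under \<open>e \<circ> w\<close> on the
      right.\<close>
    have "h (l 1) = e (w (\<gamma> 1))"
    proof (rule covering_square_edges[OF cov F \<gamma>(1) _ l(1) _ _ pathin_compose'[OF l(1) hD(1)] _ _
          pathin_compose'[OF pathin_compose'[OF \<gamma>(1) w(1)] eD(1)]])
      show "c (h (l s)) = ?F (s, 1)" if "s \<in> {0..1}" for s
        using l(3)[OF that] \<gamma>(3) hD(3)[OF y] hD(3)[OF pathin_in_topspace[OF l(1) that]] by simp
      show "c (e (w (\<gamma> t))) = ?F (1, t)" if "t \<in> {0..1}" for t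
        using \<gamma>E[OF that] eD(3) wE w(2) K(3) by simp
    qed (use \<gamma> l K(2) e(2) in auto)
    then show ?thesis using \<gamma>(3) e(2) by simp
  qed
  then show ?thesis using that e(1) by blast
qed

text \<open>\<open>u \<circ> h\<close> and \<open>k \<circ> u\<close> lie over the same map for
  every deck transformation \<open>k\<close> of \<open>F\<close>, so a \<open>k\<close> that makes
  them match at \<open>y\<close> makes them equal everywhere.\<close>

lemma deck_induced:
  assumes E: "universal_covering E M c" and F: "universal_covering F N d"
    and u: "continuous_map E F u" "\<And>x. x \<in> topspace E \<Longrightarrow> d (u x) = \<phi> (c x)"
    and ne: "y \<in> topspace E"
  obtains D where "\<And>h. deck_transformation E c h \<Longrightarrow> deck_transformation F d (D h)"
    "\<And>h x. deck_transformation E c h \<Longrightarrow> x \<in> topspace E \<Longrightarrow> D h (u x) = u (h x)"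
proof -
  interpret E: universal_covering E M c by fact
  interpret F: universal_covering F N d by fact
  have uF: "u x \<in> topspace F" if "x \<in> topspace E" for x
    using u(1) that by (auto simp: continuous_map_def)
  have "\<exists>k. deck_transformation F d k \<and> (\<forall>x \<in> topspace E. k (u x) = u (h x))"
    if h: "deck_transformation E c h" for h
  proof -
    note hD = deck_transformationD[OF h]
    have "d (u y) = d (u (h y))" using u(2) ne hD by simp
    then obtain k where k: "deck_transformation F d k" "k (u y) = u (h y)"
      using F.deck_transformation_exists[OF uF[OF ne] uF[OF hD(2)[OF ne]]] by metis
    note kD = deck_transformationD[OF k(1)]
    have "(k \<circ> u) x = (u \<circ> h) x" if "x \<in> topspace E" for x
      by (rule covering_lift_unique[OF F.cov E.con continuous_map_compose[OF u(1) kD(1)]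
            continuous_map_compose[OF hD(1) u(1)] _ ne _ that])
        (use kD hD u(2) uF k(2) in auto)
    then show ?thesis using k(1) by auto
  qed
  then show ?thesis using that by metis
qed

text \<open>A deck transformation \<open>h\<close> of \<open>E\<close> corresponds to the deck transformation \<open>k\<close> of \<open>F\<close> with
  \<open>k \<circ> U = U \<circ> h\<close>, where \<open>U\<close> lifts the homotopy equivalence.\<close>

lemma deck_groups_iso:
  assumes E: "universal_covering E M c" and F: "universal_covering F N d"
    and heq: "M homotopy_equivalent_space N" and ne: "topspace E \<noteq> {}"
    and comm: "\<And>h k x. deck_transformation F d h \<Longrightarrow> deck_transformation F d k \<Longrightarrow> x \<in> topspace F \<Longrightarrow>
      h (k x) = k (h x)"
  obtains D where "bij_betw D {h. deck_transformation E c h} {k. deck_transformation F d k}"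
    "\<And>h k. deck_transformation E c h \<Longrightarrow> deck_transformation E c k \<Longrightarrow>
      D (compose (topspace E) h k) = compose (topspace F) (D h) (D k)"
proof -
  interpret E: universal_covering E M c by fact
  interpret F: universal_covering F N d by fact
  obtain u v where u: "continuous_map M N u" and v: "continuous_map N M v"
    and vu: "homotopic_with (\<lambda>_. True) M M (v \<circ> u) id" and uv: "homotopic_with (\<lambda>_. True) N N (u \<circ> v) id"
    using heq unfolding homotopy_equivalent_space_def by blast
  obtain y where y: "y \<in> topspace E" using ne by blast
  have cc: "continuous_map E M c" and dc: "continuous_map F N d"
    using E.cov F.cov covering_map_continuous by auto
  have "u (c y) \<in> topspace N"
    using u covering_map_in_topspace[OF E.cov y] by (auto simp: continuous_map_def)
  then obtain z where z: "z \<in> topspace F" "d z = u (c y)"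
    using covering_map_surj[OF F.cov] by metis
  obtain U where U: "continuous_map E F U" "U y = z" "\<And>x. x \<in> topspace E \<Longrightarrow> d (U x) = (u \<circ> c) x"
    by (rule covering_lift_exists[OF F.cov E.sc E.lpc continuous_map_compose[OF cc u] y z(1)])
      (use z in auto)
  have "v (d z) \<in> topspace M"
    using v covering_map_in_topspace[OF F.cov z(1)] by (auto simp: continuous_map_def)
  then obtain y' where y': "y' \<in> topspace E" "c y' = v (d z)"
    using covering_map_surj[OF E.cov] by metis
  obtain V where V: "continuous_map F E V" "V z = y'" "\<And>x. x \<in> topspace F \<Longrightarrow> c (V x) = (v \<circ> d) x"
    by (rule covering_lift_exists[OF E.cov F.sc F.lpc continuous_map_compose[OF dc v] z(1) y'(1)])
      (use y' in auto)
  have UF: "U x \<in> topspace F" if "x \<in> topspace E" for x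
    using U(1) that by (auto simp: continuous_map_def)
  have VE: "V x \<in> topspace E" if "x \<in> topspace F" for x
    using V(1) that by (auto simp: continuous_map_def)
  obtain D where D: "\<And>h. deck_transformation E c h \<Longrightarrow> deck_transformation F d (D h)"
    and DU: "\<And>h x. deck_transformation E c h \<Longrightarrow> x \<in> topspace E \<Longrightarrow> D h (U x) = U (h x)"
    by (rule deck_induced[OF E F U(1) _ y, of u]) (use U(3) in auto)
  obtain D' where D': "\<And>k. deck_transformation F d k \<Longrightarrow> deck_transformation E c (D' k)"
    and DV: "\<And>k x. deck_transformation F d k \<Longrightarrow> x \<in> topspace F \<Longrightarrow> D' k (V x) = V (k x)"
    by (rule deck_induced[OF F E V(1) _ z(1), of v]) (use V(3) in auto)
  obtain e where e: "deck_transformation E c e"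
    "\<And>h. deck_transformation E c h \<Longrightarrow> e ((V \<circ> U) (h y)) = h (e ((V \<circ> U) y))"
    by (rule E.deck_commute_up_to_conjugation[OF continuous_map_compose[OF U(1) V(1)] _ homotopic_with_symD[OF vu] y])
      (use U(3) V(3) UF in auto)
  obtain f where f: "deck_transformation F d f"
    "\<And>h. deck_transformation F d h \<Longrightarrow> f ((U \<circ> V) (h z)) = h (f ((U \<circ> V) z))"
    by (rule F.deck_commute_up_to_conjugation[OF continuous_map_compose[OF V(1) U(1)] _ homotopic_with_symD[OF uv] z(1)])
      (use U(3) V(3) VE in auto)
  note eD = deck_transformationD[OF e(1)] and fD = deck_transformationD[OF f(1)]
  have eqE: "h = k" if "deck_transformation E c h" "deck_transformation E c k" "x \<in> topspace E" "h x = k x" for h k x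
    using deck_transformation_eqI[OF E.cov E.con that] .
  have eqF: "h = k" if "deck_transformation F d h" "deck_transformation F d k" "x \<in> topspace F" "h x = k x" for h k x
    using deck_transformation_eqI[OF F.cov F.con that] .
  show ?thesis
  proof
    show "bij_betw D {h. deck_transformation E c h} {k. deck_transformation F d k}"
      unfolding bij_betw_def
    proof
      show "inj_on D {h. deck_transformation E c h}"
      proof (rule inj_onI, clarify)
        fix h k assume h: "deck_transformation E c h" and k: "deck_transformation E c k" and eq: "D h = D k"
        \<comment> \<open>\<open>D h\<close> determines the value of \<open>h\<close> at the point
          \<open>e (V (U y))\<close>, and one value determines a deck transformation.\<close>
        have "h (e (V (U y))) = e (V (D h (U y)))" using e(2)[OF h] DU[OF h y] by simp
        also have "\<dots> = k (e (V (U y)))" using e(2)[OF k] DU[OF k y] eq by simp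
        finally show "h = k" using eqE[OF h k] eD(2) VE UF y by metis
      qed
      show "D ` {h. deck_transformation E c h} = {k. deck_transformation F d k}"
      proof (intro equalityI subsetI)
        fix k assume "k \<in> {k. deck_transformation F d k}"
        then have k: "deck_transformation F d k" by simp
        note kD = deck_transformationD[OF k] and D'k = D'[OF k]
        let ?x = "U (V z)"
        have x: "?x \<in> topspace F" using UF VE z(1) by simp
        \<comment> \<open>What the homotopy gives is that \<open>D (D' k)\<close> is the conjugate
          of \<open>k\<close> by \<open>f\<close>; commutativity of the deck group of
          \<open>F\<close> turns this into \<open>k\<close> itself.\<close>
        have "f (D (D' k) ?x) = f (U (V (k z)))" using DU[OF D'k] DV[OF k] VE z(1) by simp
        also have "\<dots> = k (f ?x)" using f(2)[OF k] by simp
        also have "\<dots> = f (k ?x)" using comm[OF k f(1) x] .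
        finally have "D (D' k) ?x = k ?x"
          using f(1) deck_transformationD(2)[OF D[OF D'k] x] kD(2)[OF x]
          unfolding deck_transformation_def homeomorphic_map_def inj_on_def by blast
        then have "D (D' k) = k" using eqF[OF D[OF D'k] k x] by blast
        then show "k \<in> D ` {h. deck_transformation E c h}" using D'k by (intro image_eqI[of _ _ "D' k"]) auto
      qed (use D in auto)
    qed
    fix h k assume h: "deck_transformation E c h" and k: "deck_transformation E c k"
    note kD = deck_transformationD[OF k]
    show "D (compose (topspace E) h k) = compose (topspace F) (D h) (D k)"
    proof (rule eqF[OF D[OF deck_transformation_compose[OF h k]] deck_transformation_compose[OF D[OF h] D[OF k]] z(1)])
      show "D (compose (topspace E) h k) z = compose (topspace F) (D h) (D k) z"
        using DU[OF deck_transformation_compose[OF h k] y] DU[OF h kD(2)[OF y]] DU[OF k y] U(2) y z(1)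
        by (simp add: compose_def)
    qed
  qed
qed

section \<open>Elementary collapses are homotopy equivalences\<close>

lemma subtopology_Euclidean_space_cube: "subtopology (Euclidean_space n) (cube n) = top_of_set (cube n)"
proof -
  have "{x::nat \<Rightarrow> real. \<forall>i\<ge>n. x i = 0} \<inter> cube n = cube n" by (auto simp: cube_def)
  then show ?thesis
    by (simp add: Euclidean_space_def subtopology_subtopology euclidean_product_topology)
qed

lemma compact_cube: "compact (cube n)"
proof -
  have "cube n = PiE UNIV (\<lambda>i. if i < n then {0..1} else {0::real})"
    by (auto simp: cube_def PiE_iff split: if_splits)
  moreover have "compactin (product_topology (\<lambda>i::nat. euclideanreal) UNIV) (PiE UNIV (\<lambda>i. if i < n then {0..1} else {0::real}))"
    by (simp add: compactin_PiE)
  ultimately show ?thesis by (simp add: euclidean_product_topology)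
qed

text \<open>The radial projection of \<open>cube (Suc m)\<close> from the point \<open>(1/2, \<dots>, 1/2, -1)\<close> retracts it
  onto the union of the faces other than \<open>cube m\<close>; it divides the distance of a point from the centre
  by the gauge below.\<close>

primrec cube_gauge :: "nat \<Rightarrow> nat \<Rightarrow> (nat \<Rightarrow> real) \<Rightarrow> real" where
  "cube_gauge m 0 x = (x m + 1) / 2"
| "cube_gauge m (Suc k) x = max (cube_gauge m k x) \<bar>2 * x k - 1\<bar>"

definition cube_proj :: "nat \<Rightarrow> (nat \<Rightarrow> real) \<Rightarrow> nat \<Rightarrow> real" where
  "cube_proj m x i =
     (if i < m then (1 + (2 * x i - 1) / cube_gauge m m x) / 2
      else if i = m then (x m + 1) / cube_gauge m m x - 1 else 0)"

text \<open>The boundary of \<open>cube (Suc m)\<close> without the interior of the free face: a box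
  that is open on the side \<open>cube m\<close>.\<close>

definition open_box_part :: "nat \<Rightarrow> (nat \<Rightarrow> real) set" where
  "open_box_part m = (cube (Suc m) - open_cube (Suc m)) - open_cube m"

lemma cube_gauge_ge: "(x m + 1) / 2 \<le> cube_gauge m k x" "i < k \<Longrightarrow> \<bar>2 * x i - 1\<bar> \<le> cube_gauge m k x"
  by (induction k) (auto simp: less_Suc_eq max_def)

lemma cube_gauge_cases: "cube_gauge m k x = (x m + 1) / 2 \<or> (\<exists>i<k. cube_gauge m k x = \<bar>2 * x i - 1\<bar>)"
  by (induction k) (auto simp: max_def less_Suc_eq)

lemma continuous_on_coordinate: "continuous_on A (\<lambda>x::'i \<Rightarrow> real. x i)"
  by (rule continuous_on_product_then_coordinatewise[OF continuous_on_id])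

lemma continuous_on_cube_gauge: "continuous_on A (cube_gauge m k)"
proof (induction k)
  case 0
  have "continuous_on A (\<lambda>x. (x m + 1) / 2 :: real)"
    by (intro continuous_intros continuous_on_coordinate) auto
  then show ?case by (simp add: cong: continuous_on_cong)
next
  case (Suc k)
  have "continuous_on A (\<lambda>x. max (cube_gauge m k x) \<bar>2 * x k - 1\<bar>)"
    using Suc by (intro continuous_intros continuous_on_coordinate) auto
  then show ?case by (simp add: cong: continuous_on_cong)
qed

text \<open>The lower bound reflects that the centre of projection lies below the cube, at height
  -1, and it keeps the divisions in \<open>cube_proj\<close> continuous.\<close>

lemma cube_gauge_bounds:
  assumes "x \<in> cube (Suc m)"
  shows "1/2 \<le> cube_gauge m m x" "cube_gauge m m x \<le> 1"
proof -
  have "0 \<le> x m" "x m \<le> 1" and i: "0 \<le> x i \<and> x i \<le> 1" if "i < m" for i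
    using assms that by (auto simp: cube_def)
  moreover have "0 \<le> x m" "x m \<le> 1" using assms by (auto simp: cube_def)
  ultimately show "1/2 \<le> cube_gauge m m x" "cube_gauge m m x \<le> 1"
    using cube_gauge_ge(1)[of x m m] cube_gauge_cases[of m m x] i by fastforce+
qed

text \<open>The gauge is a maximum, and the term that attains it tells where the ray leaves the
  cube: \<open>(x m + 1) / 2\<close> means the face opposite to \<open>cube m\<close>, any other
  term a side face. The remaining coordinates stay in range because their terms are at most the
  gauge and the gauge is at most 1.\<close>

lemma cube_proj_in:
  assumes x: "x \<in> cube (Suc m)"
  shows "cube_proj m x \<in> open_box_part m"
proof -
  let ?g = "cube_gauge m m x"
  note g = cube_gauge_bounds[OF x]
  have g0: "?g > 0" using g by linarith
  have xm: "0 \<le> x m" "x m \<le> 1" using x by (auto simp: cube_def)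
  have "0 \<le> cube_proj m x i \<and> cube_proj m x i \<le> 1" if "i < m" for i
  proof -
    have "\<bar>2 * x i - 1\<bar> \<le> ?g" using cube_gauge_ge(2)[OF that] .
    then have "\<bar>(2 * x i - 1) / ?g\<bar> \<le> 1"
      unfolding abs_divide using g0 by simp
    then have "-1 \<le> (2 * x i - 1) / ?g" "(2 * x i - 1) / ?g \<le> 1" by linarith+
    then show ?thesis using that by (simp add: cube_proj_def del: divide_le_eq_1)
  qed
  moreover have "0 \<le> cube_proj m x m \<and> cube_proj m x m \<le> 1"
  proof -
    have "(x m + 1) / 2 \<le> ?g" using cube_gauge_ge(1) .
    then show ?thesis using g g0 xm by (auto simp: cube_proj_def field_simps)
  qed
  moreover have "cube_proj m x i = 0" if "i \<ge> Suc m" for i using that by (simp add: cube_proj_def)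
  ultimately have c: "cube_proj m x \<in> cube (Suc m)" by (auto simp: cube_def less_Suc_eq)
  have "cube_proj m x m = 1 \<or> (\<exists>i<m. cube_proj m x i = 0 \<or> cube_proj m x i = 1)"
    using cube_gauge_cases[of m m x]
  proof
    assume "?g = (x m + 1) / 2"
    then have "(x m + 1) / ?g = 2" using g0 by (simp add: field_simps)
    then show ?thesis by (simp add: cube_proj_def)
  next
    assume "\<exists>i<m. ?g = \<bar>2 * x i - 1\<bar>"
    then obtain i where i: "i < m" "?g = \<bar>2 * x i - 1\<bar>" by blast
    then have "(2 * x i - 1) / ?g = 1 \<or> (2 * x i - 1) / ?g = -1"
      using g0 by (cases "2 * x i - 1 \<ge> 0") (simp_all add: divide_eq_eq)
    then have "cube_proj m x i = 0 \<or> cube_proj m x i = 1"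
      using i(1) unfolding cube_proj_def by (elim disjE) simp_all
    then show ?thesis using i(1) by blast
  qed
  then have "cube_proj m x \<notin> open_cube (Suc m) \<and> cube_proj m x \<notin> open_cube m"
  proof
    assume "cube_proj m x m = 1"
    then show ?thesis unfolding open_cube_def by force
  next
    assume "\<exists>i<m. cube_proj m x i = 0 \<or> cube_proj m x i = 1"
    then obtain i where "i < m" "\<not> (0 < cube_proj m x i \<and> cube_proj m x i < 1)" by auto
    then show ?thesis unfolding open_cube_def by auto
  qed
  then show ?thesis using c by (simp add: open_box_part_def)
qed

text \<open>Points of the remaining faces have gauge 1: they lie on a side face or have last
  coordinate 1, since any other point of the cube belongs to one of the two open cubes.\<close>

lemma cube_proj_id:
  assumes x: "x \<in> open_box_part m"
  shows "cube_proj m x = x"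
proof -
  have c: "x \<in> cube (Suc m)" "x \<notin> open_cube (Suc m)" "x \<notin> open_cube m"
    using x by (auto simp: open_box_part_def)
  have "1 \<le> cube_gauge m m x"
  proof (cases "\<exists>i<m. x i = 0 \<or> x i = 1")
    case True
    then obtain i where "i < m" "x i = 0 \<or> x i = 1" by blast
    then show ?thesis using cube_gauge_ge(2)[of i m x m] by auto
  next
    case False
    then have i: "0 < x i \<and> x i < 1" if "i < m" for i using c(1) that by (force simp: cube_def less_le)
    have "x m \<noteq> 0"
    proof
      assume "x m = 0"
      then have "x \<in> open_cube m" using i c(1) by (auto simp: open_cube_def cube_def) (metis Suc_leI le_less)
      then show False using c(3) by blast
    qed
    moreover have "\<not> (0 < x m \<and> x m < 1)"
    proof
      assume "0 < x m \<and> x m < 1"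
      then have "x \<in> open_cube (Suc m)" using i c(1) by (auto simp: open_cube_def cube_def less_Suc_eq)
      then show False using c(2) by blast
    qed
    moreover have "0 \<le> x m" "x m \<le> 1" using c(1) by (auto simp: cube_def)
    ultimately have "x m = 1" by linarith
    then show ?thesis using cube_gauge_ge(1)[of x m m] by simp
  qed
  then have "cube_gauge m m x = 1" using cube_gauge_bounds(2)[OF c(1)] by simp
  then show ?thesis using c(1) by (auto simp: cube_proj_def cube_def fun_eq_iff not_less)
qed

definition cube_deform :: "nat \<Rightarrow> real \<times> (nat \<Rightarrow> real) \<Rightarrow> nat \<Rightarrow> real" where
  "cube_deform m z i = (1 - fst z) * snd z i + fst z * cube_proj m (snd z) i"

lemma cube_deform_in:
  assumes "t \<in> {0..1}" "x \<in> cube (Suc m)"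
  shows "cube_deform m (t, x) \<in> cube (Suc m)"
proof -
  have p: "cube_proj m x \<in> cube (Suc m)" using cube_proj_in[OF assms(2)] by (simp add: open_box_part_def)
  have "0 \<le> (1 - t) * x i + t * cube_proj m x i \<and> (1 - t) * x i + t * cube_proj m x i \<le> 1" if "i < Suc m" for i
  proof -
    have "0 \<le> x i" "x i \<le> 1" "0 \<le> cube_proj m x i" "cube_proj m x i \<le> 1"
      using assms(2) p that by (auto simp: cube_def)
    then show ?thesis using assms(1) convex_bound_le[of "x i" 1 "cube_proj m x i" "1 - t" t] by auto
  qed
  moreover have "x i = 0 \<and> cube_proj m x i = 0" if "i \<ge> Suc m" for i
    using assms(2) p that by (auto simp: cube_def)
  ultimately show ?thesis by (simp add: cube_def cube_deform_def)
qed

lemma continuous_on_cube_deform: "continuous_on ({0..1} \<times> cube (Suc m)) (cube_deform m)"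
proof (rule continuous_on_coordinatewise_then_product)
  fix i
  have sn: "continuous_on ({0..1::real} \<times> cube (Suc m)) (\<lambda>z. snd z j)" for j
    by (rule continuous_on_product_then_coordinatewise[OF continuous_on_snd[OF continuous_on_id]])
  have g: "continuous_on ({0..1::real} \<times> cube (Suc m)) (\<lambda>z. cube_gauge m m (snd z))"
    using continuous_on_compose2[OF continuous_on_cube_gauge[of UNIV m m] continuous_on_snd[OF continuous_on_id]]
    by auto
  have g0: "cube_gauge m m (snd z) \<noteq> 0" if "z \<in> {0..1} \<times> cube (Suc m)" for z :: "real \<times> (nat \<Rightarrow> real)"
    using cube_gauge_bounds(1)[of "snd z" m] that by auto
  have "continuous_on ({0..1::real} \<times> cube (Suc m)) (\<lambda>z. cube_proj m (snd z) i)"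
    unfolding cube_proj_def using sn g g0
    by (cases "i < m"; cases "i = m") (auto intro!: continuous_intros)
  then show "continuous_on ({0..1} \<times> cube (Suc m)) (\<lambda>z. cube_deform m z i)"
    unfolding cube_deform_def using sn by (intro continuous_intros) auto
qed

section \<open>Finite complexes and their collapses\<close>

lemma characteristic_map_open_cube:
  assumes "characteristic_map X C (n, e) \<phi>" "e \<subseteq> topspace X"
  shows "\<phi> ` open_cube n = e" "inj_on \<phi> (open_cube n)"
proof -
  have hom: "homeomorphic_map (subtopology (Euclidean_space n) (open_cube n)) (subtopology X e) \<phi>"
    using assms(1) by (simp add: characteristic_map_def)
  have top: "topspace (subtopology (Euclidean_space n) (open_cube n)) = open_cube n"
    by (auto simp: topspace_Euclidean_space open_cube_def)
  show "\<phi> ` open_cube n = e" "inj_on \<phi> (open_cube n)"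
    using homeomorphic_imp_surjective_map[OF hom] homeomorphic_imp_injective_map[OF hom] assms(2)
    unfolding top by (simp_all add: Int_absorb1)
qed

text \<open>Each of the finitely many open cells lies in the image of a compact cube. In a collapse
  this makes the smaller complex closed in the larger one.\<close>

lemma finite_cw_complex_compact:
  assumes "finite_cw_complex X C"
  shows "compact_space X"
proof -
  have top: "topspace X = \<Union>(snd ` C)" and fin: "finite C"
    using assms by (auto simp: finite_cw_complex_def cells_union_def)
  have "\<exists>K. compactin X K \<and> snd cl \<subseteq> K" if "cl \<in> C" for cl
  proof -
    obtain n e where ne: "cl = (n, e)" by (cases cl)
    have "\<exists>\<phi>. characteristic_map X C cl \<phi>" using assms that by (simp add: finite_cw_complex_def)
    then obtain \<phi> where \<phi>: "characteristic_map X C cl \<phi>" by blast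
    then have cont: "continuous_map (top_of_set (cube n)) X \<phi>"
      by (simp add: characteristic_map_def ne subtopology_Euclidean_space_cube)
    have "e \<subseteq> topspace X" using top that ne by force
    then have "\<phi> ` open_cube n = e" using characteristic_map_open_cube(1) \<phi> ne by blast
    moreover have "open_cube n \<subseteq> cube n" by (auto simp: open_cube_def cube_def less_imp_le)
    moreover have "compactin X (\<phi> ` cube n)"
      using image_compactin[OF _ cont, of "cube n"] compact_cube[of n] by (simp add: compactin_subtopology)
    ultimately show ?thesis using ne by (intro exI[of _ "\<phi> ` cube n"]) auto
  qed
  then obtain K where K: "\<And>cl. cl \<in> C \<Longrightarrow> compactin X (K cl) \<and> snd cl \<subseteq> K cl" by metis
  have "compactin X (\<Union>(K ` C))" using K fin by (intro compactin_Union) auto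
  moreover have "\<Union>(K ` C) = topspace X" using K top compactin_subset_topspace by fastforce
  ultimately show ?thesis by (simp add: compact_space_def)
qed

text \<open>The linear deformation of the cube is carried to \<open>X\<close> by the characteristic
  map \<open>\<phi>\<close> of the larger cell and extended by the identity on the smaller complex.
  It descends although \<open>\<phi>\<close> may identify points, because identifications happen
  only on \<open>open_box_part m\<close>, where the deformation is stationary.\<close>

lemma elementary_collapse_homotopy_equivalent:
  assumes "elementary_collapse X C Y D"
  shows "X homotopy_equivalent_space Y"
proof -
  obtain m e e' \<phi> where cwX: "finite_cw_complex X C" and cwY: "finite_cw_complex Y D"
    and Y: "Y = subtopology X (cells_union D)" and nD: "(m, e) \<notin> D" "(Suc m, e') \<notin> D"
    and C: "C = D \<union> {(m, e), (Suc m, e')}"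
    and ch': "characteristic_map X C (Suc m, e') \<phi>" and ch: "characteristic_map X C (m, e) \<phi>"
    and J: "\<phi> ` ((cube (Suc m) - open_cube (Suc m)) - open_cube m) \<subseteq> cells_union {c \<in> D. fst c \<le> m}"
    using assms unfolding elementary_collapse_def by blast
  let ?Q = "cube (Suc m)" and ?J = "open_box_part m" and ?A = "cells_union D"
  let ?I = "top_of_set {0..1::real}" and ?inv = "inv_into (?Q - ?J) \<phi>"
  have HX: "Hausdorff_space X" and topX: "topspace X = ?A \<union> e \<union> e'"
    and dis: "\<And>c c'. c \<in> C \<Longrightarrow> c' \<in> C \<Longrightarrow> c \<noteq> c' \<Longrightarrow> snd c \<inter> snd c' = {}"
  proof -
    show "Hausdorff_space X" and "\<And>c c'. c \<in> C \<Longrightarrow> c' \<in> C \<Longrightarrow> c \<noteq> c' \<Longrightarrow> snd c \<inter> snd c' = {}"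
      using cwX unfolding finite_cw_complex_def by blast+
    have "cells_union C = topspace X" using cwX by (simp add: finite_cw_complex_def)
    then show "topspace X = ?A \<union> e \<union> e'" by (auto simp: cells_union_def C)
  qed
  have A: "?A \<inter> e = {}" "?A \<inter> e' = {}" "e \<inter> e' = {}"
  proof -
    show "e \<inter> e' = {}" using dis[of "(m, e)" "(Suc m, e')"] C by auto
    have "snd d \<inter> e = {} \<and> snd d \<inter> e' = {}" if "d \<in> D" for d
      using dis[of d "(m, e)"] dis[of d "(Suc m, e')"] that nD C by auto
    then show "?A \<inter> e = {}" "?A \<inter> e' = {}" by (auto simp: cells_union_def)
  qed
  have topY: "topspace Y = ?A" using topX by (auto simp: Y)
  have "compactin X ?A"
    using finite_cw_complex_compact[OF cwY] topX unfolding Y compactin_subspace by blast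
  then have clA: "closedin X ?A" using HX compactin_imp_closedin by blast
  have \<phi>: "continuous_map (top_of_set ?Q) X \<phi>"
    using ch' by (simp add: characteristic_map_def subtopology_Euclidean_space_cube)
  have sub: "e \<subseteq> topspace X" "e' \<subseteq> topspace X" using topX by auto
  have im: "\<phi> ` open_cube (Suc m) = e'" "\<phi> ` open_cube m = e"
    and inj: "inj_on \<phi> (open_cube (Suc m))" "inj_on \<phi> (open_cube m)"
    using characteristic_map_open_cube[OF ch' sub(2)] characteristic_map_open_cube[OF ch sub(1)] by auto
  \<comment> \<open>What the collapse removes is the open cube and its open free face. The same
    \<open>\<phi>\<close> parametrises both cells, and the two images are disjoint, so
    \<open>\<phi>\<close> is injective on the union.\<close>
  have QJ: "?Q - ?J = open_cube (Suc m) \<union> open_cube m"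
    by (auto simp: open_box_part_def open_cube_def cube_def less_imp_le less_Suc_eq)
  have JQ: "?J \<subseteq> ?Q" by (auto simp: open_box_part_def)
  have \<phi>J: "\<phi> x \<in> ?A" if "x \<in> ?J" for x
    using J that by (auto simp: open_box_part_def cells_union_def)
  have injQJ: "inj_on \<phi> (?Q - ?J)" and \<phi>QJ: "\<And>x. x \<in> ?Q - ?J \<Longrightarrow> \<phi> x \<notin> ?A"
  proof -
    have "\<phi> ` open_cube (Suc m) \<inter> \<phi> ` open_cube m = {}" using im A by blast
    then show "inj_on \<phi> (?Q - ?J)" unfolding QJ inj_on_Un using inj by blast
    show "\<And>x. x \<in> ?Q - ?J \<Longrightarrow> \<phi> x \<notin> ?A" unfolding QJ using im A by blast
  qed
  define h where "h z = (if snd z \<in> ?A then snd z else \<phi> (cube_deform m (fst z, ?inv (snd z))))" for z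
  have h\<phi>: "h (t, \<phi> x) = \<phi> (cube_deform m (t, x))" if "x \<in> ?Q" for t x
  proof (cases "x \<in> ?J")
    case True
    have "cube_deform m (t, x) = x" using cube_proj_id[OF True] by (auto simp: cube_deform_def fun_eq_iff algebra_simps)
    then show ?thesis using \<phi>J[OF True] by (simp add: h_def)
  next
    case False
    then show ?thesis using \<phi>QJ[of x] that inv_into_f_f[OF injQJ, of x] by (simp add: h_def)
  qed
  let ?P = "prod_topology ?I X"
  have cont: "continuous_map ?P X h"
  proof -
    let ?B = "\<phi> ` ?Q"
    have compQ: "compact_space (top_of_set ?Q)" using compact_cube by (simp add: compact_space_subtopology)
    have "compactin X ?B" using image_compactin[OF _ \<phi>, of ?Q] compQ by (simp add: compact_space_def)
    then have clB: "closedin X ?B" using HX compactin_imp_closedin by blast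
    have 1: "closedin ?P ({0..1} \<times> ?A)" "closedin ?P ({0..1} \<times> ?B)"
      using clA clB by (auto simp: closedin_prod_Times_iff)
    have AB: "topspace X = ?A \<union> ?B"
    proof -
      have "?B \<subseteq> topspace X" using \<phi> by (auto simp: continuous_map_def)
      moreover have "e \<union> e' \<subseteq> ?B" using im QJ by blast
      ultimately show ?thesis using topX by blast
    qed
    have 2: "topspace ?P \<subseteq> {0..1} \<times> ?A \<union> {0..1} \<times> ?B" using AB by auto
    have "continuous_map (subtopology ?P ({0..1} \<times> ?A)) X snd"
      by (intro continuous_map_from_subtopology continuous_map_snd)
    then have 3: "continuous_map (subtopology ?P ({0..1} \<times> ?A)) X h"
      by (rule continuous_map_eq) (auto simp: h_def)
    let ?q = "\<lambda>z. (fst z, \<phi> (snd z))"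
    let ?S = "subtopology ?P ({0..1} \<times> ?B)"
    have "continuous_map (prod_topology ?I (top_of_set ?Q)) X (\<phi> \<circ> snd)"
      by (rule continuous_map_compose[OF continuous_map_snd \<phi>])
    then have "continuous_map (prod_topology ?I (top_of_set ?Q)) ?P ?q"
      by (intro continuous_map_pairedI continuous_map_fst) (simp add: o_def)
    then have q: "continuous_map (prod_topology ?I (top_of_set ?Q)) ?S ?q"
      by (auto simp: continuous_map_in_subtopology)
    have qs: "?q ` topspace (prod_topology ?I (top_of_set ?Q)) = topspace ?S"
      using AB by (auto simp: image_iff)
    \<comment> \<open>Continuity of \<open>h\<close> over the removed cells is checked on the cube:
      \<open>?q\<close> is a closed surjection, being continuous from a compact to a Hausdorff
      space, and therefore a quotient map.\<close>
    have "closed_map (prod_topology ?I (top_of_set ?Q)) ?S ?q"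
    proof (rule continuous_imp_closed_map[OF q])
      show "compact_space (prod_topology ?I (top_of_set ?Q))"
        unfolding compact_space_prod_topology using compQ by (simp add: compact_space_subtopology)
      show "Hausdorff_space ?S"
        using HX by (intro Hausdorff_space_subtopology) (simp add: Hausdorff_space_prod_topology Hausdorff_space_subtopology)
    qed
    then have qq: "quotient_map (prod_topology ?I (top_of_set ?Q)) ?S ?q"
      using q qs by (intro continuous_closed_imp_quotient_map) auto
    have "continuous_map (top_of_set ({0..1} \<times> ?Q)) (top_of_set ?Q) (cube_deform m)"
      using continuous_on_cube_deform[of m] cube_deform_in[of _ _ m] by (auto simp: continuous_map_in_subtopology)
    from continuous_map_compose[OF this \<phi>]
    have "continuous_map (prod_topology ?I (top_of_set ?Q)) X (\<phi> \<circ> cube_deform m)"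
      by (simp add: prod_topology_top_of_set)
    then have "continuous_map (prod_topology ?I (top_of_set ?Q)) X (h \<circ> ?q)"
      by (rule continuous_map_eq) (auto simp: h\<phi>)
    then have 4: "continuous_map ?S X h" using continuous_compose_quotient_map[OF qq] by blast
    show ?thesis using continuous_map_paste_closed[OF 1 2 3 4] by simp
  qed
  have \<phi>inv: "?inv x \<in> ?Q \<and> \<phi> (?inv x) = x" if "x \<in> topspace X" "x \<notin> ?A" for x
  proof -
    have "x \<in> \<phi> ` (?Q - ?J)" using that topX im QJ by blast
    then show ?thesis using inv_into_into[of x \<phi> "?Q - ?J"] f_inv_into_f[of x \<phi> "?Q - ?J"] by auto
  qed
  have h0: "h (0, x) = x" if "x \<in> topspace X" for x
  proof (cases "x \<in> ?A")
    case False
    have "cube_deform m (0, y) = y" for y by (simp add: cube_deform_def fun_eq_iff)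
    then show ?thesis using h\<phi>[of "?inv x" 0] \<phi>inv[OF that False] by simp
  qed (simp add: h_def)
  have h1: "h (1, x) \<in> ?A" if "x \<in> topspace X" for x
  proof (cases "x \<in> ?A")
    case False
    have d: "cube_deform m (1, y) = cube_proj m y" for y by (auto simp: cube_deform_def fun_eq_iff)
    show ?thesis
      using \<phi>inv[OF that False] h\<phi>[of "?inv x" 1] \<phi>J[OF cube_proj_in] d by simp
  qed (simp add: h_def)
  have "homotopic_with (\<lambda>_. True) X X id (\<lambda>x. h (1, x))"
    using cont h0 by (subst homotopic_with) (auto intro!: exI[of _ h])
  then have hom: "homotopic_with (\<lambda>_. True) X X (id \<circ> (\<lambda>x. h (1, x))) id"
    by (simp add: homotopic_with_sym)
  have cf: "continuous_map X Y (\<lambda>x. h (1, x))"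
    using homotopic_with_imp_continuous_maps[OF hom] h1 by (auto simp: Y continuous_map_in_subtopology)
  have cg: "continuous_map Y X id" by (simp add: Y continuous_map_from_subtopology)
  have "homotopic_with (\<lambda>_. True) Y Y ((\<lambda>x. h (1, x)) \<circ> id) id"
    by (rule homotopic_with_equal) (use continuous_map_compose[OF cg cf] topY in \<open>auto simp: h_def\<close>)
  then show ?thesis
    unfolding homotopy_equivalent_space_def using cf cg hom by blast
qed

lemma deformation_homotopy_equivalent: "deformation X C Y D d \<Longrightarrow> X homotopy_equivalent_space Y"
proof (induction rule: deformation.induct)
  case refl
  then show ?case by (simp add: homotopy_equivalent_space_refl)
next
  case (expand Y D d Z E)
  then show ?case
    using elementary_collapse_homotopy_equivalent homotopy_equivalent_space_sym homotopy_eqv_trans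
    by blast
next
  case (collapse Y D d Z E r)
  then show ?case
    using elementary_collapse_homotopy_equivalent homotopy_eqv_trans by blast
qed

lemma simple_homotopy_equivalence_imp_homotopy_equivalent:
  assumes "simple_homotopy_equivalence M N f"
  shows "M homotopy_equivalent_space N"
proof -
  obtain X :: "(nat \<Rightarrow> real) topology" and C Y D h k s
    where "homeomorphic_map X M h" "homeomorphic_map Y N k" "cw_simple_homotopy_equivalence X C Y D s"
    using assms unfolding simple_homotopy_equivalence_def by blast
  then have "X homotopy_equivalent_space Y" "X homeomorphic_space M" "Y homeomorphic_space N"
    using deformation_homotopy_equivalent homeomorphic_map_imp_homeomorphic_space
    by (auto simp: cw_simple_homotopy_equivalence_def)
  then show ?thesis
    by (meson homeomorphic_imp_homotopy_equivalent_space homotopy_equivalent_space_sym homotopy_eqv_trans)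
qed

section \<open>The universal cover of a lens space\<close>

lemma simply_connected_space_top_of_set:
  fixes S :: "'a::real_normed_vector set"
  assumes "simply_connected S"
  shows "simply_connected_space (top_of_set S)"
proof -
  have pc: "path_connected S" and *: "\<And>p. path p \<Longrightarrow> path_image p \<subseteq> S \<Longrightarrow> pathfinish p = pathstart p \<Longrightarrow>
      homotopic_paths S p (linepath (pathstart p) (pathstart p))"
    using assms by (auto simp: simply_connected_eq_contractible_path)
  show ?thesis
    unfolding simply_connected_space_def
  proof (intro conjI allI impI)
    show "path_connected_space (top_of_set S)" using pc by simp
    fix x g assume "loop_at (top_of_set S) x g"
    then have g: "path g" "path_image g \<subseteq> S" "g 0 = x" "g 1 = x"
      by (auto simp: loop_at_def pathin_def path_def path_image_def)
    have "homotopic_paths S g (linepath x x)"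
      using *[OF g(1,2)] g(3,4) by (simp add: pathstart_def pathfinish_def)
    then show "path_homotopic (top_of_set S) x x g (\<lambda>t. x)"
      by (simp add: homotopic_paths_def pathstart_def pathfinish_def g linepath_refl)
  qed
qed

lemma locally_path_connected_space_top_of_set:
  assumes "locally path_connected S"
  shows "locally_path_connected_space (top_of_set S)"
  unfolding locally_path_connected_space
proof (intro allI impI, elim conjE)
  fix V x assume V: "openin (top_of_set S) V" "x \<in> V"
  then obtain w where "openin (top_of_set S) w" "path_connected w" "x \<in> w" "w \<subseteq> V"
    using assms locally_path_connected by metis
  then show "\<exists>U. openin (top_of_set S) U \<and> path_connectedin (top_of_set S) U \<and> x \<in> U \<and> U \<subseteq> V"
    by (intro exI[of _ w]) (simp add: path_connectedin_subtopology openin_imp_subset)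
qed

section \<open>The cyclic group of rotations of the 3-sphere\<close>

text \<open>The powers of \<open>lens_rotation\<close>, extended to negative exponents so that
  inverses and differences of exponents are available.\<close>

definition lens_action :: "nat \<Rightarrow> int \<Rightarrow> int \<Rightarrow> complex \<times> complex \<Rightarrow> complex \<times> complex" where
  "lens_action p q k z = (cis (2 * pi * real_of_int k / real p) * fst z,
     cis (2 * pi * real_of_int q * real_of_int k / real p) * snd z)"

lemma lens_action_add: "lens_action p q (j + k) z = lens_action p q j (lens_action p q k z)"
  by (simp add: lens_action_def cis_mult[symmetric] mult.assoc[symmetric] add_divide_distrib ring_distribs)

lemma lens_action_0 [simp]: "lens_action p q 0 z = z"
  by (simp add: lens_action_def)

lemma lens_rotation_funpow: "(lens_rotation p q ^^ k) z = lens_action p q (int k) z"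
proof (induction k)
  case (Suc k)
  have "lens_rotation p q w = lens_action p q 1 w" for w
    by (simp add: lens_rotation_def lens_action_def)
  then show ?case using Suc lens_action_add[of p q 1 "int k" z] by (simp add: add.commute)
qed simp

lemma cis_2pi_int_div_eq_1_iff:
  assumes "p > 0"
  shows "cis (2 * pi * real_of_int k / real p) = 1 \<longleftrightarrow> int p dvd k"
proof -
  have "cis (2 * pi * real_of_int k / real p) = 1 \<longleftrightarrow> (\<exists>n::int. real_of_int k / real p = of_int n)"
  proof -
    have "cis (2 * pi * real_of_int k / real p) = exp (\<i> * of_real (2 * pi * real_of_int k / real p))"
      by (simp add: cis_conv_exp)
    then have "cis (2 * pi * real_of_int k / real p) = 1 \<longleftrightarrow>
        (\<exists>n::int. 2 * pi * real_of_int k / real p = real_of_int (2 * n) * pi)"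
      by (simp add: exp_eq_1)
    also have "\<dots> \<longleftrightarrow> (\<exists>n::int. real_of_int k / real p = of_int n)"
    proof -
      have "2 * pi * real_of_int k / real p = real_of_int (2 * n) * pi \<longleftrightarrow> real_of_int k / real p = of_int n" for n
      proof -
        have "2 * pi * real_of_int k / real p = (2 * pi) * (real_of_int k / real p)"
          "real_of_int (2 * n) * pi = (2 * pi) * of_int n" by simp_all
        then show ?thesis by (metis mult_cancel_left pi_neq_zero mult_eq_0_iff zero_neq_numeral)
      qed
      then show ?thesis by simp
    qed
    finally show ?thesis .
  qed
  also have "\<dots> \<longleftrightarrow> (\<exists>n::int. real_of_int k = real_of_int (int p * n))"
    using assms by (simp add: field_simps)
  also have "\<dots> \<longleftrightarrow> int p dvd k" by (simp only: of_int_eq_iff dvd_def)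
  finally show ?thesis .
qed

text \<open>Some coordinate of \<open>z\<close> is nonzero. The first is fixed only if
  \<open>p\<close> divides \<open>k\<close>, the second only if \<open>p\<close> divides
  \<open>q * k\<close>, which amounts to the same by coprimality.\<close>

lemma lens_action_eq_iff:
  assumes "p \<ge> 1" "coprime (int p) q" "z \<noteq> 0"
  shows "lens_action p q k z = z \<longleftrightarrow> int p dvd k"
proof -
  have 1: "cis (2 * pi * real_of_int k / real p) = 1 \<longleftrightarrow> int p dvd k"
    using cis_2pi_int_div_eq_1_iff[of p k] assms(1) by simp
  have "cis (2 * pi * real_of_int q * real_of_int k / real p) = 1 \<longleftrightarrow> int p dvd q * k"
    using cis_2pi_int_div_eq_1_iff[of p "q * k"] assms(1) by (simp add: mult.assoc)
  also have "\<dots> \<longleftrightarrow> int p dvd k" using assms(2) by (simp add: coprime_dvd_mult_right_iff)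
  finally show ?thesis
    using 1 assms(3) by (cases z) (auto simp: lens_action_def zero_prod_def)
qed

lemma lens_action_mod:
  assumes "p \<ge> 1" "coprime (int p) q"
  shows "lens_action p q (k mod int p) z = lens_action p q k z"
proof (cases "z = 0")
  case False
  have "lens_action p q (k mod int p) (lens_action p q (int p * (k div int p)) z) = lens_action p q k z"
    by (simp flip: lens_action_add)
  then show ?thesis using lens_action_eq_iff[OF assms False, of "int p * (k div int p)"] by simp
qed (simp add: lens_action_def)

lemma norm_lens_action [simp]: "norm (lens_action p q k z) = norm z"
  by (simp add: lens_action_def norm_prod_def norm_mult)

lemma dist_lens_action [simp]: "dist (lens_action p q k z) (lens_action p q k w) = dist z w"
proof -
  have "lens_action p q k z - lens_action p q k w = lens_action p q k (z - w)"
    by (simp add: lens_action_def ring_distribs)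
  then show ?thesis by (simp add: dist_norm)
qed

lemma lens_orbit_eq:
  assumes "p \<ge> 1" "coprime (int p) q"
  shows "lens_orbit p q z = (\<lambda>k. lens_action p q k z) ` {0..<int p}"
proof -
  have "lens_action p q (int k) z \<in> (\<lambda>k. lens_action p q k z) ` {0..<int p}" for k
    using lens_action_mod[OF assms, of "int k" z] assms(1)
    by (intro image_eqI[of _ _ "int k mod int p"]) auto
  moreover have "\<exists>n. lens_action p q k z = lens_action p q (int n) z" if "k \<in> {0..<int p}" for k
    using that by (intro exI[of _ "nat k"]) simp
  ultimately show ?thesis unfolding lens_orbit_def lens_rotation_funpow by blast
qed

lemma lens_orbit_eq_iff:
  assumes "p \<ge> 1" "coprime (int p) q"
  shows "lens_orbit p q z = lens_orbit p q w \<longleftrightarrow> (\<exists>k \<in> {0..<int p}. z = lens_action p q k w)"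
proof
  assume "lens_orbit p q z = lens_orbit p q w"
  moreover have "z \<in> lens_orbit p q z" using assms(1) unfolding lens_orbit_eq[OF assms]
    by (intro image_eqI[of _ _ 0]) auto
  ultimately show "\<exists>k \<in> {0..<int p}. z = lens_action p q k w" by (auto simp: lens_orbit_eq[OF assms])
next
  assume "\<exists>k \<in> {0..<int p}. z = lens_action p q k w"
  then obtain k where k: "z = lens_action p q k w" by blast
  have w: "w = lens_action p q (- k) z" by (simp add: k flip: lens_action_add)
  have sub: "lens_orbit p q (lens_action p q j x) \<subseteq> lens_orbit p q x" for j x
    unfolding lens_orbit_eq[OF assms]
  proof (rule image_subsetI)
    fix i
    show "lens_action p q i (lens_action p q j x) \<in> (\<lambda>k. lens_action p q k x) ` {0..<int p}"
      using lens_action_mod[OF assms, of "i + j" x] assms(1)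
      by (intro image_eqI[of _ _ "(i + j) mod int p"]) (auto simp: lens_action_add)
  qed
  show "lens_orbit p q z = lens_orbit p q w" using sub[of k w] sub[of "- k" z] by (metis k w subset_antisym)
qed

lemma homeomorphic_map_lens_action:
  "homeomorphic_map (top_of_set (sphere 0 1)) (top_of_set (sphere 0 1)) (lens_action p q k)"
proof -
  have "continuous_map (top_of_set (sphere 0 1)) (top_of_set (sphere 0 1)) (lens_action p q j)" for j
    unfolding continuous_map_in_subtopology
    by (auto simp: lens_action_def[abs_def] norm_prod_def norm_mult intro!: continuous_intros)
  then have "homeomorphic_maps (top_of_set (sphere 0 1)) (top_of_set (sphere 0 1))
      (lens_action p q k) (lens_action p q (- k))"
    by (auto simp: homeomorphic_maps_def simp flip: lens_action_add)
  then show ?thesis using homeomorphic_map_maps by blast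
qed

lemma openin_lens_action:
  assumes "openin (top_of_set (sphere 0 1)) W"
  shows "openin (top_of_set (sphere 0 1)) (lens_action p q k ` W)"
  using homeomorphic_imp_open_map[OF homeomorphic_map_lens_action] assms by (simp add: open_map_def)

section \<open>The orbit map as a covering, and its deck group\<close>

text \<open>The orbit of \<open>z\<close> is finite, so a ball of at most half the least distance
  from \<open>z\<close> to its other points is moved off itself by every nontrivial rotation,
  rotations being isometries. Its translates are the sheets. The orbit map is open because the
  saturation of an open set is a union of translates.\<close>

lemma covering_map_lens_orbit:
  assumes pq: "p \<ge> 1" "coprime (int p) q"
  shows "covering_map (top_of_set (sphere 0 1)) (lens_space p q) (lens_orbit p q)"
proof -
  let ?S = "sphere 0 1 :: (complex \<times> complex) set" and ?\<pi> = "lens_orbit p q" and ?L = "lens_space p q"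
  let ?a = "lens_action p q"
  have quot: "quotient_map (top_of_set ?S) ?L ?\<pi>"
    unfolding lens_space_def by (rule quotient_map_quotient_topology)
  have cont: "continuous_map (top_of_set ?S) ?L ?\<pi>" and surj: "?\<pi> ` ?S = topspace ?L"
    using quotient_imp_continuous_map[OF quot] quotient_imp_surjective_map[OF quot] by auto
  have preim: "{y \<in> ?S. ?\<pi> y \<in> ?\<pi> ` W} = (\<Union>k\<in>{0..<int p}. ?a k ` W)" if "W \<subseteq> ?S" for W
  proof (rule Set.set_eqI)
    fix y
    have "y \<in> {y \<in> ?S. ?\<pi> y \<in> ?\<pi> ` W} \<longleftrightarrow> y \<in> ?S \<and> (\<exists>w \<in> W. ?\<pi> y = ?\<pi> w)"
      by (simp add: image_iff)
    also have "\<dots> \<longleftrightarrow> (\<exists>w \<in> W. \<exists>k \<in> {0..<int p}. y = ?a k w)"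
      unfolding lens_orbit_eq_iff[OF pq] using that by auto
    also have "\<dots> \<longleftrightarrow> y \<in> (\<Union>k\<in>{0..<int p}. ?a k ` W)" by blast
    finally show "y \<in> {y \<in> ?S. ?\<pi> y \<in> ?\<pi> ` W} \<longleftrightarrow> y \<in> (\<Union>k\<in>{0..<int p}. ?a k ` W)" .
  qed
  have opn: "openin ?L (?\<pi> ` W)" if W: "openin (top_of_set ?S) W" for W
  proof -
    have WS: "W \<subseteq> ?S" using openin_imp_subset[OF W] .
    have "openin (top_of_set ?S) {y \<in> ?S. ?\<pi> y \<in> ?\<pi> ` W}"
      unfolding preim[OF WS] using openin_lens_action[OF W] by blast
    moreover have "?\<pi> ` W \<subseteq> topspace ?L" unfolding surj[symmetric] using WS by (rule image_mono)
    ultimately show ?thesis using quot by (simp add: quotient_map_def)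
  qed
  show ?thesis
    unfolding covering_map_def
  proof (intro conjI ballI)
    show "?\<pi> ` topspace (top_of_set ?S) = topspace ?L" using surj by simp
    fix x assume "x \<in> topspace ?L"
    then obtain z where z: "z \<in> ?S" "x = ?\<pi> z" using surj by blast
    then have z0: "z \<noteq> 0" by auto
    have "\<exists>r>0. \<forall>k\<in>{1..<int p}. 2 * r \<le> dist z (?a k z)"
    proof -
      have "0 < dist z (?a k z)" if "k \<in> {1..<int p}" for k
        using lens_action_eq_iff[OF pq z0, of k] that zdvd_not_zless[of k "int p"] by auto
      \<comment> \<open>The extra 1 keeps the set nonempty for \<open>p = 1\<close>.\<close>
      let ?D = "insert 1 ((\<lambda>k. dist z (?a k z)) ` {1..<int p})"
      have "Min ?D \<in> ?D" by (intro Min_in) auto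
      then have "0 < Min ?D" using \<open>\<And>k. k \<in> {1..<int p} \<Longrightarrow> 0 < dist z (?a k z)\<close> by auto
      moreover have "Min ?D \<le> dist z (?a k z)" if "k \<in> {1..<int p}" for k
        using that by (intro Min_le) auto
      ultimately show ?thesis by (intro exI[of _ "Min ?D / 2"]) auto
    qed
    then obtain r where r: "r > 0" "\<And>k. k \<in> {1..<int p} \<Longrightarrow> 2 * r \<le> dist z (?a k z)" by blast
    define W where "W = ?S \<inter> ball z r"
    have W: "openin (top_of_set ?S) W" "W \<subseteq> ?S" "z \<in> W" using z r by (auto simp: W_def)
    have sep: "k = 0" if w: "w \<in> W" "w' \<in> W" "w = ?a k w'" and k: "k \<in> {0..<int p}" for w w' k
    proof (rule ccontr)
      assume "k \<noteq> 0"
      then have "2 * r \<le> dist z (?a k z)" using r(2) k by auto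
      also have "\<dots> \<le> dist z w + dist (?a k w') (?a k z)" unfolding w(3) by (rule dist_triangle)
      also have "\<dots> < 2 * r" using w(1,2) by (simp add: W_def dist_commute)
      finally show False by simp
    qed
    have disj: "?a j ` W \<inter> ?a k ` W = {}" if "j \<in> {0..<int p}" "k \<in> {0..<int p}" "j < k" for j k
    proof -
      have False if "w \<in> W" "w' \<in> W" "?a j w = ?a k w'" for w w'
      proof -
        have "?a (- j) (?a j w) = ?a (- j) (?a k w')" using that(3) by simp
        then have "w = ?a (k - j) w'" by (simp flip: lens_action_add)
        then show False using sep[OF that(1,2)] \<open>j < k\<close> \<open>j \<in> _\<close> \<open>k \<in> _\<close> by force
      qed
      then show ?thesis by blast
    qed
    let ?\<V> = "(\<lambda>k. ?a k ` W) ` {0..<int p}"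
    show "\<exists>U. x \<in> U \<and> openin ?L U \<and>
        (\<exists>\<V>. \<Union>\<V> = {y \<in> topspace (top_of_set ?S). ?\<pi> y \<in> U} \<and> (\<forall>V \<in> \<V>. openin (top_of_set ?S) V) \<and>
           pairwise disjnt \<V> \<and>
           (\<forall>V \<in> \<V>. homeomorphic_map (subtopology (top_of_set ?S) V) (subtopology ?L U) ?\<pi>))"
    proof (rule exI[of _ "?\<pi> ` W"], intro conjI exI[of _ ?\<V>] ballI)
      show "x \<in> ?\<pi> ` W" using W z by blast
      show "openin ?L (?\<pi> ` W)" using opn W by blast
      show "\<Union> ?\<V> = {y \<in> topspace (top_of_set ?S). ?\<pi> y \<in> ?\<pi> ` W}" using preim[OF W(2)] by simp
      show "openin (top_of_set ?S) V" if "V \<in> ?\<V>" for V using that openin_lens_action[OF W(1)] by blast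
      show "pairwise disjnt ?\<V>"
      proof (rule pairwiseI)
        fix A B assume "A \<in> ?\<V>" "B \<in> ?\<V>" "A \<noteq> B"
        then obtain j k where jk: "j \<in> {0..<int p}" "k \<in> {0..<int p}" "A = ?a j ` W" "B = ?a k ` W" "j \<noteq> k" by blast
        then show "disjnt A B"
          using disj[of j k] disj[of k j] by (cases "j < k") (auto simp: disjnt_def)
      qed
      fix V assume "V \<in> ?\<V>"
      then obtain k where k: "k \<in> {0..<int p}" "V = ?a k ` W" by blast
      have V: "openin (top_of_set ?S) V" using k openin_lens_action[OF W(1)] by blast
      have VS: "V \<subseteq> ?S" using openin_imp_subset[OF V] .
      have same: "?\<pi> (?a k w) = ?\<pi> w" for w using lens_orbit_eq_iff[OF pq] k(1) by blast
      have \<pi>V: "?\<pi> ` V = ?\<pi> ` W" using k(2) same by (simp add: image_image)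
      show "homeomorphic_map (subtopology (top_of_set ?S) V) (subtopology ?L (?\<pi> ` W)) ?\<pi>"
      proof (rule bijective_open_imp_homeomorphic_map)
        show "continuous_map (subtopology (top_of_set ?S) V) (subtopology ?L (?\<pi> ` W)) ?\<pi>"
          using cont \<pi>V by (auto simp: continuous_map_in_subtopology intro: continuous_map_from_subtopology)
        show "open_map (subtopology (top_of_set ?S) V) (subtopology ?L (?\<pi> ` W)) ?\<pi>"
          unfolding open_map_def
        proof (intro allI impI)
          fix O' assume "openin (subtopology (top_of_set ?S) V) O'"
          then have "openin (top_of_set ?S) O'" "O' \<subseteq> V" using V openin_open_subtopology by auto
          then show "openin (subtopology ?L (?\<pi> ` W)) (?\<pi> ` O')"
            using opn \<pi>V by (metis image_mono openin_open_subtopology W(1))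
        qed
        show "?\<pi> ` topspace (subtopology (top_of_set ?S) V) = topspace (subtopology ?L (?\<pi> ` W))"
          using VS \<pi>V surj W(2) by (simp add: Int_absorb1 image_mono flip: surj)
        show "inj_on ?\<pi> (topspace (subtopology (top_of_set ?S) V))"
        proof (rule inj_onI)
          fix y y' assume "y \<in> topspace (subtopology (top_of_set ?S) V)" "y' \<in> topspace (subtopology (top_of_set ?S) V)"
            and eq: "?\<pi> y = ?\<pi> y'"
          then obtain w w' where w: "w \<in> W" "w' \<in> W" "y = ?a k w" "y' = ?a k w'" using k by auto
          then have "?\<pi> w = ?\<pi> w'" using eq same by simp
          then obtain j where j: "j \<in> {0..<int p}" "w = ?a j w'" using lens_orbit_eq_iff[OF pq] by blast
          then have "j = 0" using sep w by blast
          then show "y = y'" using j w by simp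
        qed
      qed
    qed
  qed (use cont in simp)
qed

lemma universal_covering_lens:
  assumes "p \<ge> 1" "coprime (int p) q"
  shows "universal_covering (top_of_set (sphere 0 1)) (lens_space p q) (lens_orbit p q)"
proof
  have "simply_connected (sphere (0 :: complex \<times> complex) 1)" by (rule simply_connected_sphere) simp
  then show "universal_cover (top_of_set (sphere 0 1)) (lens_space p q) (lens_orbit p q)"
    using covering_map_lens_orbit[OF assms] simply_connected_space_top_of_set by (simp add: universal_cover_def)
  show "locally_path_connected_space (top_of_set (sphere (0 :: complex \<times> complex) 1))"
    by (intro locally_path_connected_space_top_of_set locally_path_connected_sphere)
qed

text \<open>Restricted to the sphere because \<open>deck_transformation\<close> asks for extensional
  maps.\<close>

definition lens_deck :: "nat \<Rightarrow> int \<Rightarrow> int \<Rightarrow> complex \<times> complex \<Rightarrow> complex \<times> complex" where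
  "lens_deck p q k = restrict (lens_action p q k) (sphere 0 1)"

lemma lens_deck_compose:
  assumes "p \<ge> 1" "coprime (int p) q"
  shows "compose (sphere 0 1) (lens_deck p q j) (lens_deck p q k) = lens_deck p q ((j + k) mod int p)"
  by (auto simp: compose_def lens_deck_def fun_eq_iff lens_action_mod[OF assms] lens_action_add)

text \<open>The point \<open>(1, 0)\<close> has \<open>p\<close> different images under the
  rotations, which make up its fibre, and a deck transformation is determined by the image of this
  point.\<close>

lemma lens_deck_bij:
  assumes pq: "p \<ge> 1" "coprime (int p) q"
  shows "bij_betw (lens_deck p q) {0..<int p}
    {h. deck_transformation (top_of_set (sphere 0 1)) (lens_orbit p q) h}"
proof -
  let ?S = "sphere 0 1 :: (complex \<times> complex) set" and ?\<pi> = "lens_orbit p q"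
  interpret universal_covering "top_of_set ?S" "lens_space p q" ?\<pi>
    by (rule universal_covering_lens[OF pq])
  have deck: "deck_transformation (top_of_set ?S) ?\<pi> (lens_deck p q k)" for k
  proof -
    have 1: "homeomorphic_map (top_of_set ?S) (top_of_set ?S) (lens_deck p q k)"
      by (rule homeomorphic_map_eq[OF homeomorphic_map_lens_action]) (simp add: lens_deck_def)
    have "?\<pi> (lens_action p q k y) = ?\<pi> y" for y
      using lens_orbit_eq_iff[OF pq] lens_action_mod[OF pq, of k y] pq(1)
      by (metis atLeastLessThan_iff of_nat_0_less_iff less_le_trans pos_mod_bound pos_mod_sign zero_less_one)
    then show ?thesis using 1 by (auto simp: deck_transformation_def lens_deck_def)
  qed
  let ?z = "(1, 0) :: complex \<times> complex"
  have "norm ?z = 1" by (simp add: norm_prod_def)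
  then have z: "?z \<in> ?S" "?z \<noteq> 0" unfolding mem_sphere_0 by (auto simp: zero_prod_def)
  show ?thesis
    unfolding bij_betw_def
  proof
    show "inj_on (lens_deck p q) {0..<int p}"
    proof (rule inj_onI)
      fix j k assume jk: "j \<in> {0..<int p}" "k \<in> {0..<int p}" and eq: "lens_deck p q j = lens_deck p q k"
      have "lens_action p q j ?z = lens_action p q k ?z" using fun_cong[OF eq, of ?z] z by (simp add: lens_deck_def)
      then have "lens_action p q (- k) (lens_action p q j ?z) = lens_action p q (- k) (lens_action p q k ?z)" by simp
      then have "lens_action p q (j - k) ?z = ?z" by (simp flip: lens_action_add)
      then have "int p dvd j - k" using lens_action_eq_iff[OF pq z(2)] by blast
      then show "j = k" using jk by (simp add: mod_eq_dvd_iff[symmetric])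
    qed
    show "lens_deck p q ` {0..<int p} = {h. deck_transformation (top_of_set ?S) ?\<pi> h}"
    proof (intro equalityI subsetI)
      fix h assume "h \<in> {h. deck_transformation (top_of_set ?S) ?\<pi> h}"
      then have h: "deck_transformation (top_of_set ?S) ?\<pi> h" by simp
      have "?\<pi> (h ?z) = ?\<pi> ?z" using deck_transformationD(3)[OF h] z by simp
      then obtain k where k: "k \<in> {0..<int p}" "h ?z = lens_action p q k ?z" using lens_orbit_eq_iff[OF pq] by blast
      have "h = lens_deck p q k"
        by (rule deck_transformation_eqI[OF cov con h deck, of ?z]) (use z k in \<open>auto simp: lens_deck_def\<close>)
      then show "h \<in> lens_deck p q ` {0..<int p}" using k by blast
    qed (use deck in auto)
  qed
qed

section \<open>Equivariant general position\<close>

text \<open>Baire's theorem in the complete space of continuous maps with the uniform metric.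
  Openness and density are phrased with explicit bounds, so that applications need not deal with the
  extensional maps that are the points of this metric space.\<close>

lemma generic_continuous_map_exists:
  fixes P :: "'i \<Rightarrow> ('b \<Rightarrow> 'v::{complete_space, real_normed_vector}) \<Rightarrow> bool"
  assumes E: "compact_space E" and I: "countable I"
    and opn: "\<And>i f. i \<in> I \<Longrightarrow> continuous_map E euclidean f \<Longrightarrow> P i f \<Longrightarrow>
      \<exists>\<delta>>0. \<forall>g. continuous_map E euclidean g \<longrightarrow> (\<forall>x \<in> topspace E. norm (f x - g x) < \<delta>) \<longrightarrow> P i g"
    and dense: "\<And>i f \<epsilon>. i \<in> I \<Longrightarrow> continuous_map E euclidean f \<Longrightarrow> \<epsilon> > 0 \<Longrightarrow>
      \<exists>g. continuous_map E euclidean g \<and> (\<forall>x \<in> topspace E. norm (f x - g x) \<le> \<epsilon>) \<and> P i g"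
  obtains f where "continuous_map E euclidean f" "\<And>i. i \<in> I \<Longrightarrow> P i f"
proof -
  let ?F = "cfunspace E (euclidean_metric :: 'v metric)"
  interpret F: Metric_space "mspace ?F" "mdist ?F" by (rule Metric_space_mspace_mdist)
  have comp: "F.mcomplete"
    using Met_TC.mcomplete_cfunspace[where 'a='v and X=E] complete_UNIV[where 'a='v]
    unfolding mcomplete_of_def Met_TC.Self_def euclidean_metric_def by blast
  have cE: "compactin E (topspace E)" using E by (simp add: compact_space_def)
  have ms: "f \<in> mspace ?F \<longleftrightarrow> f \<in> extensional (topspace E) \<and> continuous_map E euclidean f" for f
    unfolding compactin_mspace_cfunspace[OF cE] by auto
  have dle: "mdist ?F f g \<le> e" if "0 \<le> e" "\<And>x. x \<in> topspace E \<Longrightarrow> norm (f x - g x) \<le> e" for f g e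
    using mdist_cfunspace_le[of e E euclidean_metric f g] that by (simp add: dist_norm)
  have dlt: "norm (f x - g x) < e"
    if "f \<in> mspace ?F" "g \<in> mspace ?F" "mdist ?F f g < e" "x \<in> topspace E" for f g e x
    using cfunspace_mdist_lt[OF cE that] by (simp add: dist_norm)
  let ?S = "\<lambda>i. {f \<in> mspace ?F. P i f}"
  have "F.mtopology closure_of \<Inter>(?S ` I) = mspace ?F"
  proof (rule F.metric_Baire_category[OF comp])
    show "countable (?S ` I)" using I by simp
    fix T assume "T \<in> ?S ` I"
    then obtain i where i: "i \<in> I" "T = ?S i" by blast
    have "openin F.mtopology (?S i)"
      unfolding F.openin_mtopology
    proof (intro conjI allI impI)
      fix f assume f: "f \<in> ?S i"
      then have "continuous_map E euclidean f" "P i f" using ms by blast+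
      from opn[OF i(1) this] obtain \<delta> where \<delta>: "\<delta> > 0" "\<And>g. continuous_map E euclidean g \<Longrightarrow>
          \<forall>x \<in> topspace E. norm (f x - g x) < \<delta> \<Longrightarrow> P i g"
        by auto
      have "F.mball f \<delta> \<subseteq> ?S i"
      proof
        fix g assume g: "g \<in> F.mball f \<delta>"
        then have gm: "f \<in> mspace ?F" "g \<in> mspace ?F" "mdist ?F f g < \<delta>" using F.in_mball by blast+
        have "P i g" by (rule \<delta>(2)) (use gm ms dlt[OF gm] in blast)+
        then show "g \<in> ?S i" using gm by blast
      qed
      then show "\<exists>r>0. F.mball f r \<subseteq> ?S i" using \<delta> by blast
    qed auto
    moreover have "F.mtopology closure_of (?S i) = mspace ?F"
      unfolding F.metric_closure_of
    proof (intro equalityI subsetI)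
      fix f assume f: "f \<in> mspace ?F"
      have "\<exists>g \<in> ?S i. g \<in> F.mball f r" if "r > 0" for r
      proof -
        obtain g where g: "continuous_map E euclidean g" "\<And>x. x \<in> topspace E \<Longrightarrow> norm (f x - g x) \<le> r/3" "P i g"
          using dense[OF i(1), of f "r/3"] f ms \<open>r > 0\<close> by (metis divide_pos_pos zero_less_numeral)
        define g' where "g' = restrict g (topspace E)"
        have g': "continuous_map E euclidean g'"
          by (rule continuous_map_eq[OF g(1)]) (simp add: g'_def)
        from opn[OF i(1) g(1,3)] obtain \<delta> where \<delta>: "\<delta> > 0" "\<And>h. continuous_map E euclidean h \<Longrightarrow>
          \<forall>x \<in> topspace E. norm (g x - h x) < \<delta> \<Longrightarrow> P i h"
          by auto
        \<comment> \<open>Openness at \<open>g\<close> shows that \<open>P i\<close> ignores values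
          outside \<open>topspace E\<close>; so \<open>g\<close> may be exchanged for its
          extensional version, which is a point of the function space.\<close>
        have "P i g'" by (rule \<delta>(2)[OF g']) (use \<delta>(1) in \<open>simp add: g'_def\<close>)
        moreover have gm: "g' \<in> mspace ?F" using g' ms by (simp add: g'_def)
        moreover have "mdist ?F f g' \<le> r/3" by (rule dle) (use g(2) that in \<open>auto simp: g'_def\<close>)
        then have "mdist ?F f g' < r" using that by linarith
        then have "g' \<in> F.mball f r" using f gm F.in_mball by blast
        ultimately show ?thesis by blast
      qed
      then show "f \<in> {x \<in> mspace ?F. \<forall>r>0. \<exists>y\<in>?S i. y \<in> F.mball x r}" using f by blast
    qed auto
    ultimately show "openin F.mtopology T \<and> F.mtopology closure_of T = mspace ?F" using i(2) by simp
  qed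
  \<comment> \<open>A dense intersection has a member only if the function space is nonempty; the
    zero map provides a point.\<close>
  moreover have "restrict (\<lambda>_. 0) (topspace E) \<in> mspace ?F"
    unfolding ms by (auto intro: continuous_map_eq[of E euclidean "\<lambda>_. 0"])
  ultimately have "restrict (\<lambda>_. 0) (topspace E) \<in> F.mtopology closure_of \<Inter>(?S ` I)" by blast
  then have "\<forall>r>0. \<exists>f \<in> \<Inter>(?S ` I). f \<in> F.mball (restrict (\<lambda>_. 0) (topspace E)) r"
    unfolding F.metric_closure_of by blast
  then obtain f where f: "f \<in> \<Inter>(?S ` I)" "f \<in> F.mball (restrict (\<lambda>_. 0) (topspace E)) 1"
    using zero_less_one by blast
  have "f \<in> mspace ?F" using f(2) F.in_mball by blast
  then show ?thesis using that f(1) ms by blast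
qed

lemma continuous_map_scaleR:
  fixes g :: "'a \<Rightarrow> 'v::real_normed_vector"
  assumes "continuous_map X euclideanreal f" "continuous_map X euclidean g"
  shows "continuous_map X euclidean (\<lambda>x. f x *\<^sub>R g x)"
proof -
  have "continuous_map X euclidean (\<lambda>x. (f x, g x))"
    using continuous_map_pairedI[OF assms] by (simp add: euclidean_product_topology)
  moreover have "continuous_map euclidean euclidean (\<lambda>z::real \<times> 'v. fst z *\<^sub>R snd z)"
    by (auto intro!: continuous_intros)
  ultimately have "continuous_map X euclidean ((\<lambda>z::real \<times> 'v. fst z *\<^sub>R snd z) \<circ> (\<lambda>x. (f x, g x)))"
    by (rule continuous_map_compose)
  then show ?thesis by (simp add: o_def)
qed

section \<open>Linear and topological free actions of a cyclic group\<close>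

text \<open>Exponents range over all integers so that sums and differences need no reduction;
  \<open>R_fix\<close> says at once that the action factors through the integers mod
  \<open>p\<close> and that it is free away from 0.\<close>

locale free_cyclic_isometries =
  fixes p :: nat and R :: "int \<Rightarrow> 'v::euclidean_space \<Rightarrow> 'v"
  assumes p: "p \<ge> 1" and R_linear: "\<And>k. linear (R k)" and R_norm: "\<And>k v. norm (R k v) = norm v"
    and R_add: "\<And>j k v. R (j + k) v = R j (R k v)"
    and R_fix: "\<And>k v. v \<noteq> 0 \<Longrightarrow> R k v = v \<longleftrightarrow> int p dvd k"
begin

lemma R_mod: "R (k mod int p) v = R k v"
proof (cases "v = 0")
  case True
  then show ?thesis using R_linear by (simp add: linear_0)
next
  case False
  then show ?thesis
    using R_add[of "k mod int p" "int p * (k div int p)" v] R_fix[of v "int p * (k div int p)"] by simp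
qed

lemma R_0: "R 0 v = v"
  using R_fix[of v 0] R_linear[of 0] by (cases "v = 0") (auto simp: linear_0)

lemma free_orthogonal_sphere_action:
  "free_orthogonal_sphere_action (integer_mod_group p) (\<lambda>k. restrict (R k) (sphere 0 1))"
proof -
  let ?S = "sphere 0 1 :: 'v set" and ?\<rho> = "\<lambda>k. restrict (R k) (sphere 0 1)" and ?G = "integer_mod_group p"
  have carr: "carrier ?G = {0..<int p}" and mult: "j \<otimes>\<^bsub>?G\<^esub> k = (j + k) mod int p" and one: "\<one>\<^bsub>?G\<^esub> = 0" for j k
    using p by (auto simp: integer_mod_group_def)
  have Bij: "?\<rho> k \<in> Bij ?S" for k
  proof -
    have "R (- k) (R k v) = v" "R k (R (- k) v) = v" for v using R_add[of "- k" k v] R_add[of k "- k" v] R_0 by auto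
    then have "bij_betw (R k) ?S ?S"
      by (intro bij_betw_byWitness[where f' = "R (- k)"]) (auto simp: R_norm)
    then have "bij_betw (?\<rho> k) ?S ?S" by (rule bij_betw_cong[THEN iffD1, rotated]) simp
    then show ?thesis by (simp add: Bij_def)
  qed
  have "group_action ?G ?S ?\<rho>"
    unfolding group_action_def
  proof (intro group_hom.intro group_hom_axioms.intro group_BijGroup homI)
    show "group ?G" by simp
    show "?\<rho> k \<in> carrier (BijGroup ?S)" for k using Bij by (simp add: BijGroup_def)
    fix j k
    have "restrict (R ((j + k) mod int p)) ?S = compose ?S (?\<rho> j) (?\<rho> k)"
    proof (rule extensionalityI[of _ ?S])
      fix v assume v: "v \<in> ?S"
      then have "v \<noteq> 0" by auto
      then show "restrict (R ((j + k) mod int p)) ?S v = compose ?S (?\<rho> j) (?\<rho> k) v"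
        using v R_mod R_add by (simp add: compose_def R_norm)
    qed (auto simp: compose_def)
    then show "?\<rho> (j \<otimes>\<^bsub>?G\<^esub> k) = ?\<rho> j \<otimes>\<^bsub>BijGroup ?S\<^esub> ?\<rho> k"
      using Bij by (simp add: mult BijGroup_def)
  qed
  moreover have "\<exists>T. orthogonal_transformation T \<and> (\<forall>v \<in> ?S. ?\<rho> k v = T v)" for k
    using R_linear R_norm by (intro exI[of _ "R k"]) (auto simp: orthogonal_transformation)
  moreover have "k = 0" if "k \<in> {0..<int p}" "v \<in> ?S" "?\<rho> k v = v" for k v
  proof -
    have "v \<noteq> 0" using that(2) by auto
    then have "int p dvd k" using R_fix[of v k] that(2,3) by simp
    then show ?thesis using that(1) zdvd_not_zless[of k "int p"] by force
  qed
  ultimately show ?thesis by (simp add: free_orthogonal_sphere_action_def carr one)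
qed

end

text \<open>\<open>a\<close> obeys the same laws as the linear action; the case \<open>k = 0\<close>
  of \<open>a_fix\<close> is the identity law.\<close>

locale free_cyclic_action = free_cyclic_isometries p R
  for p and R :: "int \<Rightarrow> 'v::euclidean_space \<Rightarrow> 'v" +
  fixes E :: "'b topology" and a :: "int \<Rightarrow> 'b \<Rightarrow> 'b"
  assumes compact: "compact_space E" and Hausdorff: "Hausdorff_space E"
    and a_cont: "\<And>k. continuous_map E E (a k)"
    and a_add: "\<And>j k x. x \<in> topspace E \<Longrightarrow> a (j + k) x = a j (a k x)"
    and a_fix: "\<And>k x. x \<in> topspace E \<Longrightarrow> a k x = x \<longleftrightarrow> int p dvd k"
begin

lemma a_0: "x \<in> topspace E \<Longrightarrow> a 0 x = x" using a_fix[of x 0] by simp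

lemma a_in: "x \<in> topspace E \<Longrightarrow> a k x \<in> topspace E"
  using a_cont[of k] by (auto simp: continuous_map_def)

lemma a_minus: "x \<in> topspace E \<Longrightarrow> a (- k) (a k x) = x" "x \<in> topspace E \<Longrightarrow> a k (a (- k) x) = x"
  using a_add[of x "- k" k] a_add[of x k "- k"] a_0 by auto

lemma a_mod: "x \<in> topspace E \<Longrightarrow> a (k mod int p) x = a k x"
  using a_add[of x "k mod int p" "int p * (k div int p)"] a_fix[of x "int p * (k div int p)"] by simp

text \<open>The sum is not divided by \<open>p\<close>: only directions matter in the end, and a map
  that vanishes at the other points of the orbit of \<open>x\<close> then keeps its value at
  \<open>x\<close>.\<close>

definition avg :: "('b \<Rightarrow> 'v) \<Rightarrow> 'b \<Rightarrow> 'v" where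
  "avg F x = (\<Sum>k\<in>{0..<int p}. R (- k) (F (a k x)))"

text \<open>Shifting the summation index by \<open>j\<close> permutes the residues mod
  \<open>p\<close>, and both actions depend on the index only mod \<open>p\<close>.\<close>

lemma avg_equivariant:
  assumes x: "x \<in> topspace E"
  shows "avg F (a j x) = R j (avg F x)"
proof -
  let ?I = "{0..<int p}"
  have bij: "bij_betw (\<lambda>k. (k + j) mod int p) ?I ?I"
  proof (rule bij_betw_byWitness[where f' = "\<lambda>k. (k - j) mod int p"])
  qed (use p in \<open>auto simp: mod_simps\<close>)
  have "avg F (a j x) = (\<Sum>k\<in>?I. R j (R (- (k + j)) (F (a (k + j) x))))"
    unfolding avg_def
  proof (rule sum.cong[OF HOL.refl])
    fix k
    have "R j (R (- (k + j)) v) = R (- k) v" for v using R_add[of j "- (k + j)" v] by simp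
    then show "R (- k) (F (a k (a j x))) = R j (R (- (k + j)) (F (a (k + j) x)))" using a_add[OF x] by simp
  qed
  also have "\<dots> = (\<Sum>k\<in>?I. R j (R (- ((k + j) mod int p)) (F (a ((k + j) mod int p) x))))"
  proof (rule sum.cong[OF HOL.refl])
    fix k
    have "R (- ((k + j) mod int p)) v = R (- (k + j)) v" for v
      using R_mod[of "- ((k + j) mod int p)" v] R_mod[of "- (k + j)" v] by (simp add: mod_simps)
    then show "R j (R (- (k + j)) (F (a (k + j) x))) = R j (R (- ((k + j) mod int p)) (F (a ((k + j) mod int p) x)))"
      using a_mod[OF x] by simp
  qed
  also have "\<dots> = (\<Sum>k\<in>?I. R j (R (- k) (F (a k x))))"
    using sum.reindex_bij_betw[OF bij, of "\<lambda>k. R j (R (- k) (F (a k x)))"] .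
  also have "\<dots> = R j (avg F x)" unfolding avg_def using R_linear by (simp add: linear_sum)
  finally show ?thesis .
qed

lemma avg_add: "avg (\<lambda>x. F x + G x) x = avg F x + avg G x"
  by (simp add: avg_def linear_add[OF R_linear] sum.distrib)

lemma avg_diff: "avg (\<lambda>x. F x - G x) x = avg F x - avg G x"
  by (simp add: avg_def linear_diff[OF R_linear] sum_subtractf)

lemma continuous_avg:
  assumes "continuous_map E euclidean F"
  shows "continuous_map E euclidean (avg F)"
  unfolding avg_def[abs_def]
proof (rule continuous_map_sum)
  fix k assume "k \<in> {0..<int p}"
  have "continuous_map E euclidean (F \<circ> a k)" by (rule continuous_map_compose[OF a_cont assms])
  moreover have "continuous_map euclidean euclidean (R (- k))"
    using linear_continuous_on[OF R_linear[unfolded linear_conv_bounded_linear]] by simp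
  ultimately have "continuous_map E euclidean (R (- k) \<circ> (F \<circ> a k))" by (rule continuous_map_compose)
  then show "continuous_map E euclidean (\<lambda>x. R (- k) (F (a k x)))" by (simp add: o_def)
qed simp

lemma norm_avg_le:
  assumes "x \<in> topspace E" "\<And>y. y \<in> topspace E \<Longrightarrow> norm (F y) \<le> e"
  shows "norm (avg F x) \<le> real p * e"
proof -
  have "norm (avg F x) \<le> (\<Sum>k\<in>{0..<int p}. norm (R (- k) (F (a k x))))"
    unfolding avg_def by (rule norm_sum)
  also have "\<dots> \<le> (\<Sum>k\<in>{0..<int p}. e)" by (intro sum_mono) (simp add: R_norm assms a_in)
  finally show ?thesis by simp
qed

lemma avg_eq_first:
  assumes "x \<in> topspace E" "\<And>k. k \<in> {1..<int p} \<Longrightarrow> F (a k x) = 0"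
  shows "avg F x = F x"
proof -
  have "{0..<int p} = insert 0 {1..<int p}" using p by auto
  then have "avg F x = R 0 (F (a 0 x)) + (\<Sum>k\<in>{1..<int p}. R (- k) (F (a k x)))"
    by (simp add: avg_def)
  also have "(\<Sum>k\<in>{1..<int p}. R (- k) (F (a k x))) = 0"
    by (intro sum.neutral) (simp add: assms(2) linear_0[OF R_linear])
  finally show ?thesis using assms(1) by (simp add: R_0 a_0)
qed

lemma avg_eq_0:
  assumes "\<And>k. k \<in> {0..<int p} \<Longrightarrow> F (a k x) = 0"
  shows "avg F x = 0"
  unfolding avg_def by (intro sum.neutral) (simp add: assms linear_0[OF R_linear])

section \<open>Separation of directions as an open and dense condition\<close>

text \<open>Inequality of the normalised averages, cross-multiplied to avoid division. Both sides
  are 0 as soon as one of the two averages vanishes, so the condition also says that neither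
  does.\<close>

definition separated :: "'b set \<Rightarrow> 'b set \<Rightarrow> ('b \<Rightarrow> 'v) \<Rightarrow> bool" where
  "separated K K' F \<longleftrightarrow> (\<forall>x \<in> K. \<forall>y \<in> K'. norm (avg F y) *\<^sub>R avg F x \<noteq> norm (avg F x) *\<^sub>R avg F y)"

text \<open>On the compact set \<open>K \<times> K'\<close> the two sides differ by at least some
  \<open>\<eta> > 0\<close>, and \<open>est\<close> bounds how far each side moves with
  \<open>F\<close>.\<close>

lemma separated_open:
  assumes K: "compactin E K" and K': "compactin E K'"
    and F: "continuous_map E euclidean F" and sep: "separated K K' F"
  shows "\<exists>\<delta>>0. \<forall>G. continuous_map E euclidean G \<longrightarrow> (\<forall>x \<in> topspace E. norm (F x - G x) < \<delta>) \<longrightarrow> separated K K' G"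
proof -
  have sub: "K \<subseteq> topspace E" "K' \<subseteq> topspace E" using K K' compactin_subset_topspace by auto
  let ?f = "avg F"
  let ?D = "\<lambda>z. norm (norm (?f (snd z)) *\<^sub>R ?f (fst z) - norm (?f (fst z)) *\<^sub>R ?f (snd z))"
  note f = continuous_avg[OF F]
  have f1: "continuous_map (prod_topology E E) euclidean (\<lambda>z. ?f (fst z))"
    and f2: "continuous_map (prod_topology E E) euclidean (\<lambda>z. ?f (snd z))"
    using continuous_map_compose[OF continuous_map_fst f] continuous_map_compose[OF continuous_map_snd f]
    by (auto simp: o_def)
  have D: "continuous_map (prod_topology E E) euclideanreal ?D"
    by (intro continuous_map_norm continuous_map_diff continuous_map_scaleR f1 f2)
  have "compactin (prod_topology E E) (K \<times> K')" using K K' by (simp add: compactin_Times)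
  then have cD: "compact (?D ` (K \<times> K'))" using image_compactin[OF _ D] by simp
  have pos: "0 < d" if "d \<in> ?D ` (K \<times> K')" for d using that sep by (auto simp: separated_def)
  obtain \<eta> where \<eta>: "\<eta> > 0" "\<And>x y. x \<in> K \<Longrightarrow> y \<in> K' \<Longrightarrow> \<eta> \<le> ?D (x, y)"
  proof (cases "K \<times> K' = {}")
    case True
    then show ?thesis using that[of 1] by auto
  next
    case False
    then obtain m where m: "m \<in> ?D ` (K \<times> K')" "\<And>d. d \<in> ?D ` (K \<times> K') \<Longrightarrow> m \<le> d"
      using compact_attains_inf[OF cD] by blast
    show ?thesis
    proof (rule that[of m])
      show "m \<le> ?D (x, y)" if "x \<in> K" "y \<in> K'" for x y by (rule m(2)) (use that in blast)
    qed (use pos[OF m(1)] in simp)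
  qed
  have "compactin euclidean (?f ` topspace E)"
    using image_compactin[OF _ f] compact by (simp add: compact_space_def)
  then have "bounded (?f ` topspace E)" by (simp add: compact_imp_bounded)
  then obtain B where B: "B > 0" "\<And>x. x \<in> topspace E \<Longrightarrow> norm (?f x) \<le> B"
    unfolding bounded_pos by blast
  \<comment> \<open>Each of the two sides moves by at most \<open>(2 * B + 1) * d\<close>, so their
    difference moves by at most half of \<open>\<eta>\<close>; \<open>d \<le> 1\<close> bounds the
    new averages by \<open>B + 1\<close>.\<close>
  define d where "d = min 1 (\<eta> / (4 * (2 * B + 1)))"
  have d: "0 < d" "d \<le> 1" "d * (4 * (2 * B + 1)) \<le> \<eta>"
  proof -
    have "d * (4 * (2 * B + 1)) \<le> \<eta> / (4 * (2 * B + 1)) * (4 * (2 * B + 1))"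
      using B by (intro mult_right_mono) (auto simp: d_def)
    also have "\<dots> = \<eta>" using B by simp
    finally show "d * (4 * (2 * B + 1)) \<le> \<eta>" .
  qed (use \<eta> B in \<open>auto simp: d_def\<close>)
  show ?thesis
  \<comment> \<open>Averaging multiplies uniform distances by at most \<open>p\<close>.\<close>
  proof (intro exI[of _ "d / real p"] conjI allI impI)
    show "0 < d / real p" using d p by simp
    fix G assume G: "continuous_map E euclidean G" and close: "\<forall>x \<in> topspace E. norm (F x - G x) < d / real p"
    let ?g = "avg G"
    have fg: "norm (?f x - ?g x) \<le> d" if "x \<in> topspace E" for x
      using norm_avg_le[OF that, of "\<lambda>x. F x - G x" "d / real p"] close p
      by (simp add: avg_diff less_imp_le)
    show "separated K K' G"
      unfolding separated_def
    proof (intro ballI notI)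
      fix x y assume xy: "x \<in> K" "y \<in> K'" and eq: "norm (?g y) *\<^sub>R ?g x = norm (?g x) *\<^sub>R ?g y"
      have xE: "x \<in> topspace E" "y \<in> topspace E" using xy sub by auto
      have est: "norm (norm v *\<^sub>R u - norm v' *\<^sub>R u') \<le> (2 * B + 1) * d"
        if "norm (u - u') \<le> d" "norm (v - v') \<le> d" "norm u \<le> B" "norm v \<le> B" for u u' v v' :: 'v
      proof -
        have v': "norm v' \<le> B + 1" using that(2,4) d(2) norm_triangle_sub[of v' v] by (simp add: norm_minus_commute)
        have "norm v *\<^sub>R u - norm v' *\<^sub>R u' = (norm v - norm v') *\<^sub>R u + norm v' *\<^sub>R (u - u')"
          by (simp add: algebra_simps)
        then have "norm (norm v *\<^sub>R u - norm v' *\<^sub>R u') \<le> \<bar>norm v - norm v'\<bar> * norm u + norm v' * norm (u - u')"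
          using norm_triangle_ineq[of "(norm v - norm v') *\<^sub>R u" "norm v' *\<^sub>R (u - u')"] by simp
        also have "\<dots> \<le> d * B + (B + 1) * d"
          using that v' d B norm_triangle_ineq3[of v v']
          by (intro add_mono mult_mono) auto
        finally show ?thesis by (simp add: algebra_simps)
      qed
      have "\<eta> \<le> ?D (x, y)" using \<eta>(2)[OF xy] .
      also have "\<dots> = norm ((norm (?f y) *\<^sub>R ?f x - norm (?g y) *\<^sub>R ?g x) - (norm (?f x) *\<^sub>R ?f y - norm (?g x) *\<^sub>R ?g y))"
        using eq by simp
      also have "\<dots> \<le> (2 * B + 1) * d + (2 * B + 1) * d"
        by (intro order_trans[OF norm_triangle_ineq4] add_mono est fg B xE)
      also have "\<dots> = d * (4 * (2 * B + 1)) / 2" by simp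
      also have "\<dots> < \<eta>" using d(3) \<eta>(1) by linarith
      finally show False by simp
    qed
  qed
qed

text \<open>Only continuity and injectivity of \<open>\<psi>\<close> are kept, which give an
  embedding on compact subsets. The last clause ensures that a map supported in \<open>W\<close>
  contributes a single summand to its average on \<open>W\<close>.\<close>

definition free_chart :: "'b set \<Rightarrow> ('b \<Rightarrow> 'u::euclidean_space) \<Rightarrow> bool" where
  "free_chart W \<psi> \<longleftrightarrow> openin E W \<and> continuous_map (subtopology E W) euclidean \<psi> \<and> inj_on \<psi> W \<and>
     (\<forall>k \<in> {1..<int p}. \<forall>x \<in> W. a k x \<notin> W)"

text \<open>A bump function multiplies the difference between \<open>P \<circ> \<psi> + v\<close>
  and \<open>avg F\<close>; the product is supported in \<open>W\<close> and away from
  \<open>C\<close>, and on \<open>K\<close> only the summand with \<open>k = 0\<close> of its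
  average survives. The polynomial is fixed before \<open>v\<close>, because \<open>v\<close> will
  have to avoid a set that depends on it.\<close>

lemma modify_near_chart:
  fixes \<psi> :: "'b \<Rightarrow> 'u::euclidean_space"
  assumes "free_chart W \<psi>"
    and K: "closedin E K" "K \<subseteq> W" and C: "closedin E C" "C \<inter> K = {}" "\<And>k x. x \<in> C \<Longrightarrow> a k x \<in> C"
    and F: "continuous_map E euclidean F" and \<epsilon>: "\<epsilon> > 0"
  obtains P where "polynomial_function P"
    "\<And>v. norm v \<le> \<epsilon> / 2 \<Longrightarrow> \<exists>h. continuous_map E euclidean h \<and> (\<forall>x \<in> topspace E. norm (h x) \<le> \<epsilon>) \<and>
      (\<forall>x \<in> K. avg h x = P (\<psi> x) + v - avg F x) \<and> (\<forall>x \<in> C. avg h x = 0)"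
proof -
  have W: "openin E W" "continuous_map (subtopology E W) euclidean \<psi>" "inj_on \<psi> W"
    and free: "\<And>k x. k \<in> {1..<int p} \<Longrightarrow> x \<in> W \<Longrightarrow> a k x \<notin> W"
    using assms(1) by (auto simp: free_chart_def)
  have normal: "normal_space E" using compact Hausdorff compact_Hausdorff_or_regular_imp_normal_space by blast
  have WC: "openin E (W - C)" "K \<subseteq> W - C" using W K C by auto
  \<comment> \<open>The chart is continuous only on \<open>W\<close>, so the correction has to die
    out within a closed neighbourhood of \<open>K\<close> inside \<open>W\<close>.\<close>
  obtain N where N: "openin E N" "K \<subseteq> N" "E closure_of N \<subseteq> W - C"
    using normal WC K(1) unfolding normal_space_alt by meson
  define L where "L = E closure_of N"
  have L: "closedin E L" "N \<subseteq> L" "L \<subseteq> W" "L \<inter> C = {}" "L \<subseteq> topspace E"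
    using N closure_of_subset[OF openin_subset[OF N(1)]] closure_of_subset_topspace[of E N]
    by (auto simp: L_def)
  have clN: "closedin E (topspace E - N)" and disj: "disjnt (topspace E - N) K"
    using N(1,2) by (auto simp: disjnt_def)
  obtain bump where bump: "continuous_map E (top_of_set {0..1}) bump"
    "bump ` (topspace E - N) \<subseteq> {0::real}" "bump ` K \<subseteq> {1}"
    by (rule Urysohn_lemma[OF normal clN K(1) disj zero_le_one])
  have bump_cont: "continuous_map E euclideanreal bump" and bump_bounds: "\<And>x. x \<in> topspace E \<Longrightarrow> 0 \<le> bump x \<and> bump x \<le> 1"
    using bump(1) by (auto simp: continuous_map_in_subtopology)
  let ?f = "avg F" and ?T = "subtopology E L"
  note f = continuous_avg[OF F]
  have \<psi>L: "continuous_map ?T euclidean \<psi>" using W(2) L(3) continuous_map_from_subtopology_mono by blast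
  have injL: "inj_on \<psi> L" using W(3) L(3) inj_on_subset by blast
  \<comment> \<open>A continuous injection of the compact set \<open>L\<close> into a Euclidean
    space is a homeomorphism onto its image, so \<open>avg F\<close> becomes a continuous function
    on a compact set of vectors, where Stone-Weierstrass applies.\<close>
  have "compact_space ?T" using compact L(1) closedin_compact_space compact_space_subtopology by blast
  then have "homeomorphic_map ?T (top_of_set (\<psi> ` L)) \<psi>"
    using \<psi>L injL L(5)
    by (intro continuous_imp_homeomorphic_map)
      (auto simp: continuous_map_in_subtopology Int_absorb1 Hausdorff_space_subtopology)
  then obtain g where g: "homeomorphic_maps ?T (top_of_set (\<psi> ` L)) \<psi> g"
    using homeomorphic_map_maps by blast
  have gL: "g (\<psi> x) = x" if "x \<in> L" for x
    using g that L(5) by (auto simp: homeomorphic_maps_def)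
  have "continuous_map (top_of_set (\<psi> ` L)) euclidean (?f \<circ> g)"
    using g f L(1) by (intro continuous_map_compose[of _ E]) (auto simp: homeomorphic_maps_def continuous_map_in_subtopology)
  then have cont: "continuous_on (\<psi> ` L) (?f \<circ> g)" by simp
  have "compactin ?T L" using \<open>compact_space ?T\<close> L(5) by (simp add: compact_space_def Int_absorb1)
  then have "compact (\<psi> ` L)" using image_compactin[OF _ \<psi>L] by simp
  then obtain P where P: "polynomial_function P" "\<And>z. z \<in> \<psi> ` L \<Longrightarrow> norm ((?f \<circ> g) z - P z) < \<epsilon> / 2"
    using Stone_Weierstrass_polynomial_function[OF _ cont, of "\<epsilon> / 2"] \<epsilon> by (metis half_gt_zero)
  show ?thesis
  proof (rule that[OF P(1)])
    fix v :: 'v assume v: "norm v \<le> \<epsilon> / 2"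
    define h where "h x = (if x \<in> L then bump x *\<^sub>R (P (\<psi> x) + v - ?f x) else 0)" for x
    have off: "h x = 0" if "x \<in> topspace E" "x \<notin> N" for x
      using bump(2) that by (auto simp: h_def)
    have "continuous_map E euclidean (\<lambda>x. if x \<in> L then bump x *\<^sub>R (P (\<psi> x) + v - ?f x) else 0)"
    proof (rule continuous_map_paste_closed[OF L(1), of "topspace E - N"])
      show "closedin E (topspace E - N)" using N(1) by blast
      show "topspace E \<subseteq> L \<union> (topspace E - N)" using L(2) by auto
      have "continuous_map ?T euclidean (P \<circ> \<psi>)"
        using continuous_map_compose[OF \<psi>L, of euclidean P] continuous_on_polymonial_function[OF P(1)] by simp
      then have "continuous_map ?T euclidean (\<lambda>x. P (\<psi> x))" by (simp add: o_def)
      moreover have "continuous_map ?T euclidean ?f" "continuous_map ?T euclideanreal bump"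
        using f bump_cont continuous_map_from_subtopology by blast+
      ultimately show "continuous_map ?T euclidean (\<lambda>x. bump x *\<^sub>R (P (\<psi> x) + v - ?f x))"
        by (intro continuous_map_scaleR continuous_map_diff continuous_map_add) auto
      show "bump x *\<^sub>R (P (\<psi> x) + v - ?f x) = 0" if "x \<in> topspace E - N" for x
        using bump(2) that by auto
    qed simp
    then have h: "continuous_map E euclidean h" by (simp add: h_def[abs_def])
    have bound: "norm (h x) \<le> \<epsilon>" if x: "x \<in> topspace E" for x
    proof (cases "x \<in> L")
      case True
      have "norm (h x) \<le> 1 * norm (P (\<psi> x) + v - ?f x)"
        using bump_bounds[OF x] True mult_right_mono[of "bump x" 1 "norm (P (\<psi> x) + v - ?f x)"]
        by (simp add: h_def)
      also have "norm (P (\<psi> x) + v - ?f x) \<le> norm (?f x - P (\<psi> x)) + norm v"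
        using norm_triangle_ineq[of "P (\<psi> x) - ?f x" v] by (simp add: algebra_simps norm_minus_commute)
      also have "\<dots> \<le> \<epsilon>" using P(2)[of "\<psi> x"] True gL v by auto
      finally show ?thesis by simp
    qed (use \<epsilon> in \<open>simp add: h_def\<close>)
    have "avg h x = P (\<psi> x) + v - ?f x" if x: "x \<in> K" for x
    proof -
      have xL: "x \<in> L" "x \<in> W" "x \<in> topspace E" using x N(2) L K(2) by auto
      have "avg h x = h x"
        using free[OF _ xL(2)] L(3) by (intro avg_eq_first[OF xL(3)]) (auto simp: h_def)
      then show ?thesis using bump(3) x xL by (auto simp: h_def)
    qed
    moreover have "avg h x = 0" if x: "x \<in> C" for x
      using C(3)[OF x] L(4) by (intro avg_eq_0) (auto simp: h_def)
    ultimately show "\<exists>h. continuous_map E euclidean h \<and> (\<forall>x \<in> topspace E. norm (h x) \<le> \<epsilon>) \<and>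
      (\<forall>x \<in> K. avg h x = P (\<psi> x) + v - avg F x) \<and> (\<forall>x \<in> C. avg h x = 0)"
      using h bound by blast
  qed
qed

definition "orbit_hull K = (\<Union>k\<in>{0..<int p}. a k ` K)"

lemma orbit_hull:
  assumes K: "closedin E K"
  shows "closedin E (orbit_hull K)" "x \<in> orbit_hull K \<Longrightarrow> a k x \<in> orbit_hull K" "K \<subseteq> orbit_hull K"
proof -
  have KE: "K \<subseteq> topspace E" using K closedin_subset by blast
  have "closedin E (a k ` K)" for k
    using continuous_imp_closed_map[OF a_cont compact Hausdorff] K by (simp add: closed_map_def)
  then show "closedin E (orbit_hull K)" unfolding orbit_hull_def by (intro closedin_Union) auto
  show "a k x \<in> orbit_hull K" if x: "x \<in> orbit_hull K"
  proof -
    obtain j y where jy: "y \<in> K" "x = a j y" using x by (auto simp: orbit_hull_def)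
    then have "a k x = a ((k + j) mod int p) y" using a_add a_mod KE by auto
    then show ?thesis using jy(1) p by (auto simp: orbit_hull_def)
  qed
  show "K \<subseteq> orbit_hull K"
    using a_0 KE p unfolding orbit_hull_def by force
qed

text \<open>Disjointness of the orbit hulls lets the two modifications be made independently, each
  with half of \<open>\<epsilon>\<close>. The translations are chosen in order: \<open>v'\<close>
  makes the values on \<open>K'\<close> nonzero, then \<open>v\<close>, with \<open>v'\<close>
  known, excludes coincident directions.\<close>

lemma separated_dense:
  fixes \<psi> \<psi>' :: "'b \<Rightarrow> 'u::euclidean_space"
  assumes dim: "2 * DIM('u) + 1 < DIM('v)"
    and W: "free_chart W \<psi>" and W': "free_chart W' \<psi>'"
    and K: "closedin E K" "K \<subseteq> W" and K': "closedin E K'" "K' \<subseteq> W'"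
    and dis: "orbit_hull K \<inter> orbit_hull K' = {}"
    and F: "continuous_map E euclidean F" and \<epsilon>: "\<epsilon> > 0"
  shows "\<exists>G. continuous_map E euclidean G \<and> (\<forall>x \<in> topspace E. norm (F x - G x) \<le> \<epsilon>) \<and> separated K K' G"
proof -
  have \<epsilon>2: "\<epsilon> / 2 > 0" using \<epsilon> by simp
  note OK = orbit_hull[OF K(1)] and OK' = orbit_hull[OF K'(1)]
  obtain P where P: "polynomial_function P"
    "\<And>v. norm v \<le> \<epsilon> / 2 / 2 \<Longrightarrow> \<exists>h. continuous_map E euclidean h \<and> (\<forall>x \<in> topspace E. norm (h x) \<le> \<epsilon> / 2) \<and>
      (\<forall>x \<in> K. avg h x = P (\<psi> x) + v - avg F x) \<and> (\<forall>x \<in> orbit_hull K'. avg h x = 0)"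
    by (rule modify_near_chart[OF W K OK'(1) _ OK'(2) F \<epsilon>2]) (use dis OK(3) in auto)
  obtain P' where P': "polynomial_function P'"
    "\<And>v. norm v \<le> \<epsilon> / 2 / 2 \<Longrightarrow> \<exists>h. continuous_map E euclidean h \<and> (\<forall>x \<in> topspace E. norm (h x) \<le> \<epsilon> / 2) \<and>
      (\<forall>x \<in> K'. avg h x = P' (\<psi>' x) + v - avg F x) \<and> (\<forall>x \<in> orbit_hull K. avg h x = 0)"
    by (rule modify_near_chart[OF W' K' OK(1) _ OK(2) F \<epsilon>2]) (use dis OK'(3) in auto)
  \<comment> \<open>A ball has positive measure, so no null set contains all small vectors.\<close>
  have avoid: "\<exists>v. norm v \<le> \<epsilon> / 2 / 2 \<and> v \<notin> S" if "negligible S" for S :: "'v set"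
  proof (rule ccontr)
    assume "\<not> ?thesis"
    then have "ball 0 (\<epsilon> / 2 / 2) \<subseteq> S" by (auto simp: subset_iff)
    then have "negligible (ball (0 :: 'v) (\<epsilon> / 2 / 2))" using that negligible_subset by blast
    then show False using open_not_negligible[of "ball (0 :: 'v) (\<epsilon> / 2 / 2)"] \<epsilon> by auto
  qed
  have "negligible ((\<lambda>z. - P' z) ` UNIV)"
    by (rule negligible_differentiable_image_lowdim)
      (use dim differentiable_on_polynomial_function[OF P'(1)] in \<open>auto intro: differentiable_on_minus\<close>)
  then obtain v' where v': "norm v' \<le> \<epsilon> / 2 / 2" "v' \<notin> range (\<lambda>z. - P' z)" using avoid by blast
  have nz: "P' z + v' \<noteq> 0" for z
  proof
    assume "P' z + v' = 0"
    then have "v' = - P' z" by (simp add: eq_neg_iff_add_eq_0 add.commute)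
    then show False using v'(2) by blast
  qed
  \<comment> \<open>The range consists of all \<open>v\<close> for which some value
    \<open>P z + v\<close> is a real multiple of some value \<open>P' z' + v'\<close>. The domain
    has dimension \<open>2 * DIM('u) + 1\<close>, which is where the bound in \<open>dim\<close>
    comes from.\<close>
  let ?Q = "\<lambda>z :: ('u \<times> 'u) \<times> real. snd z *\<^sub>R (P' (snd (fst z)) + v') - P (fst (fst z))"
  have "?Q differentiable_on UNIV"
  proof -
    have 1: "(\<lambda>z :: ('u \<times> 'u) \<times> real. P' (snd (fst z))) differentiable_on UNIV"
    proof (rule differentiable_at_imp_differentiable_on)
      fix z :: "('u \<times> 'u) \<times> real"
      have "(\<lambda>z :: ('u \<times> 'u) \<times> real. snd (fst z)) differentiable (at z)"
        by (intro bounded_linear_imp_differentiable bounded_linear_snd_comp bounded_linear_fst)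
      from differentiable_chain_at[OF this differentiable_at_polynomial_function[OF P'(1)]]
      show "(\<lambda>z. P' (snd (fst z))) differentiable (at z)" by (simp add: o_def)
    qed
    have 2: "(\<lambda>z :: ('u \<times> 'u) \<times> real. P (fst (fst z))) differentiable_on UNIV"
    proof (rule differentiable_at_imp_differentiable_on)
      fix z :: "('u \<times> 'u) \<times> real"
      have "(\<lambda>z :: ('u \<times> 'u) \<times> real. fst (fst z)) differentiable (at z)"
        by (intro bounded_linear_imp_differentiable bounded_linear_fst_comp bounded_linear_fst)
      from differentiable_chain_at[OF this differentiable_at_polynomial_function[OF P(1)]]
      show "(\<lambda>z. P (fst (fst z))) differentiable (at z)" by (simp add: o_def)
    qed
    have 3: "(\<lambda>z :: ('u \<times> 'u) \<times> real. snd z) differentiable_on UNIV"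
      by (intro differentiable_at_imp_differentiable_on bounded_linear_imp_differentiable bounded_linear_snd)
    show ?thesis using 1 2 3 by (intro differentiable_on_diff differentiable_on_scaleR differentiable_on_add) auto
  qed
  then have "negligible (?Q ` UNIV)"
    by (intro negligible_differentiable_image_lowdim) (use dim in auto)
  then obtain v where v: "norm v \<le> \<epsilon> / 2 / 2" "v \<notin> range ?Q" using avoid by blast
  obtain h where h: "continuous_map E euclidean h" "\<And>x. x \<in> topspace E \<Longrightarrow> norm (h x) \<le> \<epsilon> / 2"
    "\<And>x. x \<in> K \<Longrightarrow> avg h x = P (\<psi> x) + v - avg F x" "\<And>x. x \<in> orbit_hull K' \<Longrightarrow> avg h x = 0"
    using P(2)[OF v(1)] by blast
  obtain h' where h': "continuous_map E euclidean h'" "\<And>x. x \<in> topspace E \<Longrightarrow> norm (h' x) \<le> \<epsilon> / 2"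
    "\<And>x. x \<in> K' \<Longrightarrow> avg h' x = P' (\<psi>' x) + v' - avg F x" "\<And>x. x \<in> orbit_hull K \<Longrightarrow> avg h' x = 0"
    using P'(2)[OF v'(1)] by blast
  let ?G = "\<lambda>x. F x + (h x + h' x)"
  have G: "continuous_map E euclidean ?G" by (intro continuous_map_add F h(1) h'(1))
  have close: "norm (F x - ?G x) \<le> \<epsilon>" if "x \<in> topspace E" for x
  proof -
    have "F x - ?G x = - (h x + h' x)" by simp
    then have "norm (F x - ?G x) = norm (h x + h' x)" by (metis norm_minus_cancel)
    then show ?thesis using norm_triangle_ineq[of "h x" "h' x"] h(2)[OF that] h'(2)[OF that] by linarith
  qed
  have GK: "avg ?G x = P (\<psi> x) + v" if "x \<in> K" for x
    using h(3)[OF that] h'(4)[of x] OK(3) that by (auto simp: avg_add)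
  have GK': "avg ?G y = P' (\<psi>' y) + v'" if "y \<in> K'" for y
    using h(4)[of y] h'(3)[OF that] OK'(3) that by (auto simp: avg_add)
  have "separated K K' ?G"
    unfolding separated_def
  proof (intro ballI notI)
    fix x y assume xy: "x \<in> K" "y \<in> K'" and eq: "norm (avg ?G y) *\<^sub>R avg ?G x = norm (avg ?G x) *\<^sub>R avg ?G y"
    let ?A = "avg ?G x" and ?B = "avg ?G y"
    have "?B \<noteq> 0" using GK'[OF xy(2)] nz by simp
    \<comment> \<open>Dividing by the nonzero norm of \<open>?B\<close> expresses \<open>?A\<close>
      as a multiple of \<open>?B\<close>; the factor 0 covers a vanishing \<open>?A\<close>.\<close>
    define t where "t = norm ?A / norm ?B"
    have "?A = t *\<^sub>R ?B"
      using arg_cong[OF eq, of "\<lambda>w. (1 / norm ?B) *\<^sub>R w"] \<open>?B \<noteq> 0\<close> by (simp add: t_def)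
    moreover have "v = ?A - P (\<psi> x)" using GK[OF xy(1)] by simp
    ultimately have "v = t *\<^sub>R (P' (\<psi>' y) + v') - P (\<psi> x)" using GK'[OF xy(2)] by metis
    then have "v = ?Q ((\<psi> x, \<psi>' y), t)" by simp
    then show False using v(2) by blast
  qed
  then show ?thesis using G close by blast
qed

section \<open>The equivariant embedding into the sphere\<close>

text \<open>\<open>two\<close> supplies for each point one in another orbit; separation of these two
  shows that the average does not vanish and can be normalised. Injectivity rests on separation
  across orbits and on freeness of \<open>R\<close> within an orbit.\<close>

lemma equivariant_embedding:
  assumes dim: "2 * DIM('u::euclidean_space) + 1 < DIM('v)" and sc: "second_countable E"
    and chart: "\<And>x. x \<in> topspace E \<Longrightarrow> \<exists>W \<psi>. openin E W \<and> x \<in> W \<and>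
      continuous_map (subtopology E W) euclidean (\<psi> :: 'b \<Rightarrow> 'u) \<and> inj_on \<psi> W"
    and two: "\<And>x. x \<in> topspace E \<Longrightarrow> \<exists>y \<in> topspace E. \<forall>k. y \<noteq> a k x"
  obtains \<epsilon> :: "'b \<Rightarrow> 'v" where "embedding_map E (top_of_set (sphere 0 1)) \<epsilon>"
    "\<And>k x. x \<in> topspace E \<Longrightarrow> \<epsilon> (a k x) = R k (\<epsilon> x)"
proof -
  define nice where "nice K \<longleftrightarrow> closedin E K \<and> (\<exists>W (\<psi> :: 'b \<Rightarrow> 'u). K \<subseteq> W \<and> free_chart W \<psi>)" for K
  obtain \<B> where \<B>: "countable \<B>" "\<And>V. V \<in> \<B> \<Longrightarrow> openin E V"
    "\<And>U x. openin E U \<Longrightarrow> x \<in> U \<Longrightarrow> \<exists>V \<in> \<B>. x \<in> V \<and> V \<subseteq> U"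
    using sc unfolding second_countable_def by meson
  \<comment> \<open>Closures of basic open sets keep the family countable, and by
    \<open>small\<close> those lying in a free chart are still found inside every open neighbourhood
    of every point.\<close>
  define \<K> where "\<K> = {K \<in> (\<lambda>V. E closure_of V) ` \<B>. nice K}"
  define I where "I = {(K, K'). K \<in> \<K> \<and> K' \<in> \<K> \<and> orbit_hull K \<inter> orbit_hull K' = {}}"
  have nhd: "\<exists>O1 O2. openin E O1 \<and> openin E O2 \<and> x \<in> O1 \<and> y \<in> O2 \<and> (\<forall>z \<in> O1. a k z \<notin> O2)"
    if x: "x \<in> topspace E" and y: "y \<in> topspace E" "y \<noteq> a k x" for x y k
  proof -
    obtain A B where AB: "openin E A" "openin E B" "a k x \<in> A" "y \<in> B" "disjnt A B"
      using Hausdorff x y a_in[OF x, of k] unfolding Hausdorff_space_def by metis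
    have "openin E {z \<in> topspace E. a k z \<in> A}" using openin_continuous_map_preimage[OF a_cont AB(1)] .
    then show ?thesis using AB x
      by (intro exI[of _ "{z \<in> topspace E. a k z \<in> A}"] exI[of _ B]) (auto simp: disjnt_iff)
  qed
  \<comment> \<open>Needed twice: with \<open>y = x\<close> and the nonzero residues, to find a
    neighbourhood disjoint from its translates, and with all residues, to separate two
    orbits.\<close>
  have nhds: "\<exists>O1 O2. openin E O1 \<and> openin E O2 \<and> x \<in> O1 \<and> y \<in> O2 \<and> (\<forall>k \<in> S. \<forall>z \<in> O1. a k z \<notin> O2)"
    if "finite S" "x \<in> topspace E" "y \<in> topspace E" "\<And>k. k \<in> S \<Longrightarrow> y \<noteq> a k x" for x y and S :: "int set"
    using that
  proof (induction S rule: finite_induct)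
    case empty
    then show ?case using openin_topspace by auto
  next
    case (insert k S)
    obtain O1 O2 where 1: "openin E O1" "openin E O2" "x \<in> O1" "y \<in> O2" "\<And>k z. k \<in> S \<Longrightarrow> z \<in> O1 \<Longrightarrow> a k z \<notin> O2"
      using insert by (metis insertCI)
    obtain A B where 2: "openin E A" "openin E B" "x \<in> A" "y \<in> B" "\<And>z. z \<in> A \<Longrightarrow> a k z \<notin> B"
      using nhd[of x y k] insert.prems by (metis insertCI)
    show ?case using 1 2 by (intro exI[of _ "O1 \<inter> A"] exI[of _ "O2 \<inter> B"]) auto
  qed
  have small: "\<exists>K \<in> \<K>. x \<in> K \<and> K \<subseteq> U" if U: "openin E U" "x \<in> U" for x U
  proof -
    have xE: "x \<in> topspace E" using U openin_subset by blast
    obtain W and \<psi> :: "'b \<Rightarrow> 'u" where W: "openin E W" "x \<in> W" "continuous_map (subtopology E W) euclidean \<psi>" "inj_on \<psi> W"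
      using chart[OF xE] by blast
    have "x \<noteq> a k x" if "k \<in> {1..<int p}" for k
      using a_fix[OF xE, of k] zdvd_not_zless[of k "int p"] that by auto
    then obtain O1 O2 where O: "openin E O1" "openin E O2" "x \<in> O1" "x \<in> O2"
        "\<And>k z. k \<in> {1..<int p} \<Longrightarrow> z \<in> O1 \<Longrightarrow> a k z \<notin> O2"
      using nhds[of "{1..<int p}" x x] xE by (metis finite_atLeastLessThan_int)
    let ?W = "W \<inter> O1 \<inter> O2"
    have oW: "openin E (?W \<inter> U)" using W O U by auto
    have "regular_space E" using compact Hausdorff compact_Hausdorff_imp_regular_space by blast
    then obtain V C where VC: "openin E V" "closedin E C" "x \<in> V" "V \<subseteq> C" "C \<subseteq> ?W \<inter> U"
      using oW W(2) O U(2) unfolding neighbourhood_base_of_closedin[symmetric] neighbourhood_base_of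
      by (metis IntI)
    obtain V' where V': "V' \<in> \<B>" "x \<in> V'" "V' \<subseteq> V" using \<B>(3)[OF VC(1,3)] by blast
    let ?K = "E closure_of V'"
    have K: "?K \<subseteq> ?W \<inter> U" using closure_of_minimal[of V' C E] V' VC by blast
    have xK: "x \<in> ?K" using closure_of_subset[OF openin_subset[OF \<B>(2)[OF V'(1)]]] V'(2) by blast
    have "nice ?K"
      unfolding nice_def
    proof (intro conjI exI)
      show "?K \<subseteq> ?W" using K by blast
      have "continuous_map (subtopology E ?W) euclidean \<psi>"
        by (rule continuous_map_from_subtopology_mono[OF W(3)]) blast
      moreover have "inj_on \<psi> ?W" by (rule inj_on_subset[OF W(4)]) blast
      moreover have "openin E ?W" using W O by auto
      ultimately show "free_chart ?W \<psi>" unfolding free_chart_def using O(5) by blast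
    qed auto
    then show ?thesis using V'(1) xK K by (auto simp: \<K>_def)
  qed
  have "countable \<K>" using \<B>(1) by (simp add: \<K>_def)
  then have "countable (\<K> \<times> \<K>)" by blast
  then have "countable I" unfolding I_def by (rule countable_subset[rotated]) auto
  have nK: "nice K" "K \<in> \<K> \<Longrightarrow> closedin E K" if "K \<in> \<K>" for K using that by (auto simp: \<K>_def nice_def)
  obtain F where F: "continuous_map E euclidean F" "\<And>i. i \<in> I \<Longrightarrow> (\<lambda>(K, K'). separated K K') i F"
  proof (rule generic_continuous_map_exists[OF compact \<open>countable I\<close>, of "\<lambda>(K, K'). separated K K'"])
    fix i and f :: "'b \<Rightarrow> 'v" assume "i \<in> I" "continuous_map E euclidean f" and sep: "(case i of (K, K') \<Rightarrow> separated K K') f"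
    then obtain K K' where i: "i = (K, K')" "closedin E K" "closedin E K'" using nK by (auto simp: I_def)
    then have "compactin E K" "compactin E K'" using compact closedin_compact_space by blast+
    then show "\<exists>\<delta>>0. \<forall>g. continuous_map E euclidean g \<longrightarrow> (\<forall>x\<in>topspace E. norm (f x - g x) < \<delta>) \<longrightarrow>
        (case i of (K, K') \<Rightarrow> separated K K') g"
      using separated_open[of K K' f] \<open>continuous_map E euclidean f\<close> sep i(1) by simp
  next
    fix i and f :: "'b \<Rightarrow> 'v" and e :: real assume i: "i \<in> I" and f: "continuous_map E euclidean f" and e: "e > 0"
    obtain K K' where KK: "i = (K, K')" "nice K" "nice K'" "orbit_hull K \<inter> orbit_hull K' = {}"
      using i nK by (auto simp: I_def)
    obtain W and \<psi> :: "'b \<Rightarrow> 'u" where W: "closedin E K" "K \<subseteq> W" "free_chart W \<psi>"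
      using KK(2) unfolding nice_def by blast
    obtain W' and \<psi>' :: "'b \<Rightarrow> 'u" where W': "closedin E K'" "K' \<subseteq> W'" "free_chart W' \<psi>'"
      using KK(3) unfolding nice_def by blast
    show "\<exists>g. continuous_map E euclidean g \<and> (\<forall>x\<in>topspace E. norm (f x - g x) \<le> e) \<and>
        (case i of (K, K') \<Rightarrow> separated K K') g"
      using separated_dense[OF dim W(3) W'(3) W(1,2) W'(1,2) KK(4) f e] KK(1) by simp
  qed (rule that)
  let ?f = "avg F"
  note f = continuous_avg[OF F(1)]
  have sep: "norm (?f y) *\<^sub>R ?f x \<noteq> norm (?f x) *\<^sub>R ?f y"
    if xy: "x \<in> topspace E" "y \<in> topspace E" "\<And>k. y \<noteq> a k x" for x y
  proof -
    obtain O1 O2 where O: "openin E O1" "openin E O2" "x \<in> O1" "y \<in> O2"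
        "\<And>k z. k \<in> {0..<int p} \<Longrightarrow> z \<in> O1 \<Longrightarrow> a k z \<notin> O2"
      using nhds[of "{0..<int p}" x y] xy by (metis finite_atLeastLessThan_int)
    obtain K where K: "K \<in> \<K>" "x \<in> K" "K \<subseteq> O1" using small[OF O(1,3)] by blast
    obtain K' where K': "K' \<in> \<K>" "y \<in> K'" "K' \<subseteq> O2" using small[OF O(2,4)] by blast
    have "orbit_hull K \<inter> orbit_hull K' = {}"
    proof (rule ccontr)
      assume "orbit_hull K \<inter> orbit_hull K' \<noteq> {}"
      then obtain z w i j where zw: "z \<in> K" "w \<in> K'" "a i z = a j w" by (auto simp: orbit_hull_def)
      have zE: "z \<in> topspace E" "w \<in> topspace E" using zw K(3) K'(3) O(1,2) openin_subset by blast+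
      have "w = a (- j) (a i z)" using zw(3) a_minus(1)[OF zE(2)] by simp
      then have "w = a ((i - j) mod int p) z" using a_add[OF zE(1), of "- j" i] a_mod[OF zE(1)] by simp
      then show False using O(5)[of "(i - j) mod int p" z] zw K(3) K'(3) p by auto
    qed
    then have "separated K K' F" using F(2)[of "(K, K')"] K K' by (simp add: I_def)
    then show ?thesis using K(2) K'(2) by (simp add: separated_def)
  qed
  have nz: "?f x \<noteq> 0" if "x \<in> topspace E" for x
    using two[OF that] sep[OF that] by force
  define \<epsilon> where "\<epsilon> x = (1 / norm (?f x)) *\<^sub>R ?f x" for x
  have eq: "\<epsilon> (a k x) = R k (\<epsilon> x)" if "x \<in> topspace E" for k x
    using avg_equivariant[OF that] by (simp add: \<epsilon>_def R_norm linear_scale[OF R_linear])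
  have norm1: "norm (\<epsilon> x) = 1" if "x \<in> topspace E" for x
    using nz[OF that] by (simp add: \<epsilon>_def)
  have "continuous_map E euclidean \<epsilon>"
    unfolding \<epsilon>_def using nz f
    by (intro continuous_map_scaleR continuous_map_real_divide continuous_map_norm) auto
  then have cont: "continuous_map E (top_of_set (sphere 0 1)) \<epsilon>"
    using norm1 by (auto simp: continuous_map_in_subtopology)
  have inj: "inj_on \<epsilon> (topspace E)"
  proof (rule inj_onI)
    fix x y assume x: "x \<in> topspace E" and y: "y \<in> topspace E" and e: "\<epsilon> x = \<epsilon> y"
    show "x = y"
    proof (cases "\<exists>k. y = a k x")
      case True
      then obtain k where k: "y = a k x" by blast
      then have "R k (\<epsilon> x) = \<epsilon> x" using eq[OF x, of k] e by simp
      then have "int p dvd k" using R_fix[of "\<epsilon> x" k] norm1[OF x] by force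
      then show ?thesis using a_fix[OF x, of k] k by metis
    next
      case False
      have "(norm (?f y) * norm (?f x)) *\<^sub>R \<epsilon> x = (norm (?f y) * norm (?f x)) *\<^sub>R \<epsilon> y" using e by simp
      then have "norm (?f y) *\<^sub>R ?f x = norm (?f x) *\<^sub>R ?f y" using nz[OF x] nz[OF y] by (simp add: \<epsilon>_def)
      then show ?thesis using sep[OF x y] False by blast
    qed
  qed
  have "closed_map E (top_of_set (sphere 0 1)) \<epsilon>"
    by (rule continuous_imp_closed_map[OF cont compact]) (simp add: Hausdorff_space_subtopology)
  then have "embedding_map E (top_of_set (sphere 0 1)) \<epsilon>"
    using cont inj by (simp add: injective_closed_imp_embedding_map)
  then show ?thesis using that eq by blast
qed

end

section \<open>Covers of closed 3-manifolds\<close>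

lemma locally_path_connected_space_if_open_cover:
  assumes "\<And>x. x \<in> topspace X \<Longrightarrow> \<exists>U. openin X U \<and> x \<in> U \<and> locally_path_connected_space (subtopology X U)"
  shows "locally_path_connected_space X"
  unfolding locally_path_connected_space
proof (intro allI impI, elim conjE)
  fix V x assume V: "openin X V" "x \<in> V"
  then have "x \<in> topspace X" using openin_subset by blast
  then obtain U where U: "openin X U" "x \<in> U" "locally_path_connected_space (subtopology X U)"
    using assms by blast
  have "openin (subtopology X U) (U \<inter> V)" "x \<in> U \<inter> V" using U V by (auto simp: openin_open_subtopology)
  then obtain N where "openin (subtopology X U) N" "path_connectedin (subtopology X U) N" "x \<in> N" "N \<subseteq> U \<inter> V"
    using U(3) unfolding locally_path_connected_space by blast
  then show "\<exists>U. openin X U \<and> path_connectedin X U \<and> x \<in> U \<and> U \<subseteq> V"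
    using U(1) by (intro exI[of _ N]) (auto simp: openin_open_subtopology path_connectedin_subtopology)
qed

lemma compact_space_finite_subcover:
  assumes "compact_space X" "\<And>x. x \<in> topspace X \<Longrightarrow> openin X (N x) \<and> x \<in> N x"
  obtains S where "finite S" "S \<subseteq> topspace X" "topspace X \<subseteq> \<Union>(N ` S)"
proof -
  have "(\<forall>U \<in> N ` topspace X. openin X U) \<and> topspace X \<subseteq> \<Union>(N ` topspace X)" using assms(2) by blast
  then have "\<exists>\<F>. finite \<F> \<and> \<F> \<subseteq> N ` topspace X \<and> topspace X \<subseteq> \<Union>\<F>"
    using assms(1) unfolding compact_space_alt by (elim allE impE)
  then show ?thesis using that by (metis finite_subset_image)
qed

lemma second_countable_if_finite_open_cover:
  assumes fin: "finite \<U>" and cover: "topspace X \<subseteq> \<Union>\<U>"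
    and U: "\<And>U. U \<in> \<U> \<Longrightarrow> openin X U \<and> second_countable (subtopology X U)"
  shows "second_countable X"
proof -
  have "\<forall>U \<in> \<U>. \<exists>\<B>. countable \<B> \<and> (\<forall>V \<in> \<B>. openin (subtopology X U) V) \<and>
      (\<forall>W x. openin (subtopology X U) W \<and> x \<in> W \<longrightarrow> (\<exists>V \<in> \<B>. x \<in> V \<and> V \<subseteq> W))"
    using U unfolding second_countable_def by blast
  then obtain \<B> where \<B>: "\<And>U. U \<in> \<U> \<Longrightarrow> countable (\<B> U)"
    "\<And>U V. U \<in> \<U> \<Longrightarrow> V \<in> \<B> U \<Longrightarrow> openin (subtopology X U) V"
    "\<And>U W x. U \<in> \<U> \<Longrightarrow> openin (subtopology X U) W \<Longrightarrow> x \<in> W \<Longrightarrow> \<exists>V \<in> \<B> U. x \<in> V \<and> V \<subseteq> W"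
    by metis
  show ?thesis
    unfolding second_countable_def
  proof (intro exI[of _ "\<Union>U\<in>\<U>. \<B> U"] conjI ballI allI impI)
    show "countable (\<Union>U\<in>\<U>. \<B> U)" by (rule countable_UN[OF countable_finite[OF fin] \<B>(1)])
    show "openin X V" if "V \<in> (\<Union>U\<in>\<U>. \<B> U)" for V
      using that \<B>(2) U by (auto simp: openin_open_subtopology)
    fix W x assume W: "openin X W \<and> x \<in> W"
    then obtain V where V: "V \<in> \<U>" "x \<in> V" using cover openin_subset by blast
    then have "openin (subtopology X V) (V \<inter> W)" using U[OF V(1)] W by (auto simp: openin_open_subtopology)
    then show "\<exists>B \<in> (\<Union>U\<in>\<U>. \<B> U). x \<in> B \<and> B \<subseteq> W" using \<B>(3)[OF V(1), of "V \<inter> W" x] V W by blast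
  qed
qed

lemma second_countable_Euclidean_space: "second_countable (Euclidean_space n)"
proof -
  obtain B :: "(nat \<Rightarrow> real) set set" where B: "countable B" "topological_basis B"
    using ex_countable_basis by blast
  have "second_countable (euclidean :: (nat \<Rightarrow> real) topology)"
    unfolding second_countable_def
  proof (intro exI[of _ B] conjI ballI allI impI)
    show "openin euclidean V" if "V \<in> B" for V using B(2) that by (simp add: topological_basis_open)
    show "\<exists>V\<in>B. x \<in> V \<and> V \<subseteq> U" if "openin euclidean U \<and> x \<in> U" for U x
    proof -
      have "open U" "x \<in> U" using that by auto
      then show ?thesis using topological_basisE[OF B(2), of U x] by metis
    qed
  qed (rule B(1))
  then show ?thesis
    unfolding Euclidean_space_def euclidean_product_topology by (rule second_countable_subtopology)
qed

text \<open>A small change of the coordinate with index 0 stays in the open set;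
  \<open>n > 0\<close> makes it a coordinate of the space.\<close>

lemma Euclidean_space_open_not_singleton:
  assumes V: "openin (Euclidean_space n) V" "x \<in> V" and n: "n > 0"
  shows "\<exists>y \<in> V. y \<noteq> x"
proof -
  have x: "\<forall>i\<ge>n. x i = 0" using V openin_subset by (fastforce simp: topspace_Euclidean_space)
  have "continuous_map euclideanreal (Euclidean_space n) (\<lambda>t i. if i = 0 then x 0 + t else x i)"
    using x n unfolding Euclidean_space_def
    by (auto simp: continuous_map_in_subtopology continuous_map_componentwise_UNIV intro!: continuous_intros)
  from openin_continuous_map_preimage[OF this V(1)]
  have op: "open {t. (\<lambda>i. if i = 0 then x 0 + t else x i) \<in> V}" by simp
  have "(\<lambda>i. if i = 0 then x 0 + 0 else x i) = x" by auto
  then have "0 \<in> {t. (\<lambda>i. if i = 0 then x 0 + t else x i) \<in> V}" using V(2) by simp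
  then obtain e where e: "e > 0" "ball 0 e \<subseteq> {t. (\<lambda>i. if i = 0 then x 0 + t else x i) \<in> V}"
    using op open_contains_ball by blast
  then have "e / 2 \<in> {t. (\<lambda>i. if i = 0 then x 0 + t else x i) \<in> V}" by (intro subsetD[OF e(2)]) auto
  moreover have "(\<lambda>i. if i = 0 then x 0 + e / 2 else x i) \<noteq> x" using e(1) by (auto simp: fun_eq_iff)
  ultimately show ?thesis by blast
qed

section \<open>Charts and compactness of the cover\<close>

text \<open>A chart of \<open>M\<close> is pulled back along the part of a sheet that lies over its
  domain. Injectivity of \<open>c\<close> on \<open>W\<close> is recorded for
  \<open>other_fibre\<close>.\<close>

lemma covering_chart:
  assumes cov: "covering_map E M c" and M: "closed_manifold 3 M" and y: "y \<in> topspace E"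
  obtains W \<phi> where "openin E W" "y \<in> W" "openin (Euclidean_space 3) (\<phi> ` W)"
    "homeomorphic_map (subtopology E W) (subtopology (Euclidean_space 3) (\<phi> ` W)) \<phi>" "inj_on c W"
proof -
  have cy: "c y \<in> topspace M" using cov y covering_map_in_topspace by metis
  obtain U V where U: "openin M U"
    and V: "y \<in> V" "openin E V" "homeomorphic_map (subtopology E V) (subtopology M U) c"
    using covering_map_sheet[OF cov y] by metis
  obtain U1 V1 where U1: "c y \<in> U1" "openin M U1" "openin (Euclidean_space 3) V1"
    "subtopology M U1 homeomorphic_space subtopology (Euclidean_space 3) V1"
    using M cy unfolding closed_manifold_def by blast
  then obtain \<phi> where \<phi>: "homeomorphic_map (subtopology M U1) (subtopology (Euclidean_space 3) V1) \<phi>"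
    using homeomorphic_space by blast
  have tops: "topspace (subtopology E V) = V" "topspace (subtopology M U) = U" "topspace (subtopology M U1) = U1"
    "topspace (subtopology (Euclidean_space 3) V1) = V1"
    using V(2) U U1(2,3) openin_subset by (auto simp: Int_absorb1)
  define W where "W = {v \<in> V. c v \<in> U1}"
  have cV: "c ` V = U" using homeomorphic_imp_surjective_map[OF V(3)] tops by simp
  have W: "openin E W"
  proof -
    have "openin (subtopology E V) {v \<in> topspace (subtopology E V). c v \<in> U \<inter> U1}"
      using U U1(2) by (intro openin_continuous_map_preimage[OF homeomorphic_imp_continuous_map[OF V(3)]])
        (auto simp: openin_open_subtopology)
    moreover have "{v \<in> topspace (subtopology E V). c v \<in> U \<inter> U1} = W" using cV tops by (auto simp: W_def)
    ultimately show ?thesis using V(2) by (simp add: openin_open_subtopology)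
  qed
  have cW: "c ` W = U \<inter> U1" using cV by (auto simp: W_def)
  have h1: "homeomorphic_map (subtopology E W) (subtopology M (U \<inter> U1)) c"
  proof -
    have "homeomorphic_map (subtopology (subtopology E V) W) (subtopology (subtopology M U) (U \<inter> U1)) c"
      by (rule homeomorphic_map_subtopologies[OF V(3)]) (use cW tops in \<open>auto simp: W_def\<close>)
    then show ?thesis by (simp add: subtopology_subtopology W_def Int_absorb1 Collect_subset)
  qed
  have h2: "homeomorphic_map (subtopology M (U \<inter> U1)) (subtopology (Euclidean_space 3) (\<phi> ` (U \<inter> U1))) \<phi>"
  proof -
    have sub: "\<phi> ` (U \<inter> U1) \<subseteq> V1" using homeomorphic_imp_surjective_map[OF \<phi>] tops by auto
    have "homeomorphic_map (subtopology (subtopology M U1) (U \<inter> U1)) (subtopology (subtopology (Euclidean_space 3) V1) (\<phi> ` (U \<inter> U1))) \<phi>"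
      by (rule homeomorphic_map_subtopologies[OF \<phi>]) (use sub tops in auto)
    then show ?thesis using sub by (simp add: subtopology_subtopology Int_absorb1)
  qed
  have "openin (subtopology (Euclidean_space 3) V1) (\<phi> ` (U \<inter> U1))"
    using homeomorphic_imp_open_map[OF \<phi>] U U1 by (auto simp: open_map_def openin_open_subtopology)
  then have op: "openin (Euclidean_space 3) (\<phi> ` (U \<inter> U1))" using U1(3) by (simp add: openin_open_subtopology)
  have im: "(\<phi> \<circ> c) ` W = \<phi> ` (U \<inter> U1)" unfolding image_comp[symmetric] cW ..
  show ?thesis
  proof (rule that[OF W])
    show "y \<in> W" using V(1) U1(1) by (simp add: W_def)
    show "openin (Euclidean_space 3) ((\<phi> \<circ> c) ` W)" using op im by simp
    show "homeomorphic_map (subtopology E W) (subtopology (Euclidean_space 3) ((\<phi> \<circ> c) ` W)) (\<phi> \<circ> c)"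
      unfolding im by (rule homeomorphic_map_compose[OF h1 h2])
    show "inj_on c W"
      using homeomorphic_imp_injective_map[OF h1] openin_subset[OF W] by (simp add: Int_absorb1)
  qed
qed

lemma locally_path_connected_covering:
  assumes "covering_map E M c" "closed_manifold 3 M"
  shows "locally_path_connected_space E"
proof (rule locally_path_connected_space_if_open_cover)
  fix y assume "y \<in> topspace E"
  then obtain W \<phi> where W: "openin E W" "y \<in> W" "openin (Euclidean_space 3) (\<phi> ` W)"
    "homeomorphic_map (subtopology E W) (subtopology (Euclidean_space 3) (\<phi> ` W)) \<phi>"
    using covering_chart[OF assms] by metis
  have "locally_path_connected_space (subtopology (Euclidean_space 3) (\<phi> ` W))"
    using W(3) locally_path_connected_Euclidean_space locally_path_connected_space_open_subset by blast
  then show "\<exists>U. openin E U \<and> y \<in> U \<and> locally_path_connected_space (subtopology E U)"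
    using W homeomorphic_locally_path_connected_space homeomorphic_map_imp_homeomorphic_space by blast
qed

lemma Hausdorff_covering:
  assumes cov: "covering_map E M c" and M: "Hausdorff_space M"
  shows "Hausdorff_space E"
  unfolding Hausdorff_space_def
proof (intro allI impI, elim conjE)
  fix y y' assume y: "y \<in> topspace E" "y' \<in> topspace E" "y \<noteq> y'"
  show "\<exists>U V. openin E U \<and> openin E V \<and> y \<in> U \<and> y' \<in> V \<and> disjnt U V"
  proof (cases "c y = c y'")
    case True
    have "c y \<in> topspace M" using cov y covering_map_in_topspace by metis
    then show ?thesis using covering_map_sheets[OF cov] y True by metis
  next
    case False
    then obtain U V where UV: "openin M U" "openin M V" "c y \<in> U" "c y' \<in> V" "disjnt U V"
      using M cov y covering_map_in_topspace unfolding Hausdorff_space_def by metis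
    then show ?thesis
      using openin_continuous_map_preimage[OF covering_map_continuous[OF cov]] y
      by (intro exI[of _ "{z \<in> topspace E. c z \<in> U}"] exI[of _ "{z \<in> topspace E. c z \<in> V}"])
        (auto simp: disjnt_iff)
  qed
qed

text \<open>A sheet contains a compact lift of a small compact neighbourhood in \<open>M\<close>.
  Finitely many such neighbourhoods cover \<open>M\<close>, and as deck transformations are
  transitive on fibres, the finitely many translates of the lifts cover \<open>E\<close>.\<close>

lemma compact_finite_covering:
  assumes uc: "universal_covering E M c" and M: "compact_space M" "Hausdorff_space M"
    and fin: "finite {h. deck_transformation E c h}"
  shows "compact_space E"
proof -
  interpret universal_covering E M c by fact
  have nb: "\<exists>N K. openin M N \<and> x \<in> N \<and> compactin E K \<and> N \<subseteq> c ` K" if x: "x \<in> topspace M" for x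
  proof -
    obtain y where y: "y \<in> topspace E" "c y = x" using covering_map_surj[OF cov x] by blast
    obtain U V where U: "openin M U"
      and V: "y \<in> V" "openin E V" "homeomorphic_map (subtopology E V) (subtopology M U) c"
      using covering_map_sheet[OF cov y(1)] by metis
    obtain s where s: "continuous_map (subtopology M U) E s" "\<And>u. u \<in> U \<Longrightarrow> s u \<in> V \<and> c (s u) = u"
      and xU: "x \<in> U"
      using sheet_section[OF V(3,2) U] V(1) y(2) by metis
    have "regular_space M" using M compact_Hausdorff_imp_regular_space by blast
    then obtain N C where N: "openin M N" "closedin M C" "x \<in> N" "N \<subseteq> C" "C \<subseteq> U"
      using U xU unfolding neighbourhood_base_of_closedin[symmetric] neighbourhood_base_of by metis
    have "compactin M C" using M(1) N(2) closedin_compact_space by blast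
    then have "compactin (subtopology M U) C" using N(5) by (simp add: compactin_subtopology)
    then have "compactin E (s ` C)" using image_compactin s(1) by blast
    moreover have "N \<subseteq> c ` (s ` C)" using N(4,5) s(2) by (force simp: image_iff)
    ultimately show ?thesis using N(1,3) by blast
  qed
  then obtain N K where NK: "\<And>x. x \<in> topspace M \<Longrightarrow> openin M (N x) \<and> x \<in> N x \<and> compactin E (K x) \<and> N x \<subseteq> c ` K x"
    by metis
  obtain S where S: "finite S" "S \<subseteq> topspace M" "topspace M \<subseteq> \<Union>(N ` S)"
    by (rule compact_space_finite_subcover[OF M(1), of N]) (use NK in auto)
  let ?D = "{h. deck_transformation E c h}"
  have "topspace E \<subseteq> (\<Union>h\<in>?D. \<Union>x\<in>S. h ` K x)"
  proof
    fix z assume z: "z \<in> topspace E"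
    then have "c z \<in> topspace M" using cov covering_map_in_topspace by metis
    then obtain x where x: "x \<in> S" "c z \<in> N x" using S(3) by blast
    have xM: "x \<in> topspace M" using x(1) S(2) by blast
    have "c z \<in> c ` K x" using NK[OF xM] x(2) by blast
    then obtain k where k: "k \<in> K x" "c k = c z" by (metis imageE)
    have "k \<in> topspace E" using compactin_subset_topspace[of E "K x"] NK[OF xM] k(1) by blast
    then obtain h where "deck_transformation E c h" "h k = z" using deck_transformation_exists[of k z] z k(2) by metis
    then show "z \<in> (\<Union>h\<in>?D. \<Union>x\<in>S. h ` K x)" using x(1) k(1) by blast
  qed
  moreover have "compactin E (\<Union>h\<in>?D. \<Union>x\<in>S. h ` K x)"
  proof (intro compactin_Union finite_imageI fin S(1); clarify)
    show "compactin E (\<Union>x\<in>S. h ` K x)" if h: "deck_transformation E c h" for h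
    proof (intro compactin_Union finite_imageI S(1); clarify)
      show "compactin E (h ` K x)" if "x \<in> S" for x
        using image_compactin[OF _ deck_transformationD(1)[OF h]] NK S(2) that by blast
    qed
  qed
  ultimately show ?thesis
    unfolding compact_space_def using compactin_subset_topspace by (metis subset_antisym)
qed

lemma second_countable_covering:
  assumes "covering_map E M c" "closed_manifold 3 M" "compact_space E"
  shows "second_countable E"
proof -
  have "\<exists>W. openin E W \<and> y \<in> W \<and> second_countable (subtopology E W)" if y: "y \<in> topspace E" for y
  proof -
    obtain W \<phi> where W: "openin E W" "y \<in> W"
      "homeomorphic_map (subtopology E W) (subtopology (Euclidean_space 3) (\<phi> ` W)) \<phi>"
      using covering_chart[OF assms(1,2) y] by blast
    have "second_countable (subtopology (Euclidean_space 3) (\<phi> ` W))"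
      by (intro second_countable_subtopology second_countable_Euclidean_space)
    then show ?thesis using W homeomorphic_space_second_countability homeomorphic_map_imp_homeomorphic_space by blast
  qed
  then obtain W where W: "\<And>y. y \<in> topspace E \<Longrightarrow> openin E (W y) \<and> y \<in> W y \<and> second_countable (subtopology E (W y))"
    by metis
  obtain S where S: "finite S" "S \<subseteq> topspace E" "topspace E \<subseteq> \<Union>(W ` S)"
    by (rule compact_space_finite_subcover[OF assms(3), of W]) (use W in auto)
  then show ?thesis using W by (intro second_countable_if_finite_open_cover[of "W ` S"]) auto
qed

text \<open>The chart is moved from \<open>Euclidean_space 3\<close>, a space of sequences, into a
  type of dimension 3, so that \<open>DIM\<close> counts the parameters in the general position
  argument.\<close>

lemma coordinate_chart:
  assumes "covering_map E M c" "closed_manifold 3 M" "y \<in> topspace E"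
  shows "\<exists>W \<psi>. openin E W \<and> y \<in> W \<and>
      continuous_map (subtopology E W) euclidean (\<psi> :: _ \<Rightarrow> real \<times> real \<times> real) \<and> inj_on \<psi> W"
proof -
  obtain W \<phi> where W: "openin E W" "y \<in> W" "openin (Euclidean_space 3) (\<phi> ` W)"
    "homeomorphic_map (subtopology E W) (subtopology (Euclidean_space 3) (\<phi> ` W)) \<phi>"
    using covering_chart[OF assms] by blast
  let ?r = "\<lambda>x :: nat \<Rightarrow> real. (x 0, x 1, x 2)"
  have "continuous_map (subtopology E W) (Euclidean_space 3) \<phi>"
    using homeomorphic_imp_continuous_map[OF W(4)] by (simp add: continuous_map_in_subtopology)
  then have "continuous_map (subtopology E W) euclidean \<phi>"
    by (simp add: Euclidean_space_def euclidean_product_topology continuous_map_in_subtopology)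
  moreover have "continuous_map euclidean euclidean ?r"
    by (auto intro!: continuous_intros continuous_on_coordinate)
  ultimately have "continuous_map (subtopology E W) euclidean (?r \<circ> \<phi>)" by (rule continuous_map_compose)
  moreover have "inj_on (?r \<circ> \<phi>) W"
  proof (rule comp_inj_on)
    show "inj_on \<phi> W"
      using homeomorphic_imp_injective_map[OF W(4)] openin_subset[OF W(1)] by (simp add: Int_absorb1)
    have "\<phi> ` W \<subseteq> {x. \<forall>i\<ge>3. x i = 0}" using openin_subset[OF W(3)] by (auto simp: topspace_Euclidean_space)
    moreover have "inj_on ?r {x. \<forall>i\<ge>3. x i = 0}"
    proof (rule inj_onI)
      fix x y :: "nat \<Rightarrow> real" assume *: "x \<in> {x. \<forall>i\<ge>3. x i = 0}" "y \<in> {x. \<forall>i\<ge>3. x i = 0}" "?r x = ?r y"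
      have "x i = y i" for i
      proof -
        have "i = 0 \<or> i = 1 \<or> i = 2 \<or> i \<ge> 3" by arith
        then show ?thesis using * by auto
      qed
      then show "x = y" by blast
    qed
    ultimately show "inj_on ?r (\<phi> ` W)" using inj_on_subset by blast
  qed
  ultimately show ?thesis using W(1,2) by blast
qed

text \<open>A chart domain contains a second point and \<open>c\<close> is injective on it. Points
  of different fibres lie in different deck orbits, as \<open>equivariant_embedding\<close>
  requires.\<close>

lemma other_fibre:
  assumes cov: "covering_map E M c" and M: "closed_manifold 3 M" and y: "y \<in> topspace E"
  shows "\<exists>y' \<in> topspace E. c y' \<noteq> c y"
proof -
  obtain W \<phi> where W: "openin E W" "y \<in> W" "openin (Euclidean_space 3) (\<phi> ` W)" "inj_on c W"
    using covering_chart[OF assms] by metis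
  obtain y' where "y' \<in> W" "\<phi> y' \<noteq> \<phi> y"
    using Euclidean_space_open_not_singleton[OF W(3) imageI[OF W(2)]] by auto
  then show ?thesis using W(1,2,4) openin_subset inj_onD by fastforce
qed

section \<open>The model representation and the conclusion\<close>

text \<open>Multiplying all four complex coordinates by the same root of unity fixes no nonzero
  vector unless the root is 1; a linear isometry carries this action from \<open>complex ^ 4\<close>
  to \<open>'v\<close>.\<close>

lemma cyclic_isometries_exist:
  assumes p: "p \<ge> 1" and dim: "DIM('v::euclidean_space) = 8"
  obtains R :: "int \<Rightarrow> 'v::euclidean_space \<Rightarrow> 'v" where "free_cyclic_isometries p R"
proof -
  obtain f :: "complex ^ 4 \<Rightarrow> 'v" and g where fg: "linear f" "linear g" "\<And>x. norm (f x) = norm x" "\<And>y. norm (g y) = norm y"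
    "\<And>x. g (f x) = x" "\<And>y. f (g y) = y"
    by (rule isomorphisms_UNIV_UNIV[where 'M="complex ^ 4" and 'N='v]) (use dim in auto)
  define T where "T k v = (\<chi> i. cis (2 * pi * real_of_int k / real p) * v $ i)" for k and v :: "complex ^ 4"
  have T_linear: "linear (T k)" for k
    by (rule linearI) (simp_all add: T_def vec_eq_iff distrib_left)
  have T_norm: "norm (T k v) = norm v" for k v
    by (simp add: T_def norm_vec_def norm_mult)
  have T_add: "T (j + k) v = T j (T k v)" for j k v
    by (simp add: T_def vec_eq_iff add_divide_distrib ring_distribs mult.assoc[symmetric] flip: cis_mult)
  have T_fix: "T k v = v \<longleftrightarrow> int p dvd k" if "v \<noteq> 0" for k v
    using cis_2pi_int_div_eq_1_iff[of p k] p that by (auto simp: T_def vec_eq_iff)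
  show ?thesis
  proof (rule that[of "\<lambda>k v. f (T k (g v))"], rule free_cyclic_isometries.intro)
    show "linear (\<lambda>v. f (T k (g v)))" for k
      using linear_compose[OF linear_compose[OF fg(2) T_linear[of k]] fg(1)] by (simp add: o_def)
    show "f (T k (g v)) = v \<longleftrightarrow> int p dvd k" if "v \<noteq> 0" for k v
    proof -
      have "g v \<noteq> 0" using fg(4)[of v] that by auto
      then show ?thesis using T_fix[of "g v" k] fg(5,6) by metis
    qed
  qed (use p in \<open>simp_all add: fg T_norm T_add\<close>)
qed

theorem corollary0p3:
  fixes p :: nat and q :: int
    and M :: "'a topology" and f :: "'a \<Rightarrow> (complex \<times> complex) set"
    and E :: "'b topology" and c :: "'b \<Rightarrow> 'a" and y\<^sub>0 :: 'b
  assumes "p \<ge> 1" and "coprime (int p) q"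
    and "closed_manifold 3 M" and "connected_space M"
    and "simple_homotopy_equivalence M (lens_space p q) f"
    and "universal_cover E M c" and "y\<^sub>0 \<in> topspace E"
  shows "fundamental_group M (c y\<^sub>0) \<cong> integer_mod_group p \<and>
    (\<forall>\<theta> \<in> iso (fundamental_group M (c y\<^sub>0)) (integer_mod_group p).
       \<exists>(\<rho> :: int \<Rightarrow> real^8 \<Rightarrow> real^8) (\<epsilon> :: 'b \<Rightarrow> real^8).
         free_orthogonal_sphere_action (integer_mod_group p) \<rho> \<and>
         embedding_map E (top_of_set (sphere 0 1)) \<epsilon> \<and>
         (\<forall>\<alpha> \<in> carrier (fundamental_group M (c y\<^sub>0)). \<forall>x \<in> topspace E.
            \<epsilon> (deck_action E c y\<^sub>0 \<alpha> x) = \<rho> (\<theta> \<alpha>) (\<epsilon> x)))"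
proof -
  note pq = assms(1,2) and M = assms(3) and y = assms(7)
  let ?G = "fundamental_group M (c y\<^sub>0)" and ?Z = "integer_mod_group p" and ?A = "deck_action E c y\<^sub>0"
  let ?S = "sphere 0 1 :: (complex \<times> complex) set" and ?\<pi> = "lens_orbit p q"
  let ?I = "{0..<int p}" and ?D = "{h. deck_transformation E c h}"
  let ?L = "{h. deck_transformation (top_of_set ?S) ?\<pi> h}"
  have carr: "carrier ?Z = ?I" and mult: "j \<otimes>\<^bsub>?Z\<^esub> k = (j + k) mod int p" for j k
    using pq(1) by (auto simp: integer_mod_group_def)
  have covE: "covering_map E M c" using assms(6) by (simp add: universal_cover_def)
  interpret universal_covering E M c
    using assms(6) locally_path_connected_covering[OF covE M] by unfold_locales
  note bijL = lens_deck_bij[OF pq]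
  have comm: "h (k x) = k (h x)" if hk: "h \<in> ?L" "k \<in> ?L" and x: "x \<in> topspace (top_of_set ?S)" for h k x
  proof -
    obtain i j where ij: "h = lens_deck p q i" "k = lens_deck p q j" using hk bijL unfolding bij_betw_def by blast
    then have "compose ?S h k = compose ?S k h" using lens_deck_compose[OF pq] by (simp add: add.commute)
    then have "compose ?S h k x = compose ?S k h x" by simp
    then show ?thesis using x by (simp add: compose_def)
  qed
  obtain D where D: "bij_betw D ?D ?L"
    "\<And>h k. deck_transformation E c h \<Longrightarrow> deck_transformation E c k \<Longrightarrow>
      D (compose (topspace E) h k) = compose (topspace (top_of_set ?S)) (D h) (D k)"
    by (rule deck_groups_iso[OF universal_covering_axioms universal_covering_lens[OF pq]
          simple_homotopy_equivalence_imp_homotopy_equivalent[OF assms(5)]])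
      (use y comm in auto)
  note bijA = deck_action_bij[OF y] and multA = deck_action_mult[OF y]
  have A_deck: "deck_transformation E c (?A \<alpha>)" if "\<alpha> \<in> carrier ?G" for \<alpha>
    using bijA that by (auto simp: bij_betw_def)
  \<comment> \<open>Finiteness comes from the lens space through \<open>D\<close>; it yields
    compactness of \<open>E\<close> below.\<close>
  have fin: "finite ?D" using bij_betw_finite[OF D(1)] bij_betw_finite[OF bijL] by simp
  \<comment> \<open>A class acts as a deck transformation of \<open>E\<close>, which corresponds to
    a rotation of the 3-sphere, which is read as a residue.\<close>
  let ?\<Theta> = "inv_into ?I (lens_deck p q) \<circ> (D \<circ> ?A)"
  have bij\<Theta>: "bij_betw ?\<Theta> (carrier ?G) ?I"
    by (intro bij_betw_trans[OF bij_betw_trans[OF bijA D(1)]] bij_betw_inv_into bijL)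
  have "?\<Theta> \<in> iso ?G ?Z"
    unfolding iso_def
  proof (intro CollectI conjI homI)
    show "?\<Theta> \<alpha> \<in> carrier ?Z" if "\<alpha> \<in> carrier ?G" for \<alpha>
      using bij_betw_apply[OF bij\<Theta> that] carr by simp
    show "bij_betw ?\<Theta> (carrier ?G) (carrier ?Z)" using bij\<Theta> carr by simp
    fix \<alpha> \<beta> assume ab: "\<alpha> \<in> carrier ?G" "\<beta> \<in> carrier ?G"
    have l: "lens_deck p q (?\<Theta> \<gamma>) = D (?A \<gamma>)" if "\<gamma> \<in> carrier ?G" for \<gamma>
    proof -
      have "D (?A \<gamma>) \<in> lens_deck p q ` ?I"
        using bij_betw_apply[OF D(1)] A_deck[OF that] bijL by (auto simp: bij_betw_def)
      then show ?thesis by (simp add: f_inv_into_f)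
    qed
    have "lens_deck p q (?\<Theta> (\<alpha> \<otimes>\<^bsub>?G\<^esub> \<beta>)) = D (compose (topspace E) (?A \<alpha>) (?A \<beta>))"
      using l[OF multA(1)[OF ab]] multA(2)[OF ab] by simp
    also have "\<dots> = compose ?S (lens_deck p q (?\<Theta> \<alpha>)) (lens_deck p q (?\<Theta> \<beta>))"
      using D(2) A_deck ab l by simp
    also have "\<dots> = lens_deck p q ((?\<Theta> \<alpha> + ?\<Theta> \<beta>) mod int p)" by (rule lens_deck_compose[OF pq])
    finally show "?\<Theta> (\<alpha> \<otimes>\<^bsub>?G\<^esub> \<beta>) = ?\<Theta> \<alpha> \<otimes>\<^bsub>?Z\<^esub> ?\<Theta> \<beta>"
      using bijL bij_betw_apply[OF bij\<Theta> multA(1)[OF ab]] pq(1)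
      unfolding mult bij_betw_def inj_on_def by auto
  qed
  then have iso: "?G \<cong> ?Z" unfolding is_iso_def by blast
  have cE: "compact_space E"
    using compact_finite_covering[OF universal_covering_axioms _ _ fin] M by (simp add: closed_manifold_def)
  have HE: "Hausdorff_space E"
    using Hausdorff_covering[OF covE] M by (simp add: closed_manifold_def)
  obtain R :: "int \<Rightarrow> real^8 \<Rightarrow> real^8" where R: "free_cyclic_isometries p R"
    by (rule cyclic_isometries_exist[OF pq(1), where 'v="real^8"]) auto
  have "\<exists>(\<rho> :: int \<Rightarrow> real^8 \<Rightarrow> real^8) (\<epsilon> :: 'b \<Rightarrow> real^8).
         free_orthogonal_sphere_action ?Z \<rho> \<and> embedding_map E (top_of_set (sphere 0 1)) \<epsilon> \<and>
         (\<forall>\<alpha> \<in> carrier ?G. \<forall>x \<in> topspace E. \<epsilon> (?A \<alpha> x) = \<rho> (\<theta> \<alpha>) (\<epsilon> x))"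
    if \<theta>: "\<theta> \<in> iso ?G ?Z" for \<theta>
  proof -
    have bij: "bij_betw \<theta> (carrier ?G) ?I" and hom: "\<And>\<alpha> \<beta>. \<alpha> \<in> carrier ?G \<Longrightarrow> \<beta> \<in> carrier ?G \<Longrightarrow>
        \<theta> (\<alpha> \<otimes>\<^bsub>?G\<^esub> \<beta>) = (\<theta> \<alpha> + \<theta> \<beta>) mod int p"
      using \<theta> carr mult by (auto simp: iso_def hom_def)
    \<comment> \<open>The inverse of the given \<open>\<theta>\<close>, extended periodically to all
      integers. The identification enters only through this indexing of the deck transformations, so
      one representation \<open>R\<close> serves every \<open>\<theta>\<close>.\<close>
    define \<tau> where "\<tau> k = inv_into (carrier ?G) \<theta> (k mod int p)" for k
    have kI: "k mod int p \<in> ?I" for k using pq(1) by simp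
    have \<tau>: "\<tau> k \<in> carrier ?G" "\<theta> (\<tau> k) = k mod int p" for k
      using bij kI[of k] inv_into_into[of "k mod int p" \<theta> "carrier ?G"] f_inv_into_f[of "k mod int p" \<theta> "carrier ?G"]
      by (auto simp: \<tau>_def bij_betw_def)
    have inj\<theta>: "\<alpha> = \<beta>" if "\<alpha> \<in> carrier ?G" "\<beta> \<in> carrier ?G" "\<theta> \<alpha> = \<theta> \<beta>" for \<alpha> \<beta>
      using bij that by (auto simp: bij_betw_def inj_on_def)
    have \<tau>_add: "\<tau> (j + k) = \<tau> j \<otimes>\<^bsub>?G\<^esub> \<tau> k" for j k
      by (rule inj\<theta>) (simp_all add: \<tau> multA(1) hom mod_simps)
    define a where "a k = ?A (\<tau> k)" for k
    have a: "deck_transformation E c (a k)" for k using A_deck \<tau>(1) by (simp add: a_def)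
    note aD = deck_transformationD[OF a]
    have a_add: "a (j + k) x = a j (a k x)" if "x \<in> topspace E" for j k x
      using multA(2)[OF \<tau>(1) \<tau>(1)] that by (simp add: a_def \<tau>_add compose_def)
    have a0: "a 0 x = x" if x: "x \<in> topspace E" for x
    proof -
      \<comment> \<open>An injective idempotent map is the identity; so the unit of the fundamental
        group need not be identified.\<close>
      have "a 0 (a 0 x) = a 0 x" using a_add[OF x, of 0 0] by simp
      moreover have "inj_on (a 0) (topspace E)"
        using a[of 0] by (simp add: deck_transformation_def homeomorphic_map_def)
      ultimately show ?thesis using aD(2)[OF x] x by (meson inj_onD)
    qed
    have a_fix: "a k x = x \<longleftrightarrow> int p dvd k" if x: "x \<in> topspace E" for k x
    proof
      assume "a k x = x"
      then have "a k = a 0" using deck_transformation_eqI[OF cov con a a x] a0[OF x] by simp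
      then have "\<tau> k = \<tau> 0" using bijA \<tau>(1) unfolding a_def bij_betw_def inj_on_def by blast
      then have "k mod int p = 0" using \<tau>(2)[of k] \<tau>(2)[of 0] by simp
      then show "int p dvd k" by (simp add: dvd_eq_mod_eq_0)
    next
      assume "int p dvd k"
      then have "\<tau> k = \<tau> 0" by (simp add: \<tau>_def dvd_eq_mod_eq_0)
      then have "a k = a 0" by (simp add: a_def)
      then show "a k x = x" using a0[OF x] by simp
    qed
    interpret A: free_cyclic_action p R E a
      by (intro free_cyclic_action.intro free_cyclic_action_axioms.intro) (fact R cE HE aD(1) a_add a_fix)+
    have two: "\<exists>x' \<in> topspace E. \<forall>k. x' \<noteq> a k x" if "x \<in> topspace E" for x
      using other_fibre[OF covE M that] aD(3)[OF that] by metis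
    obtain \<epsilon> :: "'b \<Rightarrow> real^8" where \<epsilon>: "embedding_map E (top_of_set (sphere 0 1)) \<epsilon>"
      "\<And>k x. x \<in> topspace E \<Longrightarrow> \<epsilon> (a k x) = R k (\<epsilon> x)"
      by (rule A.equivariant_embedding[where 'u="real \<times> real \<times> real",
            OF _ second_countable_covering[OF covE M cE] coordinate_chart[OF covE M] two]) auto
    have \<epsilon>S: "\<epsilon> x \<in> sphere 0 1" if "x \<in> topspace E" for x
      using homeomorphic_imp_surjective_map[OF \<epsilon>(1)[unfolded embedding_map_def]] that by auto
    have "\<epsilon> (?A \<alpha> x) = restrict (R (\<theta> \<alpha>)) (sphere 0 1) (\<epsilon> x)" if \<alpha>: "\<alpha> \<in> carrier ?G" and x: "x \<in> topspace E" for \<alpha> x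
    proof -
      have "\<theta> \<alpha> \<in> ?I" using bij_betw_apply[OF bij \<alpha>] .
      then have "\<tau> (\<theta> \<alpha>) = \<alpha>" using inj\<theta>[OF \<tau>(1) \<alpha>, of "\<theta> \<alpha>"] \<tau>(2) by simp
      then show ?thesis using \<epsilon>(2)[OF x, of "\<theta> \<alpha>"] \<epsilon>S[OF x] by (simp add: a_def)
    qed
    then show ?thesis
      using A.free_orthogonal_sphere_action \<epsilon>(1) by blast
  qed
  then show ?thesis using iso by blast
qed

end
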